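(* Let $\mathcal C$ be an SMI (symmetric bimonoidal intermuting) category that is strict monoidal with respect to both $(\vee,\bot)$ and $(\wedge,\top)$, and let $n,m$ be natural numbers with $n+m\geq 1$. Then the $(n,m)$-reduced bar construction based on $\mathcal C$, $$\overline{W}\mathcal C_{n,m}:(\Delta_+^{op})^{n+m}\to \mathrm{Cat},\qquad (k_1,\ldots,k_{n+m})\mapsto \mathcal C^{k_1\cdots k_{n+m}},$$ is a lax functor.
   Context: An SMI (symmetric bimonoidal intermuting) category is a category with two symmetric monoidal structures $(\vee,\bot,\check\alpha,\check\sigma,\check\rho,\check\lambda)$ and $(\wedge,\top,\hat\alpha,\hat\sigma,\hat\rho,\hat\lambda)$, where $\check\alpha^{\to}_{A,B,C}:A\vee(B\vee C)\to(A\vee B)\vee C$, $\check\sigma_{A,B}:A\vee B\to B\vee A$, $\check\rho^{\to}_A:A\vee\bot\to A$, $\check\lambda^{\to}_A:\bot\vee A\to A$ are the structural natural isomorphisms (with inverses $\check\alpha^{\leftarrow},\check\rho^{\leftarrow},\check\lambda^{\leftarrow}$), and analogously for $\wedge,\top$ with hats; together with a natural transformation $\iota_{A,B,C,D}:(A\wedge B)\vee(C\wedge D)\to(A\vee C)\wedge(B\vee D)$, isomorphisms $\beta^{\leftarrow}:\bot\to\bot\wedge\bot$ (inverse $\beta^{\to}$) and $\tau^{\to}:\top\vee\top\to\top$ (inverse $\tau^{\leftarrow}$), and an arrow $\kappa:\bot\to\top$, such that for all objects: (1) $\iota_{A\vee B,D\vee E,C,F}\circ(\iota_{A,D,B,E}\vee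 \mathbf 1)\circ\check\alpha^{\to}_{A\wedge D,B\wedge E,C\wedge F}=(\check\alpha^{\to}_{A,B,C}\wedge\check\alpha^{\to}_{D,E,F})\circ\iota_{A,D,B\vee C,E\vee F}\circ(\mathbf 1\vee\iota_{B,E,C,F})$; (2) $\iota_{B,D,A,C}\circ\check\sigma_{A\wedge C,B\wedge D}=(\check\sigma_{A,B}\wedge\check\sigma_{C,D})\circ\iota_{A,C,B,D}$; (3) $(\check\rho^{\to}_A\wedge\check\rho^{\to}_B)\circ\iota_{A,B,\bot,\bot}\circ(\mathbf 1\vee\beta^{\leftarrow})=\check\rho^{\to}_{A\wedge B}$; (4) $\tau^{\to}\circ(\tau^{\to}\vee\mathbf 1)\circ\check\alpha^{\to}_{\top,\top,\top}=\tau^{\to}\circ(\mathbf 1\vee\tau^{\to})$; (5) $\tau^{\to}\circ\check\sigma_{\top,\top}=\tau^{\to}$; (6) $\tau^{\to}\circ(\mathbf 1_\top\vee\kappa)=\check\rho^{\to}_\top$; (7) $\hat\alpha^{\to}_{A\vee D,B\vee E,C\vee F}\circ(\mathbf 1\wedge\iota_{B,C,E,F})\circ\iota_{A,B\wedge C,D,E\wedge F}=(\iota_{A,B,D,E}\wedge\mathbf 1)\circ\iota_{A\wedge B,C,D\wedge E,F}\circ(\hat\alpha^{\to}_{A,B,C}\vee\hat\alpha^{\to}_{D,E,F})$; (8) $\hat\alpha^{\to}_{\bot,\bot,\bot}\circ(\mathbf 1\wedge\beta^{\leftarrow})\circ\beta^{\leftarrow}=(\beta^{\leftarrow}\wedge\mathbf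 1)\circ\beta^{\leftarrow}$; (9) $\hat\sigma_{A\vee C,B\vee D}\circ\iota_{A,B,C,D}=\iota_{B,A,D,C}\circ(\hat\sigma_{A,B}\vee\hat\sigma_{C,D})$; (10) $\hat\sigma_{\bot,\bot}\circ\beta^{\leftarrow}=\beta^{\leftarrow}$; (11) $\hat\rho^{\to}_{A\vee B}\circ(\mathbf 1\wedge\tau^{\to})\circ\iota_{A,\top,B,\top}=\hat\rho^{\to}_A\vee\hat\rho^{\to}_B$; (12) $\hat\rho^{\to}_\bot\circ(\mathbf 1_\bot\wedge\kappa)\circ\beta^{\leftarrow}=\mathbf 1_\bot$. "Strict monoidal with respect to both" means that all $\check\alpha,\check\rho,\check\lambda,\hat\alpha,\hat\rho,\hat\lambda$ are identities. $\Delta_+$ is the topologist's simplicial category: its objects are $0,1,2,\ldots$, where $n$ stands for the ordinal $\{0,\ldots,n\}$, and its arrows are order-preserving functions. In $\Delta_+^{op}$ write $d_i^n:n\to n-1$ ($n\ge1$, $0\le i\le n$) for the opposite of the injection $\delta_i^n$ omitting $i$, and $s_i^n:n-1\to n$ ($n\geq 1$, $0\le i\le n-1$) for the opposite of the surjection $\sigma_i^n:n\to n-1$ identifying $i$ and $i+1$. For a strict monoidal category $\mathcal D$ (tensor $\otimes$, unit $I$), $\overline W\mathcal D:\Delta_+^{op}\to\mathrm{Cat}$ is the functor with $\overline W\mathcal D(n)=\mathcal D^n$, such that $\overline W\mathcal D(d_0^n)$ omits the first coordinate, $\overline W\mathcal D(d_n^n)$ omits the last coordinate, $\overline W\mathcal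 D(d_i^n)$ for $1\le i\le n-1$ replaces the $i$-th and $(i+1)$-th coordinates by their tensor product, and $\overline W\mathcal D(s_j^n)$ inserts $I$ after the first $j$ coordinates. $\overline W\mathcal C_{n,m}$ is defined on objects by $(k_1,\ldots,k_{n+m})\mapsto\mathcal C^{k_1\cdots k_{n+m}}$. For $1\le i\le n+m$ and $f_i:k_i\to l_i$ in $\Delta_+^{op}$, $$\overline W\mathcal C_{n,m}(\mathbf 1_{k_1},\ldots,\mathbf 1_{k_{i-1}},f_i,\mathbf 1_{k_{i+1}},\ldots,\mathbf 1_{k_{n+m}})=[\overline W\mathcal D(f_i)]^{k_1\cdots k_{i-1}},$$ where $\mathcal D=\mathcal C^{k_{i+1}\cdots k_{n+m}}$ has the componentwise strict monoidal structure given by $\vee,\bot$ if $i\le n$, and by $\wedge,\top$ if $n<i\le n+m$. For general arrows $f_i:k_i\to l_i$, $$\overline W\mathcal C_{n,m}(f_1,\ldots,f_{n+m})=\overline W\mathcal C_{n,m}(\mathbf 1_{l_1},\ldots,\mathbf 1_{l_{n+m-1}},f_{n+m})\circ\cdots\circ\overline W\mathcal C_{n,m}(f_1,\mathbf 1_{k_2},\ldots,\mathbf 1_{k_{n+m}}).$$ Write $f^\ast$ for $\overline W\mathcal C_{n,m}(f)$. This assignment preserves identities. That it is a lax functor means that there are natural transformations $\omega_{g,f}:g^\ast\circ f^\ast\to(g\circ f)^\ast$, for all composable pairs $f,g$ of arrows of $(\Delta_+^{op})^{n+m}$, such that for all composable $f,g,h$ one has $\omega_{h\circ g,f}\circ\omega_{h,g}(f^\ast)=\omega_{h,g\circ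 f}\circ h^\ast(\omega_{g,f})$ as natural transformations $h^\ast\circ g^\ast\circ f^\ast\to(h\circ g\circ f)^\ast$ (the unit constraints are identities, so the unit axioms say that $\omega_{g,f}$ is the identity when $f$ or $g$ is an identity arrow). An ordinary functor is regarded as a lax functor with identity constraints. *)

theory Defs
  imports Main "HOL-Library.FuncSet"
begin

section \<open>Categories, functors, natural transformations\<close>

record ('o, 'a) cat =
  Obj :: "'o set"
  Arr :: "'a set"
  Dom :: "'a \<Rightarrow> 'o"
  Cod :: "'a \<Rightarrow> 'o"
  Idt :: "'o \<Rightarrow> 'a"
  Cmp :: "'a \<Rightarrow> 'a \<Rightarrow> 'a"  (infixr "\<cdot>\<index>" 55)

definition hom :: "('o, 'a) cat \<Rightarrow> 'o \<Rightarrow> 'o \<Rightarrow> 'a set" where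
  "hom C A B = {f \<in> Arr C. Dom C f = A \<and> Cod C f = B}"

locale category =
  fixes C :: "('o, 'a) cat" (structure)
  assumes dom_obj: "f \<in> Arr C \<Longrightarrow> Dom C f \<in> Obj C"
    and cod_obj: "f \<in> Arr C \<Longrightarrow> Cod C f \<in> Obj C"
    and idt_hom: "A \<in> Obj C \<Longrightarrow> Idt C A \<in> hom C A A"
    and cmp_hom: "f \<in> hom C A B \<Longrightarrow> g \<in> hom C B D \<Longrightarrow> g \<cdot> f \<in> hom C A D"
    and idt_left: "f \<in> Arr C \<Longrightarrow> Idt C (Cod C f) \<cdot> f = f"
    and idt_right: "f \<in> Arr C \<Longrightarrow> f \<cdot> Idt C (Dom C f) = f"
    and cmp_assoc: "f \<in> Arr C \<Longrightarrow> g \<in> Arr C \<Longrightarrow> h \<in> Arr C \<Longrightarrow>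
      Cod C f = Dom C g \<Longrightarrow> Cod C g = Dom C h \<Longrightarrow> h \<cdot> (g \<cdot> f) = (h \<cdot> g) \<cdot> f"

definition iso :: "('o, 'a) cat \<Rightarrow> 'o \<Rightarrow> 'o \<Rightarrow> 'a \<Rightarrow> bool" where
  "iso C A B f \<longleftrightarrow> f \<in> hom C A B \<and>
     (\<exists>g \<in> hom C B A. Cmp C g f = Idt C A \<and> Cmp C f g = Idt C B)"

definition op_cat :: "('o, 'a) cat \<Rightarrow> ('o, 'a) cat" where
  "op_cat C = \<lparr>Obj = Obj C, Arr = Arr C, Dom = Cod C, Cod = Dom C, Idt = Idt C,
     Cmp = (\<lambda>g f. Cmp C f g)\<rparr>"

definition pow_cat :: "('o, 'a) cat \<Rightarrow> nat \<Rightarrow> ('o list, 'a list) cat" where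
  "pow_cat C k = \<lparr>Obj = {xs. length xs = k \<and> set xs \<subseteq> Obj C},
     Arr = {fs. length fs = k \<and> set fs \<subseteq> Arr C},
     Dom = map (Dom C), Cod = map (Cod C), Idt = map (Idt C), Cmp = map2 (Cmp C)\<rparr>"

record ('o, 'a, 'p, 'b) fnctr =
  onObj :: "'o \<Rightarrow> 'p"
  onArr :: "'a \<Rightarrow> 'b"

definition is_functor ::
  "('o, 'a) cat \<Rightarrow> ('p, 'b) cat \<Rightarrow> ('o, 'a, 'p, 'b) fnctr \<Rightarrow> bool" where
  "is_functor A B F \<longleftrightarrow>
     (\<forall>X \<in> Obj A. onObj F X \<in> Obj B) \<and>
     (\<forall>f \<in> Arr A. onArr F f \<in> hom B (onObj F (Dom A f)) (onObj F (Cod A f))) \<and>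
     (\<forall>X \<in> Obj A. onArr F (Idt A X) = Idt B (onObj F X)) \<and>
     (\<forall>f \<in> Arr A. \<forall>g \<in> Arr A. Cod A f = Dom A g \<longrightarrow>
        onArr F (Cmp A g f) = Cmp B (onArr F g) (onArr F f))"

definition id_fnctr :: "('o, 'a, 'o, 'a) fnctr" where
  "id_fnctr = \<lparr>onObj = id, onArr = id\<rparr>"

definition comp_fnctr (infixr "\<circ>\<^sub>F" 55) where
  "G \<circ>\<^sub>F F = \<lparr>onObj = onObj G \<circ> onObj F, onArr = onArr G \<circ> onArr F\<rparr>"

text \<open>HOL functions are total; two functors with source \<open>A\<close> are equal as arrows of Cat
  when they agree on the objects and arrows of \<open>A\<close>.\<close>

definition fnctr_eq ::
  "('o, 'a) cat \<Rightarrow> ('o, 'a, 'p, 'b) fnctr \<Rightarrow> ('o, 'a, 'p, 'b) fnctr \<Rightarrow> bool" where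
  "fnctr_eq A F G \<longleftrightarrow> (\<forall>X \<in> Obj A. onObj F X = onObj G X) \<and> (\<forall>f \<in> Arr A. onArr F f = onArr G f)"

definition is_nat_trans ::
  "('o, 'a) cat \<Rightarrow> ('p, 'b) cat \<Rightarrow> ('o, 'a, 'p, 'b) fnctr \<Rightarrow> ('o, 'a, 'p, 'b) fnctr
    \<Rightarrow> ('o \<Rightarrow> 'b) \<Rightarrow> bool" where
  "is_nat_trans A B F G \<eta> \<longleftrightarrow>
     (\<forall>X \<in> Obj A. \<eta> X \<in> hom B (onObj F X) (onObj G X)) \<and>
     (\<forall>f \<in> Arr A. Cmp B (\<eta> (Cod A f)) (onArr F f) = Cmp B (onArr G f) (\<eta> (Dom A f)))"


section \<open>Functors and lax functors to Cat\<close>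

definition is_functor_to_Cat ::
  "('j, 'b) cat \<Rightarrow> ('j \<Rightarrow> ('o, 'a) cat) \<Rightarrow> ('b \<Rightarrow> ('o, 'a, 'o, 'a) fnctr) \<Rightarrow> bool" where
  "is_functor_to_Cat J P F \<longleftrightarrow>
     (\<forall>k \<in> Obj J. category (P k)) \<and>
     (\<forall>f \<in> Arr J. is_functor (P (Dom J f)) (P (Cod J f)) (F f)) \<and>
     (\<forall>k \<in> Obj J. fnctr_eq (P k) (F (Idt J k)) id_fnctr) \<and>
     (\<forall>f \<in> Arr J. \<forall>g \<in> Arr J. Cod J f = Dom J g \<longrightarrow>
        fnctr_eq (P (Dom J f)) (F (Cmp J g f)) (F g \<circ>\<^sub>F F f))"

text \<open>Lax functors whose unit constraints are identities.\<close>

definition lax_functor_to_Cat_with ::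
  "('j, 'b) cat \<Rightarrow> ('j \<Rightarrow> ('o, 'a) cat) \<Rightarrow> ('b \<Rightarrow> ('o, 'a, 'o, 'a) fnctr)
    \<Rightarrow> ('b \<Rightarrow> 'b \<Rightarrow> 'o \<Rightarrow> 'a) \<Rightarrow> bool" where
  "lax_functor_to_Cat_with J P F \<omega> \<longleftrightarrow>
     (\<forall>k \<in> Obj J. category (P k)) \<and>
     (\<forall>f \<in> Arr J. is_functor (P (Dom J f)) (P (Cod J f)) (F f)) \<and>
     (\<forall>k \<in> Obj J. fnctr_eq (P k) (F (Idt J k)) id_fnctr) \<and>
     (\<forall>f \<in> Arr J. \<forall>g \<in> Arr J. Cod J f = Dom J g \<longrightarrow>
        is_nat_trans (P (Dom J f)) (P (Cod J g)) (F g \<circ>\<^sub>F F f) (F (Cmp J g f)) (\<omega> g f)) \<and>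
     (\<forall>f \<in> Arr J. \<forall>g \<in> Arr J. \<forall>h \<in> Arr J. Cod J f = Dom J g \<longrightarrow> Cod J g = Dom J h \<longrightarrow>
        (\<forall>X \<in> Obj (P (Dom J f)).
           Cmp (P (Cod J h)) (\<omega> (Cmp J h g) f X) (\<omega> h g (onObj (F f) X)) =
           Cmp (P (Cod J h)) (\<omega> h (Cmp J g f) X) (onArr (F h) (\<omega> g f X)))) \<and>
     (\<forall>f \<in> Arr J. \<forall>X \<in> Obj (P (Dom J f)).
        \<omega> (Idt J (Cod J f)) f X = Idt (P (Cod J f)) (onObj (F f) X) \<and>
        \<omega> f (Idt J (Dom J f)) X = Idt (P (Cod J f)) (onObj (F f) X))"

definition is_lax_functor_to_Cat ::
  "('j, 'b) cat \<Rightarrow> ('j \<Rightarrow> ('o, 'a) cat) \<Rightarrow> ('b \<Rightarrow> ('o, 'a, 'o, 'a) fnctr) \<Rightarrow> bool" where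
  "is_lax_functor_to_Cat J P F \<longleftrightarrow> (\<exists>\<omega>. lax_functor_to_Cat_with J P F \<omega>)"


section \<open>Symmetric monoidal and SMI categories\<close>

record ('o, 'a) tensor =
  tens :: "'o \<Rightarrow> 'o \<Rightarrow> 'o"  (infixr "\<otimes>\<index>" 70)
  tensA :: "'a \<Rightarrow> 'a \<Rightarrow> 'a"  (infixr "\<boxtimes>\<index>" 70)
  unt :: "'o"

record ('o, 'a) sym_mon = "('o, 'a) tensor" +
  assoc :: "'o \<Rightarrow> 'o \<Rightarrow> 'o \<Rightarrow> 'a"
  symm :: "'o \<Rightarrow> 'o \<Rightarrow> 'a"
  runit :: "'o \<Rightarrow> 'a"
  lunit :: "'o \<Rightarrow> 'a"

locale bifunctor = category C for C :: "('o, 'a) cat" (structure) +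
  fixes T :: "('o, 'a, 'z) tensor_scheme" (structure)
  assumes unt_obj: "unt T \<in> Obj C"
    and tens_obj: "A \<in> Obj C \<Longrightarrow> B \<in> Obj C \<Longrightarrow> tens T A B \<in> Obj C"
    and tensA_hom: "f \<in> hom C A A' \<Longrightarrow> g \<in> hom C B B' \<Longrightarrow>
      tensA T f g \<in> hom C (tens T A B) (tens T A' B')"
    and tensA_idt: "A \<in> Obj C \<Longrightarrow> B \<in> Obj C \<Longrightarrow>
      tensA T (Idt C A) (Idt C B) = Idt C (tens T A B)"
    and tensA_cmp: "f \<in> hom C A A' \<Longrightarrow> f' \<in> hom C A' A'' \<Longrightarrow>
      g \<in> hom C B B' \<Longrightarrow> g' \<in> hom C B' B'' \<Longrightarrow>
      tensA T (Cmp C f' f) (Cmp C g' g) = Cmp C (tensA T f' g') (tensA T f g)"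

locale symmetric_monoidal = bifunctor C T
  for C :: "('o, 'a) cat" (structure) and T :: "('o, 'a) sym_mon" +
  assumes assoc_iso: "A \<in> Obj C \<Longrightarrow> B \<in> Obj C \<Longrightarrow> D \<in> Obj C \<Longrightarrow>
      iso C (A \<otimes>\<^bsub>T\<^esub> (B \<otimes>\<^bsub>T\<^esub> D)) ((A \<otimes>\<^bsub>T\<^esub> B) \<otimes>\<^bsub>T\<^esub> D) (assoc T A B D)"
    and symm_iso: "A \<in> Obj C \<Longrightarrow> B \<in> Obj C \<Longrightarrow> iso C (A \<otimes>\<^bsub>T\<^esub> B) (B \<otimes>\<^bsub>T\<^esub> A) (symm T A B)"
    and runit_iso: "A \<in> Obj C \<Longrightarrow> iso C (A \<otimes>\<^bsub>T\<^esub> unt T) A (runit T A)"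
    and lunit_iso: "A \<in> Obj C \<Longrightarrow> iso C (unt T \<otimes>\<^bsub>T\<^esub> A) A (lunit T A)"
    and assoc_natural: "f \<in> hom C A A' \<Longrightarrow> g \<in> hom C B B' \<Longrightarrow> h \<in> hom C D D' \<Longrightarrow>
      assoc T A' B' D' \<cdot> (f \<boxtimes>\<^bsub>T\<^esub> (g \<boxtimes>\<^bsub>T\<^esub> h)) = ((f \<boxtimes>\<^bsub>T\<^esub> g) \<boxtimes>\<^bsub>T\<^esub> h) \<cdot> assoc T A B D"
    and symm_natural: "f \<in> hom C A A' \<Longrightarrow> g \<in> hom C B B' \<Longrightarrow>
      symm T A' B' \<cdot> (f \<boxtimes>\<^bsub>T\<^esub> g) = (g \<boxtimes>\<^bsub>T\<^esub> f) \<cdot> symm T A B"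
    and runit_natural: "f \<in> hom C A A' \<Longrightarrow>
      runit T A' \<cdot> (f \<boxtimes>\<^bsub>T\<^esub> Idt C (unt T)) = f \<cdot> runit T A"
    and lunit_natural: "f \<in> hom C A A' \<Longrightarrow>
      lunit T A' \<cdot> (Idt C (unt T) \<boxtimes>\<^bsub>T\<^esub> f) = f \<cdot> lunit T A"
    and pentagon: "A \<in> Obj C \<Longrightarrow> B \<in> Obj C \<Longrightarrow> D \<in> Obj C \<Longrightarrow> E \<in> Obj C \<Longrightarrow>
      assoc T (A \<otimes>\<^bsub>T\<^esub> B) D E \<cdot> assoc T A B (D \<otimes>\<^bsub>T\<^esub> E) =
      (assoc T A B D \<boxtimes>\<^bsub>T\<^esub> Idt C E) \<cdot> assoc T A (B \<otimes>\<^bsub>T\<^esub> D) E \<cdot> (Idt C A \<boxtimes>\<^bsub>T\<^esub> assoc T B D E)"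
    and triangle: "A \<in> Obj C \<Longrightarrow> B \<in> Obj C \<Longrightarrow>
      (runit T A \<boxtimes>\<^bsub>T\<^esub> Idt C B) \<cdot> assoc T A (unt T) B = Idt C A \<boxtimes>\<^bsub>T\<^esub> lunit T B"
    and hexagon: "A \<in> Obj C \<Longrightarrow> B \<in> Obj C \<Longrightarrow> D \<in> Obj C \<Longrightarrow>
      assoc T D A B \<cdot> symm T (A \<otimes>\<^bsub>T\<^esub> B) D \<cdot> assoc T A B D =
      (symm T A D \<boxtimes>\<^bsub>T\<^esub> Idt C B) \<cdot> assoc T A D B \<cdot> (Idt C A \<boxtimes>\<^bsub>T\<^esub> symm T B D)"
    and symm_symm: "A \<in> Obj C \<Longrightarrow> B \<in> Obj C \<Longrightarrow>
      symm T B A \<cdot> symm T A B = Idt C (A \<otimes>\<^bsub>T\<^esub> B)"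
    and lunit_symm: "A \<in> Obj C \<Longrightarrow> lunit T A \<cdot> symm T A (unt T) = runit T A"

definition strict_structure :: "('o, 'a) cat \<Rightarrow> ('o, 'a) sym_mon \<Rightarrow> bool" where
  "strict_structure C T \<longleftrightarrow>
     (\<forall>A \<in> Obj C. \<forall>B \<in> Obj C. \<forall>D \<in> Obj C.
        assoc T A B D = Idt C (tens T A (tens T B D))) \<and>
     (\<forall>A \<in> Obj C. runit T A = Idt C (tens T A (unt T))) \<and>
     (\<forall>A \<in> Obj C. lunit T A = Idt C (tens T (unt T) A))"

locale SMI_data =
  fixes C :: "('o, 'a) cat" (structure)
    and V :: "('o, 'a) sym_mon"
    and M :: "('o, 'a) sym_mon"
    and iota :: "'o \<Rightarrow> 'o \<Rightarrow> 'o \<Rightarrow> 'o \<Rightarrow> 'a"  (\<open>\<iota>\<close>)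
    and beta :: "'a"  (\<open>\<beta>\<close>)
    and tau :: "'a"  (\<open>\<tau>\<close>)
    and kappa :: "'a"  (\<open>\<kappa>\<close>)
begin

abbreviation vee (infixr "\<or>\<^sub>O" 65) where "A \<or>\<^sub>O B \<equiv> tens V A B"
abbreviation veeA (infixr "\<or>\<^sub>A" 65) where "f \<or>\<^sub>A g \<equiv> tensA V f g"
abbreviation wedge (infixr "\<and>\<^sub>O" 65) where "A \<and>\<^sub>O B \<equiv> tens M A B"
abbreviation wedgeA (infixr "\<and>\<^sub>A" 65) where "f \<and>\<^sub>A g \<equiv> tensA M f g"
abbreviation vbot ("\<^bold>\<bottom>") where "\<^bold>\<bottom> \<equiv> unt V"
abbreviation wtop ("\<^bold>\<top>") where "\<^bold>\<top> \<equiv> unt M"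
abbreviation one ("\<^bold>1") where "\<^bold>1 \<equiv> Idt C"

end

text \<open>Here \<open>\<beta>\<close> is the arrow \<open>\<beta>\<^sup>\<leftarrow>\<close> and \<open>\<tau>\<close> the arrow \<open>\<tau>\<^sup>\<rightarrow>\<close>.\<close>

locale SMI_category = SMI_data C V M iota beta tau kappa +
    V: symmetric_monoidal C V + M: symmetric_monoidal C M
  for C :: "('o, 'a) cat" (structure)
    and V :: "('o, 'a) sym_mon" and M :: "('o, 'a) sym_mon"
    and iota (\<open>\<iota>\<close>) and beta (\<open>\<beta>\<close>) and tau (\<open>\<tau>\<close>) and kappa (\<open>\<kappa>\<close>) +
  assumes iota_hom: "\<lbrakk>A \<in> Obj C; B \<in> Obj C; D \<in> Obj C; E \<in> Obj C\<rbrakk> \<Longrightarrow>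
      \<iota> A B D E \<in> hom C ((A \<and>\<^sub>O B) \<or>\<^sub>O (D \<and>\<^sub>O E)) ((A \<or>\<^sub>O D) \<and>\<^sub>O (B \<or>\<^sub>O E))"
    and iota_natural: "\<lbrakk>a \<in> hom C A A'; b \<in> hom C B B'; d \<in> hom C D D'; e \<in> hom C E E'\<rbrakk> \<Longrightarrow>
      \<iota> A' B' D' E' \<cdot> ((a \<and>\<^sub>A b) \<or>\<^sub>A (d \<and>\<^sub>A e)) = ((a \<or>\<^sub>A d) \<and>\<^sub>A (b \<or>\<^sub>A e)) \<cdot> \<iota> A B D E"
    and beta_iso: "iso C \<^bold>\<bottom> (\<^bold>\<bottom> \<and>\<^sub>O \<^bold>\<bottom>) \<beta>"
    and tau_iso: "iso C (\<^bold>\<top> \<or>\<^sub>O \<^bold>\<top>) \<^bold>\<top> \<tau>"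
    and kappa_hom: "\<kappa> \<in> hom C \<^bold>\<bottom> \<^bold>\<top>"
    and smi1: "\<lbrakk>A \<in> Obj C; B \<in> Obj C; X \<in> Obj C; D \<in> Obj C; E \<in> Obj C; F \<in> Obj C\<rbrakk> \<Longrightarrow>
      \<iota> (A \<or>\<^sub>O B) (D \<or>\<^sub>O E) X F \<cdot> (\<iota> A D B E \<or>\<^sub>A \<^bold>1 (X \<and>\<^sub>O F))
        \<cdot> assoc V (A \<and>\<^sub>O D) (B \<and>\<^sub>O E) (X \<and>\<^sub>O F)
      = (assoc V A B X \<and>\<^sub>A assoc V D E F) \<cdot> \<iota> A D (B \<or>\<^sub>O X) (E \<or>\<^sub>O F)
        \<cdot> (\<^bold>1 (A \<and>\<^sub>O D) \<or>\<^sub>A \<iota> B E X F)"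
    and smi2: "\<lbrakk>A \<in> Obj C; B \<in> Obj C; X \<in> Obj C; D \<in> Obj C\<rbrakk> \<Longrightarrow>
      \<iota> B D A X \<cdot> symm V (A \<and>\<^sub>O X) (B \<and>\<^sub>O D) = (symm V A B \<and>\<^sub>A symm V X D) \<cdot> \<iota> A X B D"
    and smi3: "\<lbrakk>A \<in> Obj C; B \<in> Obj C\<rbrakk> \<Longrightarrow>
      (runit V A \<and>\<^sub>A runit V B) \<cdot> \<iota> A B \<^bold>\<bottom> \<^bold>\<bottom> \<cdot> (\<^bold>1 (A \<and>\<^sub>O B) \<or>\<^sub>A \<beta>) = runit V (A \<and>\<^sub>O B)"
    and smi4: "\<tau> \<cdot> (\<tau> \<or>\<^sub>A \<^bold>1 \<^bold>\<top>) \<cdot> assoc V \<^bold>\<top> \<^bold>\<top> \<^bold>\<top> = \<tau> \<cdot> (\<^bold>1 \<^bold>\<top> \<or>\<^sub>A \<tau>)"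
    and smi5: "\<tau> \<cdot> symm V \<^bold>\<top> \<^bold>\<top> = \<tau>"
    and smi6: "\<tau> \<cdot> (\<^bold>1 \<^bold>\<top> \<or>\<^sub>A \<kappa>) = runit V \<^bold>\<top>"
    and smi7: "\<lbrakk>A \<in> Obj C; B \<in> Obj C; X \<in> Obj C; D \<in> Obj C; E \<in> Obj C; F \<in> Obj C\<rbrakk> \<Longrightarrow>
      assoc M (A \<or>\<^sub>O D) (B \<or>\<^sub>O E) (X \<or>\<^sub>O F) \<cdot> (\<^bold>1 (A \<or>\<^sub>O D) \<and>\<^sub>A \<iota> B X E F)
        \<cdot> \<iota> A (B \<and>\<^sub>O X) D (E \<and>\<^sub>O F)
      = (\<iota> A B D E \<and>\<^sub>A \<^bold>1 (X \<or>\<^sub>O F)) \<cdot> \<iota> (A \<and>\<^sub>O B) X (D \<and>\<^sub>O E) F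
        \<cdot> (assoc M A B X \<or>\<^sub>A assoc M D E F)"
    and smi8: "assoc M \<^bold>\<bottom> \<^bold>\<bottom> \<^bold>\<bottom> \<cdot> (\<^bold>1 \<^bold>\<bottom> \<and>\<^sub>A \<beta>) \<cdot> \<beta> = (\<beta> \<and>\<^sub>A \<^bold>1 \<^bold>\<bottom>) \<cdot> \<beta>"
    and smi9: "\<lbrakk>A \<in> Obj C; B \<in> Obj C; X \<in> Obj C; D \<in> Obj C\<rbrakk> \<Longrightarrow>
      symm M (A \<or>\<^sub>O X) (B \<or>\<^sub>O D) \<cdot> \<iota> A B X D = \<iota> B A D X \<cdot> (symm M A B \<or>\<^sub>A symm M X D)"
    and smi10: "symm M \<^bold>\<bottom> \<^bold>\<bottom> \<cdot> \<beta> = \<beta>"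
    and smi11: "\<lbrakk>A \<in> Obj C; B \<in> Obj C\<rbrakk> \<Longrightarrow>
      runit M (A \<or>\<^sub>O B) \<cdot> (\<^bold>1 (A \<or>\<^sub>O B) \<and>\<^sub>A \<tau>) \<cdot> \<iota> A \<^bold>\<top> B \<^bold>\<top> = runit M A \<or>\<^sub>A runit M B"
    and smi12: "runit M \<^bold>\<bottom> \<cdot> (\<^bold>1 \<^bold>\<bottom> \<and>\<^sub>A \<kappa>) \<cdot> \<beta> = \<^bold>1 \<^bold>\<bottom>"


section \<open>The topologist's simplicial category\<close>

text \<open>The object \<open>n\<close> stands for the ordinal \<open>{0..n}\<close>; an arrow \<open>l \<rightarrow> k\<close> is a triple
  \<open>(l, k, \<phi>)\<close>.\<close>

type_synonym simp_arr = "nat \<times> nat \<times> (nat \<Rightarrow> nat)"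

definition Delta :: "(nat, simp_arr) cat" where
  "Delta = \<lparr>Obj = UNIV,
     Arr = {(l, k, \<phi>). \<phi> \<in> {0..l} \<rightarrow>\<^sub>E {0..k} \<and> mono_on {0..l} \<phi>},
     Dom = (\<lambda>(l, k, \<phi>). l), Cod = (\<lambda>(l, k, \<phi>). k),
     Idt = (\<lambda>k. (k, k, \<lambda>i\<in>{0..k}. i)),
     Cmp = (\<lambda>(l', k', \<psi>) (l, k, \<phi>). (l, k', compose {0..l} \<psi> \<phi>))\<rparr>"

abbreviation Delta_op :: "(nat, simp_arr) cat" where
  "Delta_op \<equiv> op_cat Delta"

text \<open>\<open>face i n : n \<rightarrow> n - 1\<close> and \<open>degen i n : n - 1 \<rightarrow> n\<close> in \<open>Delta_op\<close>, for \<open>n \<ge> 1\<close>;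
  \<open>op_cat\<close> keeps the arrows, so these are the injection omitting \<open>i\<close> and the surjection
  identifying \<open>i\<close> and \<open>i + 1\<close>.\<close>

definition face :: "nat \<Rightarrow> nat \<Rightarrow> simp_arr" where
  "face i n = (n - 1, n, \<lambda>j\<in>{0..n - 1}. if j < i then j else j + 1)"

definition degen :: "nat \<Rightarrow> nat \<Rightarrow> simp_arr" where
  "degen i n = (n, n - 1, \<lambda>j\<in>{0..n}. if j \<le> i then j else j - 1)"


section \<open>The reduced bar construction\<close>

definition is_reduced_bar ::
  "('o, 'a) cat \<Rightarrow> ('o, 'a, 'z) tensor_scheme
    \<Rightarrow> (simp_arr \<Rightarrow> ('o list, 'a list, 'o list, 'a list) fnctr) \<Rightarrow> bool" where
  "is_reduced_bar D T W \<longleftrightarrow>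
     is_functor_to_Cat Delta_op (pow_cat D) W \<and>
     (\<forall>n \<ge> 1. \<forall>xs \<in> Obj (pow_cat D n).
        onObj (W (face 0 n)) xs = tl xs \<and>
        onObj (W (face n n)) xs = butlast xs \<and>
        (\<forall>i \<in> {1..n - 1}. onObj (W (face i n)) xs =
           take (i - 1) xs @ [tens T (xs ! (i - 1)) (xs ! i)] @ drop (i + 1) xs)) \<and>
     (\<forall>n \<ge> 1. \<forall>fs \<in> Arr (pow_cat D n).
        onArr (W (face 0 n)) fs = tl fs \<and>
        onArr (W (face n n)) fs = butlast fs \<and>
        (\<forall>i \<in> {1..n - 1}. onArr (W (face i n)) fs =
           take (i - 1) fs @ [tensA T (fs ! (i - 1)) (fs ! i)] @ drop (i + 1) fs)) \<and>
     (\<forall>n \<ge> 1. \<forall>j \<in> {0..n - 1}. \<forall>xs \<in> Obj (pow_cat D (n - 1)).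
        onObj (W (degen j n)) xs = take j xs @ [unt T] @ drop j xs) \<and>
     (\<forall>n \<ge> 1. \<forall>j \<in> {0..n - 1}. \<forall>fs \<in> Arr (pow_cat D (n - 1)).
        onArr (W (degen j n)) fs = take j fs @ [Idt D (unt T)] @ drop j fs)"

text \<open>For strict monoidal \<open>D\<close> such a functor exists and is unique up to \<open>fnctr_eq\<close>; see
  \<open>reduced_bar_is_reduced_bar\<close> and \<open>reduced_bar_unique\<close> below.\<close>

definition reduced_bar ::
  "('o, 'a) cat \<Rightarrow> ('o, 'a, 'z) tensor_scheme
    \<Rightarrow> simp_arr \<Rightarrow> ('o list, 'a list, 'o list, 'a list) fnctr" where
  "reduced_bar D T = (SOME W. is_reduced_bar D T W)"

definition pow_tensor :: "nat \<Rightarrow> ('o, 'a, 'z) tensor_scheme \<Rightarrow> ('o list, 'a list) tensor" where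
  "pow_tensor q T = \<lparr>tens = map2 (tens T), tensA = map2 (tensA T), unt = replicate q (unt T)\<rparr>"

definition pow_fnctr ::
  "('o, 'a, 'p, 'b) fnctr \<Rightarrow> ('o list, 'a list, 'p list, 'b list) fnctr" where
  "pow_fnctr F = \<lparr>onObj = map (onObj F), onArr = map (onArr F)\<rparr>"

text \<open>The identification of \<open>\<C>\<close> to the power \<open>p \<cdot> k \<cdot> q\<close> with the iterated power
  \<open>((\<C>\<^sup>q)\<^sup>k)\<^sup>p\<close> (coordinates in lexicographic order), on objects and on arrows.\<close>

definition chunks :: "nat \<Rightarrow> nat \<Rightarrow> 'x list \<Rightarrow> 'x list list" where
  "chunks k r xs = map (\<lambda>a. take r (drop (a * r) xs)) [0..<k]"

definition nest_fnctr ::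
  "nat \<Rightarrow> nat \<Rightarrow> nat \<Rightarrow>
    ('o list, 'a list, 'o list list list, 'a list list list) fnctr" where
  "nest_fnctr p k q = \<lparr>onObj = map (chunks k q) \<circ> chunks p (k * q),
     onArr = map (chunks k q) \<circ> chunks p (k * q)\<rparr>"

definition flatten_fnctr ::
  "('o list list list, 'a list list list, 'o list, 'a list) fnctr" where
  "flatten_fnctr = \<lparr>onObj = concat \<circ> concat, onArr = concat \<circ> concat\<rparr>"

text \<open>Coordinates are numbered from 0 here, so the first \<open>n\<close> of them, which use \<open>V\<close>,
  are those with \<open>i < n\<close>.  In \<open>bar_coord C V M n ks i f\<close> the entry \<open>ks ! i\<close> is the source of
  \<open>f\<close> in \<open>Delta_op\<close>, and all other coordinates carry the identities of \<open>ks\<close>.\<close>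

definition bar_coord ::
  "('o, 'a) cat \<Rightarrow> ('o, 'a) sym_mon \<Rightarrow> ('o, 'a) sym_mon \<Rightarrow> nat \<Rightarrow> nat list \<Rightarrow> nat \<Rightarrow> simp_arr
    \<Rightarrow> ('o list, 'a list, 'o list, 'a list) fnctr" where
  "bar_coord C V M n ks i f =
     (let p = prod_list (take i ks); k = ks ! i; q = prod_list (drop (i + 1) ks);
          T = (if i < n then V else M)
      in flatten_fnctr
           \<circ>\<^sub>F pow_fnctr (reduced_bar (pow_cat C q) (pow_tensor q T) f)
           \<circ>\<^sub>F nest_fnctr p k q)"

definition multi_bar_obj :: "('o, 'a) cat \<Rightarrow> nat list \<Rightarrow> ('o list, 'a list) cat" where
  "multi_bar_obj C ks = pow_cat C (prod_list ks)"

definition multi_bar_arr ::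
  "('o, 'a) cat \<Rightarrow> ('o, 'a) sym_mon \<Rightarrow> ('o, 'a) sym_mon \<Rightarrow> nat \<Rightarrow> simp_arr list
    \<Rightarrow> ('o list, 'a list, 'o list, 'a list) fnctr" where
  "multi_bar_arr C V M n fs =
     (let ks = map (Dom Delta_op) fs; ls = map (Cod Delta_op) fs
      in fold (\<lambda>i F. bar_coord C V M n (take i ls @ drop i ks) i (fs ! i) \<circ>\<^sub>F F)
           [0..<length fs] id_fnctr)"

section \<open>Existence and uniqueness of the reduced bar construction\<close>

lemma hom_iff: "f \<in> hom C A B \<longleftrightarrow> f \<in> Arr C \<and> Dom C f = A \<and> Cod C f = B"
  by (auto simp: hom_def)

lemma pow_cat_simps [simp]:
  "Obj (pow_cat C k) = {xs. length xs = k \<and> set xs \<subseteq> Obj C}"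
  "Arr (pow_cat C k) = {fs. length fs = k \<and> set fs \<subseteq> Arr C}"
  "Dom (pow_cat C k) = map (Dom C)" "Cod (pow_cat C k) = map (Cod C)"
  "Idt (pow_cat C k) = map (Idt C)" "Cmp (pow_cat C k) = map2 (Cmp C)"
  by (simp_all add: pow_cat_def)

lemma Delta_op_simps [simp]:
  "Obj Delta_op = UNIV"
  "(l, k, \<phi>) \<in> Arr Delta_op \<longleftrightarrow> \<phi> \<in> {0..l} \<rightarrow>\<^sub>E {0..k} \<and> mono_on {0..l} \<phi>"
  "Dom Delta_op (l, k, \<phi>) = k" "Cod Delta_op (l, k, \<phi>) = l"
  "Idt Delta_op k = (k, k, \<lambda>i\<in>{0..k}. i)"
  "Cmp Delta_op (m, l', \<psi>) (l, k, \<phi>) = (m, k, compose {0..m} \<phi> \<psi>)"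
  by (simp_all add: op_cat_def Delta_def)

lemma category_pow_cat:
  assumes "category C" shows "category (pow_cat C k)"
proof -
  interpret category C by fact
  have sub: "xs ! i \<in> S" if "set xs \<subseteq> S" "i < length xs" for xs :: "'c list" and S i
    using that by auto
  show ?thesis
  proof
    fix f g A B D
    assume "f \<in> hom (pow_cat C k) A B" "g \<in> hom (pow_cat C k) B D"
    then have f: "length f = k" "set f \<subseteq> Arr C" "A = map (Dom C) f" "B = map (Cod C) f"
      and g: "length g = k" "set g \<subseteq> Arr C" "B = map (Dom C) g" "D = map (Cod C) g"
      by (auto simp: hom_iff)
    have eq: "Cod C (f ! i) = Dom C (g ! i)" if "i < k" for i
      using f g that by (metis nth_map)
    have h: "g ! i \<cdot>\<^bsub>C\<^esub> f ! i \<in> hom C (Dom C (f ! i)) (Cod C (g ! i))" if "i < k" for i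
      using cmp_hom[of "f ! i" "Dom C (f ! i)" "Cod C (f ! i)" "g ! i" "Cod C (g ! i)"]
        f g that eq[OF that] sub[of f "Arr C" i] sub[of g "Arr C" i] by (simp add: hom_iff)
    show "Cmp (pow_cat C k) g f \<in> hom (pow_cat C k) A D"
      using f g h by (auto simp: hom_iff set_zip intro!: nth_equalityI)
  next
    fix f g h
    assume a: "f \<in> Arr (pow_cat C k)" "g \<in> Arr (pow_cat C k)" "h \<in> Arr (pow_cat C k)"
      "Cod (pow_cat C k) f = Dom (pow_cat C k) g" "Cod (pow_cat C k) g = Dom (pow_cat C k) h"
    then have eq: "Cod C (f ! i) = Dom C (g ! i)" "Cod C (g ! i) = Dom C (h ! i)" if "i < k" for i
      using that by (auto dest!: map_eq_imp_length_eq simp: list_eq_iff_nth_eq)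
    show "Cmp (pow_cat C k) h (Cmp (pow_cat C k) g f) = Cmp (pow_cat C k) (Cmp (pow_cat C k) h g) f"
      using a eq by (auto intro!: nth_equalityI cmp_assoc sub)
  qed (use dom_obj cod_obj idt_hom in
      \<open>auto simp: hom_iff idt_left idt_right sub intro!: nth_equalityI\<close>)
qed

locale strict_tensor = bifunctor D T
  for D :: "('o, 'a) cat" (structure) and T :: "('o, 'a, 'z) tensor_scheme" +
  assumes tens_assoc: "\<lbrakk>A \<in> Obj D; B \<in> Obj D; E \<in> Obj D\<rbrakk> \<Longrightarrow>
      tens T A (tens T B E) = tens T (tens T A B) E"
    and tens_unt: "A \<in> Obj D \<Longrightarrow> tens T A (unt T) = A"
    and unt_tens: "A \<in> Obj D \<Longrightarrow> tens T (unt T) A = A"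
    and tensA_assoc: "\<lbrakk>f \<in> Arr D; g \<in> Arr D; h \<in> Arr D\<rbrakk> \<Longrightarrow>
      tensA T f (tensA T g h) = tensA T (tensA T f g) h"
    and tensA_unt: "f \<in> Arr D \<Longrightarrow> tensA T f (Idt D (unt T)) = f"
    and unt_tensA: "f \<in> Arr D \<Longrightarrow> tensA T (Idt D (unt T)) f = f"

lemma (in symmetric_monoidal) strict_tensorI:
  assumes "strict_structure C T"
  shows "strict_tensor C T"
proof -
  have a: "assoc T A B E = Idt C (A \<otimes>\<^bsub>T\<^esub> B \<otimes>\<^bsub>T\<^esub> E)" if "A \<in> Obj C" "B \<in> Obj C" "E \<in> Obj C" for A B E
    using assms that by (auto simp: strict_structure_def)
  have r: "runit T A = Idt C (A \<otimes>\<^bsub>T\<^esub> unt T)" and l: "lunit T A = Idt C (unt T \<otimes>\<^bsub>T\<^esub> A)"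
    if "A \<in> Obj C" for A
    using assms that by (auto simp: strict_structure_def)
  have ta: "A \<otimes>\<^bsub>T\<^esub> B \<otimes>\<^bsub>T\<^esub> E = (A \<otimes>\<^bsub>T\<^esub> B) \<otimes>\<^bsub>T\<^esub> E" if "A \<in> Obj C" "B \<in> Obj C" "E \<in> Obj C" for A B E
    using assoc_iso[OF that] idt_hom[of "A \<otimes>\<^bsub>T\<^esub> B \<otimes>\<^bsub>T\<^esub> E"] a[OF that] that
    by (auto simp: iso_def hom_iff tens_obj)
  have tu: "A \<otimes>\<^bsub>T\<^esub> unt T = A" and ut: "unt T \<otimes>\<^bsub>T\<^esub> A = A" if "A \<in> Obj C" for A
    using runit_iso[OF that] lunit_iso[OF that] r[OF that] l[OF that] that unt_obj
      idt_hom[of "A \<otimes>\<^bsub>T\<^esub> unt T"] idt_hom[of "unt T \<otimes>\<^bsub>T\<^esub> A"]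
    by (auto simp: iso_def hom_iff tens_obj)
  have selfhom: "f \<in> hom C (Dom C f) (Cod C f)" if "f \<in> Arr C" for f
    using that by (simp add: hom_iff)
  have th: "f \<boxtimes>\<^bsub>T\<^esub> g \<in> hom C (Dom C f \<otimes>\<^bsub>T\<^esub> Dom C g) (Cod C f \<otimes>\<^bsub>T\<^esub> Cod C g)"
    if "f \<in> Arr C" "g \<in> Arr C" for f g
    using that by (intro tensA_hom selfhom)
  show ?thesis
  proof
    fix f g h assume fgh: "f \<in> Arr C" "g \<in> Arr C" "h \<in> Arr C"
    have o: "Dom C f \<in> Obj C" "Dom C g \<in> Obj C" "Dom C h \<in> Obj C"
      "Cod C f \<in> Obj C" "Cod C g \<in> Obj C" "Cod C h \<in> Obj C"
      using fgh dom_obj cod_obj by auto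
    have gh: "g \<boxtimes>\<^bsub>T\<^esub> h \<in> Arr C" "f \<boxtimes>\<^bsub>T\<^esub> g \<in> Arr C" using th fgh by (auto simp: hom_iff)
    have 1: "f \<boxtimes>\<^bsub>T\<^esub> (g \<boxtimes>\<^bsub>T\<^esub> h) \<in> Arr C"
      "Cod C (f \<boxtimes>\<^bsub>T\<^esub> (g \<boxtimes>\<^bsub>T\<^esub> h)) = Cod C f \<otimes>\<^bsub>T\<^esub> Cod C g \<otimes>\<^bsub>T\<^esub> Cod C h"
      using th[OF fgh(1) gh(1)] th[OF fgh(2,3)] by (auto simp: hom_iff)
    have 2: "(f \<boxtimes>\<^bsub>T\<^esub> g) \<boxtimes>\<^bsub>T\<^esub> h \<in> Arr C"
      "Dom C ((f \<boxtimes>\<^bsub>T\<^esub> g) \<boxtimes>\<^bsub>T\<^esub> h) = Dom C f \<otimes>\<^bsub>T\<^esub> Dom C g \<otimes>\<^bsub>T\<^esub> Dom C h"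
      using th[OF gh(2) fgh(3)] th[OF fgh(1,2)] ta o by (auto simp: hom_iff)
    show "f \<boxtimes>\<^bsub>T\<^esub> (g \<boxtimes>\<^bsub>T\<^esub> h) = (f \<boxtimes>\<^bsub>T\<^esub> g) \<boxtimes>\<^bsub>T\<^esub> h"
      using assoc_natural[OF selfhom[OF fgh(1)] selfhom[OF fgh(2)] selfhom[OF fgh(3)]]
        idt_left[OF 1(1)] idt_right[OF 2(1)] o 1 2 by (simp add: a)
  next
    fix f assume f: "f \<in> Arr C"
    have o: "Dom C f \<in> Obj C" "Cod C f \<in> Obj C" using f dom_obj cod_obj by auto
    have u: "Idt C (unt T) \<in> hom C (unt T) (unt T)" using idt_hom unt_obj by auto
    have 1: "f \<boxtimes>\<^bsub>T\<^esub> Idt C (unt T) \<in> hom C (Dom C f) (Cod C f)"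
      "Idt C (unt T) \<boxtimes>\<^bsub>T\<^esub> f \<in> hom C (Dom C f) (Cod C f)"
      using th[OF f] th[OF _ f] u o tu ut by (auto simp: hom_iff)
    show "f \<boxtimes>\<^bsub>T\<^esub> Idt C (unt T) = f"
      using runit_natural[OF selfhom[OF f]] idt_left[of "f \<boxtimes>\<^bsub>T\<^esub> Idt C (unt T)"] idt_right[OF f] 1 o
      by (simp add: r tu hom_iff)
    show "Idt C (unt T) \<boxtimes>\<^bsub>T\<^esub> f = f"
      using lunit_natural[OF selfhom[OF f]] idt_left[of "Idt C (unt T) \<boxtimes>\<^bsub>T\<^esub> f"] idt_right[OF f] 1 o
      by (simp add: l ut hom_iff)
  qed (use ta tu ut in auto)
qed

lemma (in strict_tensor) strict_tensor_pow: "strict_tensor (pow_cat D q) (pow_tensor q T)"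
proof -
  interpret P: category "pow_cat D q" by (rule category_pow_cat) unfold_locales
  have sub: "xs ! i \<in> S" if "set xs \<subseteq> S" "i < length xs" for xs :: "'c list" and S i
    using that by auto
  have th: "tensA T f g \<in> hom D (tens T (Dom D f) (Dom D g)) (tens T (Cod D f) (Cod D g))"
    if "f \<in> Arr D" "g \<in> Arr D" for f g
    using that by (intro tensA_hom) (auto simp: hom_iff)
  show ?thesis
  proof
    fix f A A' g B B'
    assume "f \<in> hom (pow_cat D q) A A'" "g \<in> hom (pow_cat D q) B B'"
    then have "length f = q" "length g = q" "set f \<subseteq> Arr D" "set g \<subseteq> Arr D"
      "A = map (Dom D) f" "A' = map (Cod D) f" "B = map (Dom D) g" "B' = map (Cod D) g"
      by (auto simp: hom_iff)
    then show "tensA (pow_tensor q T) f g \<in>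
      hom (pow_cat D q) (tens (pow_tensor q T) A B) (tens (pow_tensor q T) A' B')"
      using th sub[of _ "Arr D"]
      by (auto simp: pow_tensor_def hom_iff set_zip intro!: nth_equalityI)
  next
    fix f A A' f' A'' g B B' g' B''
    assume "f \<in> hom (pow_cat D q) A A'" "f' \<in> hom (pow_cat D q) A' A''"
      "g \<in> hom (pow_cat D q) B B'" "g' \<in> hom (pow_cat D q) B' B''"
    then have l: "length f = q" "length g = q" "length f' = q" "length g' = q"
      and s: "set f \<subseteq> Arr D" "set g \<subseteq> Arr D" "set f' \<subseteq> Arr D" "set g' \<subseteq> Arr D"
      and e: "map (Cod D) f = map (Dom D) f'" "map (Cod D) g = map (Dom D) g'"
      by (auto simp: hom_iff)
    have e': "Cod D (f ! i) = Dom D (f' ! i)" "Cod D (g ! i) = Dom D (g' ! i)" if "i < q" for i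
      using e l that by (metis nth_map)+
    have "tensA T (f' ! i \<cdot> f ! i) (g' ! i \<cdot> g ! i) = tensA T (f' ! i) (g' ! i) \<cdot> tensA T (f ! i) (g ! i)"
      if "i < q" for i
      by (rule tensA_cmp) (use that l s e'[OF that] in \<open>auto simp: hom_iff sub\<close>)
    then show "tensA (pow_tensor q T) (Cmp (pow_cat D q) f' f) (Cmp (pow_cat D q) g' g) =
       Cmp (pow_cat D q) (tensA (pow_tensor q T) f' g') (tensA (pow_tensor q T) f g)"
      using l by (auto simp: pow_tensor_def intro!: nth_equalityI)
  qed (use unt_obj in \<open>auto simp: pow_tensor_def set_zip tens_obj tensA_idt tens_assoc tens_unt unt_tens
      tensA_assoc tensA_unt unt_tensA sub intro!: nth_equalityI\<close>)
qed

subsection \<open>Existence\<close>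

definition bar_list :: "('x \<Rightarrow> 'x \<Rightarrow> 'x) \<Rightarrow> 'x \<Rightarrow> simp_arr \<Rightarrow> 'x list \<Rightarrow> 'x list" where
  "bar_list t u = (\<lambda>(l, k, \<phi>) xs.
     map (\<lambda>j. foldr t (take (\<phi> (Suc j) - \<phi> j) (drop (\<phi> j) xs)) u) [0..<l])"

definition bar_fnctr ::
  "('o, 'a) cat \<Rightarrow> ('o, 'a, 'z) tensor_scheme \<Rightarrow> simp_arr
    \<Rightarrow> ('o list, 'a list, 'o list, 'a list) fnctr" where
  "bar_fnctr D T f = \<lparr>onObj = bar_list (tens T) (unt T) f,
     onArr = bar_list (tensA T) (Idt D (unt T)) f\<rparr>"

locale list_monoid =
  fixes S :: "'x set" and t :: "'x \<Rightarrow> 'x \<Rightarrow> 'x" and u :: 'x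
  assumes cl: "x \<in> S \<Longrightarrow> y \<in> S \<Longrightarrow> t x y \<in> S" and ucl: "u \<in> S"
    and as: "x \<in> S \<Longrightarrow> y \<in> S \<Longrightarrow> z \<in> S \<Longrightarrow> t x (t y z) = t (t x y) z"
    and lu: "x \<in> S \<Longrightarrow> t u x = x" and ru: "x \<in> S \<Longrightarrow> t x u = x"
begin

lemma foldr_cl: "set xs \<subseteq> S \<Longrightarrow> foldr t xs u \<in> S"
  by (induction xs) (auto simp: cl ucl)

lemma foldr_app: "set xs \<subseteq> S \<Longrightarrow> set ys \<subseteq> S \<Longrightarrow>
    foldr t (xs @ ys) u = t (foldr t xs u) (foldr t ys u)"
  by (induction xs) (auto simp: lu as foldr_cl)

lemma ru_nth: "set xs \<subseteq> S \<Longrightarrow> i < length xs \<Longrightarrow> t (xs ! i) u = xs ! i"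
  by (meson nth_mem ru subsetD)

lemma slice1: "j < length xs \<Longrightarrow> take (Suc 0) (drop j xs) = [xs ! j]" for xs :: "'y list"
  by (simp add: Cons_nth_drop_Suc[symmetric])

lemma set_slice: "set xs \<subseteq> S \<Longrightarrow> set (take a (drop b xs)) \<subseteq> S"
  by (meson order_trans set_drop_subset set_take_subset)

lemma foldr_slices:
  assumes "set xs \<subseteq> S" "mono_on {0..l} \<phi>" "a \<le> b" "b \<le> l"
  shows "foldr t (map (\<lambda>j. foldr t (take (\<phi> (Suc j) - \<phi> j) (drop (\<phi> j) xs)) u) [a..<b]) u
     = foldr t (take (\<phi> b - \<phi> a) (drop (\<phi> a) xs)) u"
  using assms(3,4)
proof (induction b rule: dec_induct)
  case base then show ?case by simp
next
  case (step b)
  have m: "\<phi> a \<le> \<phi> b" "\<phi> b \<le> \<phi> (Suc b)"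
    using assms(2) step by (auto simp: mono_on_def)
  have "take (\<phi> (Suc b) - \<phi> a) (drop (\<phi> a) xs)
      = take (\<phi> b - \<phi> a) (drop (\<phi> a) xs) @ take (\<phi> (Suc b) - \<phi> b) (drop (\<phi> b) xs)"
    using m take_add[of "\<phi> b - \<phi> a" "\<phi> (Suc b) - \<phi> b" "drop (\<phi> a) xs"] by simp
  moreover have "set (map (\<lambda>j. foldr t (take (\<phi> (Suc j) - \<phi> j) (drop (\<phi> j) xs)) u) [a..<b]) \<subseteq> S"
    using foldr_cl[OF set_slice[OF assms(1)]] by auto
  ultimately show ?case
    using step set_slice[OF assms(1)] foldr_cl[OF set_slice[OF assms(1)]]
    by (simp add: foldr_app ru del: foldr_append foldr_map)
qed

lemma bar_list_cl: "set xs \<subseteq> S \<Longrightarrow> set (bar_list t u f xs) \<subseteq> S"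
  by (auto simp: bar_list_def foldr_cl set_slice split: prod.splits)

lemma bar_list_len: "length (bar_list t u f xs) = Cod Delta_op f"
  by (cases f) (simp add: bar_list_def)

lemma bar_list_cmp:
  assumes "(l, k, \<phi>) \<in> Arr Delta_op" "(m, l, \<psi>) \<in> Arr Delta_op" "set xs \<subseteq> S"
  shows "bar_list t u (m, k, compose {0..m} \<phi> \<psi>) xs
    = bar_list t u (m, l, \<psi>) (bar_list t u (l, k, \<phi>) xs)"
proof (rule nth_equalityI)
  fix j assume "j < length (bar_list t u (m, k, compose {0..m} \<phi> \<psi>) xs)"
  then have j: "j < m" by (simp add: bar_list_def)
  have p: "\<psi> j \<le> \<psi> (Suc j)" "\<psi> (Suc j) \<le> l"
    using assms(2) j by (auto simp: mono_on_def PiE_def Pi_def)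
  have "take (\<psi> (Suc j) - \<psi> j) (drop (\<psi> j) [0..<l]) = [\<psi> j..<\<psi> (Suc j)]"
    using p by (simp add: drop_upt take_upt)
  with foldr_slices[OF assms(3), of l \<phi> "\<psi> j" "\<psi> (Suc j)"] p j assms(1)
  show "bar_list t u (m, k, compose {0..m} \<phi> \<psi>) xs ! j
      = bar_list t u (m, l, \<psi>) (bar_list t u (l, k, \<phi>) xs) ! j"
    by (simp add: bar_list_def compose_def drop_map take_map)
qed (simp add: bar_list_def)

lemma bar_list_idt:
  assumes "set xs \<subseteq> S" "length xs = k"
  shows "bar_list t u (k, k, \<lambda>i\<in>{0..k}. i) xs = xs"
  using assms
  by (auto simp: bar_list_def slice1 ru_nth intro!: nth_equalityI)

lemma bar_list_face0:
  assumes "set xs \<subseteq> S" "length xs = n" "n \<ge> 1"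
  shows "bar_list t u (face 0 n) xs = tl xs"
  using assms by (auto simp: bar_list_def face_def slice1 nth_tl ru_nth intro!: nth_equalityI)

lemma bar_list_facen:
  assumes "set xs \<subseteq> S" "length xs = n" "n \<ge> 1"
  shows "bar_list t u (face n n) xs = butlast xs"
  using assms by (auto simp: bar_list_def face_def slice1 nth_butlast ru_nth intro!: nth_equalityI)

lemma bar_list_face:
  assumes "set xs \<subseteq> S" "length xs = n" "i \<in> {1..n - 1}"
  shows "bar_list t u (face i n) xs
     = take (i - 1) xs @ [t (xs ! (i - 1)) (xs ! i)] @ drop (i + 1) xs"
proof (rule nth_equalityI)
  fix j assume "j < length (bar_list t u (face i n) xs)"
  then have j: "j < n - 1" by (simp add: bar_list_def face_def)
  consider "j < i - 1" | "j = i - 1" | "j > i - 1" by linarith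
  then show "bar_list t u (face i n) xs ! j
     = (take (i - 1) xs @ [t (xs ! (i - 1)) (xs ! i)] @ drop (i + 1) xs) ! j"
  proof cases
    case 1 then show ?thesis using assms j
      by (auto simp: bar_list_def face_def slice1 ru_nth nth_append)
  next
    case 2
    then have "take 2 (drop j xs) = [xs ! j, xs ! Suc j]"
      using assms j by (simp add: Cons_nth_drop_Suc[symmetric] numeral_2_eq_2)
    moreover have "Suc (Suc j) - j = 2" by simp
    ultimately show ?thesis using assms j 2
      by (auto simp: bar_list_def face_def ru_nth nth_append)
  next
    case 3 then show ?thesis using assms j
      by (auto simp: bar_list_def face_def slice1 ru_nth nth_append nth_Cons' not_less Suc_diff_Suc
           simp flip: Suc_diff_le)
  qed
qed (use assms in \<open>auto simp: bar_list_def face_def\<close>)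

lemma bar_list_degen:
  assumes "set xs \<subseteq> S" "length xs = n - 1" "n \<ge> 1" "i \<in> {0..n - 1}"
  shows "bar_list t u (degen i n) xs = take i xs @ [u] @ drop i xs"
proof (rule nth_equalityI)
  fix j assume "j < length (bar_list t u (degen i n) xs)"
  then have j: "j < n" by (simp add: bar_list_def degen_def)
  consider "j < i" | "j = i" | "j > i" by linarith
  then show "bar_list t u (degen i n) xs ! j = (take i xs @ [u] @ drop i xs) ! j"
  proof cases
    case 3
    then have "Suc (i + (j - Suc i)) = j" "j - (j - Suc 0) = Suc 0" by auto
    with 3 show ?thesis using assms j
      by (auto simp: bar_list_def degen_def slice1 ru_nth nth_append nth_Cons')
  qed (use assms j in \<open>auto simp: bar_list_def degen_def slice1 ru_nth nth_append\<close>)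
qed (use assms in \<open>auto simp: bar_list_def degen_def\<close>)

end

context strict_tensor
begin

lemma tensA_arr: "f \<in> Arr D \<Longrightarrow> g \<in> Arr D \<Longrightarrow>
   tensA T f g \<in> hom D (tens T (Dom D f) (Dom D g)) (tens T (Cod D f) (Cod D g))"
  by (intro tensA_hom) (auto simp: hom_iff)

sublocale O: list_monoid "Obj D" "tens T" "unt T"
  by unfold_locales (auto simp: tens_obj unt_obj tens_assoc tens_unt unt_tens)

sublocale A: list_monoid "Arr D" "tensA T" "Idt D (unt T)"
  by unfold_locales
    (use idt_hom[OF unt_obj] tensA_arr in \<open>auto simp: hom_iff tensA_assoc tensA_unt unt_tensA\<close>)

lemma foldr_dom: "set fs \<subseteq> Arr D \<Longrightarrow>
    Dom D (foldr (tensA T) fs (Idt D (unt T))) = foldr (tens T) (map (Dom D) fs) (unt T)"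
  using idt_hom[OF unt_obj] tensA_arr A.foldr_cl by (induction fs) (auto simp: hom_iff)

lemma foldr_cod: "set fs \<subseteq> Arr D \<Longrightarrow>
    Cod D (foldr (tensA T) fs (Idt D (unt T))) = foldr (tens T) (map (Cod D) fs) (unt T)"
  using idt_hom[OF unt_obj] tensA_arr A.foldr_cl by (induction fs) (auto simp: hom_iff)

lemma foldr_idt: "set xs \<subseteq> Obj D \<Longrightarrow>
    foldr (tensA T) (map (Idt D) xs) (Idt D (unt T)) = Idt D (foldr (tens T) xs (unt T))"
  by (induction xs) (auto simp: tensA_idt O.foldr_cl)

lemma foldr_cmp:
  assumes "length fs = length gs" "set fs \<subseteq> Arr D" "set gs \<subseteq> Arr D" "map (Cod D) fs = map (Dom D) gs"
  shows "foldr (tensA T) (map2 (Cmp D) gs fs) (Idt D (unt T))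
    = foldr (tensA T) gs (Idt D (unt T)) \<cdot> foldr (tensA T) fs (Idt D (unt T))"
  using assms
proof (induction fs gs rule: list_induct2)
  case Nil
  show ?case using idt_hom[OF unt_obj] idt_left[of "Idt D (unt T)"] by (auto simp: hom_iff)
next
  case (Cons f fs g gs)
  have "tensA T (g \<cdot> f)
     (foldr (tensA T) gs (Idt D (unt T)) \<cdot> foldr (tensA T) fs (Idt D (unt T)))
   = tensA T g (foldr (tensA T) gs (Idt D (unt T))) \<cdot> tensA T f (foldr (tensA T) fs (Idt D (unt T)))"
    by (rule tensA_cmp) (use Cons in \<open>auto simp: hom_iff foldr_dom foldr_cod A.foldr_cl\<close>)
  then show ?case using Cons by simp
qed

lemma bar_fnctr_functor:
  assumes "f \<in> Arr Delta_op"
  shows "is_functor (pow_cat D (Dom Delta_op f)) (pow_cat D (Cod Delta_op f)) (bar_fnctr D T f)"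
proof -
  obtain l k \<phi> where f: "f = (l, k, \<phi>)" by (cases f)
  have z: "take a (drop b (zip xs ys)) = zip (take a (drop b xs)) (take a (drop b ys))"
    for a b and xs ys :: "'a list" by (simp add: take_zip drop_zip)
  show ?thesis
    unfolding is_functor_def
  proof (intro conjI ballI impI)
    fix fs gs
    assume "fs \<in> Arr (pow_cat D (Dom Delta_op f))" "gs \<in> Arr (pow_cat D (Dom Delta_op f))"
      and "Cod (pow_cat D (Dom Delta_op f)) fs = Dom (pow_cat D (Dom Delta_op f)) gs"
    then have a: "length fs = length gs" "set fs \<subseteq> Arr D" "set gs \<subseteq> Arr D"
      "map (Cod D) fs = map (Dom D) gs" by auto
    have "foldr (tensA T) (take a (drop b (map2 (Cmp D) gs fs))) (Idt D (unt T)) =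
       foldr (tensA T) (take a (drop b gs)) (Idt D (unt T)) \<cdot>
       foldr (tensA T) (take a (drop b fs)) (Idt D (unt T))" for a b
      using foldr_cmp[of "take a (drop b fs)" "take a (drop b gs)"] a
        A.set_slice[OF a(2)] A.set_slice[OF a(3)]
      by (simp add: take_map[symmetric] drop_map[symmetric]) (simp add: take_map drop_map z)
    then show "onArr (bar_fnctr D T f) (Cmp (pow_cat D (Dom Delta_op f)) gs fs) =
      Cmp (pow_cat D (Cod Delta_op f)) (onArr (bar_fnctr D T f) gs) (onArr (bar_fnctr D T f) fs)"
      by (simp add: bar_fnctr_def bar_list_def f zip_map_map zip_same_conv_map)
  qed (auto simp: bar_fnctr_def hom_iff O.bar_list_len A.bar_list_len
      dest: O.bar_list_cl[THEN subsetD, rotated] A.bar_list_cl[THEN subsetD, rotated],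
      auto simp: bar_list_def f foldr_dom foldr_cod foldr_idt O.set_slice A.set_slice take_map drop_map)
qed

theorem bar_fnctr_is_reduced_bar: "is_reduced_bar D T (bar_fnctr D T)"
  unfolding is_reduced_bar_def
proof (intro conjI)
  show "is_functor_to_Cat Delta_op (pow_cat D) (bar_fnctr D T)"
    unfolding is_functor_to_Cat_def
  proof (intro conjI ballI impI)
    show "category (pow_cat D k)" for k by (rule category_pow_cat) unfold_locales
    show "is_functor (pow_cat D (Dom Delta_op f)) (pow_cat D (Cod Delta_op f)) (bar_fnctr D T f)"
      if "f \<in> Arr Delta_op" for f using that by (rule bar_fnctr_functor)
    show "fnctr_eq (pow_cat D k) (bar_fnctr D T (Idt Delta_op k)) id_fnctr" for k
      by (auto simp: fnctr_eq_def bar_fnctr_def id_fnctr_def O.bar_list_idt A.bar_list_idt)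
    fix f g assume "f \<in> Arr Delta_op" "g \<in> Arr Delta_op" "Cod Delta_op f = Dom Delta_op g"
    then show "fnctr_eq (pow_cat D (Dom Delta_op f)) (bar_fnctr D T (Cmp Delta_op g f))
        (bar_fnctr D T g \<circ>\<^sub>F bar_fnctr D T f)"
      by (cases f; cases g) (auto simp: fnctr_eq_def bar_fnctr_def comp_fnctr_def
          simp del: Delta_op_simps(2) intro!: O.bar_list_cmp A.bar_list_cmp)
  qed
qed (auto simp: bar_fnctr_def O.bar_list_face0 O.bar_list_facen O.bar_list_face O.bar_list_degen
      A.bar_list_face0 A.bar_list_facen A.bar_list_face A.bar_list_degen)

theorem reduced_bar_is_reduced_bar: "is_reduced_bar D T (reduced_bar D T)"
  unfolding reduced_bar_def using someI[of "is_reduced_bar D T", OF bar_fnctr_is_reduced_bar] .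

end

subsection \<open>Uniqueness\<close>

lemma face_arr: "n \<ge> 1 \<Longrightarrow> i \<le> n \<Longrightarrow> face i n \<in> Arr Delta_op"
  by (auto simp: face_def mono_on_def)

lemma degen_arr: "n \<ge> 1 \<Longrightarrow> i \<le> n - 1 \<Longrightarrow> degen i n \<in> Arr Delta_op"
  by (auto simp: degen_def mono_on_def)

lemma mono_bij_id:
  assumes "strict_mono_on {0..l} \<phi>" "\<phi> ` {0..l} = {0..k::nat}" 
  shows "l = k \<and> (\<forall>i\<le>l. \<phi> i = i)"
proof -
  have inj: "inj_on \<phi> {0..l}" using assms(1) by (rule strict_mono_on_imp_inj_on)
  have lk: "l = k" using card_image[OF inj] assms(2) by simp
  have ge: "i \<le> \<phi> i" if "i \<le> l" for i using that
  proof (induction i)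
    case (Suc i)
    then have "\<phi> i < \<phi> (Suc i)" using assms(1) by (auto simp: strict_mono_on_def)
    with Suc show ?case by auto
  qed simp
  have le: "\<phi> (l - d) \<le> l - d" if "d \<le> l" for d using that
  proof (induction d)
    case 0 have "\<phi> l \<in> {0..k}" using assms(2) by auto
    then show ?case using lk by simp
  next
    case (Suc d)
    then have "\<phi> (l - Suc d) < \<phi> (l - d)" using assms(1) by (auto simp: strict_mono_on_def)
    with Suc show ?case by auto
  qed
  have "\<phi> i = i" if "i \<le> l" for i using ge[OF that] le[of "l - i"] that by simp
  with lk show ?thesis by simp
qed

lemma Delta_op_cases:
  assumes "(l, k, \<phi>) \<in> Arr Delta_op"
  obtains (idt) "l = k" "(l, k, \<phi>) = Idt Delta_op k"
  | (degen) j \<psi> where "l \<ge> 1" "j \<le> l - 1" "(l - 1, k, \<psi>) \<in> Arr Delta_op"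
      "(l, k, \<phi>) = Cmp Delta_op (degen j l) (l - 1, k, \<psi>)"
  | (face) j \<psi> where "k \<ge> 1" "j \<le> k" "(l, k - 1, \<psi>) \<in> Arr Delta_op"
      "(l, k, \<phi>) = Cmp Delta_op (l, k - 1, \<psi>) (face j k)"
proof -
  have ext: "\<phi> \<in> {0..l} \<rightarrow>\<^sub>E {0..k}" and mono: "mono_on {0..l} \<phi>" using assms by auto
  have bd: "\<phi> i \<le> k" if "i \<le> l" for i using ext that by (auto simp: PiE_def Pi_def)
  have und: "\<phi> i = undefined" if "\<not> i \<le> l" for i using ext that by (auto simp: PiE_def extensional_def)
  have mo: "\<phi> i \<le> \<phi> j" if "i \<le> j" "j \<le> l" for i j using mono that by (auto simp: mono_on_def)
  show thesis
  proof (cases "\<exists>j<l. \<phi> j = \<phi> (Suc j)")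
    case True
    then obtain j where j: "j < l" "\<phi> j = \<phi> (Suc j)" by auto
    define \<psi> where "\<psi> = (\<lambda>i\<in>{0..l - 1}. \<phi> (if i \<le> j then i else Suc i))"
    have "(l - 1, k, \<psi>) \<in> Arr Delta_op"
      using j by (auto simp: \<psi>_def mono_on_def intro!: bd mo)
    moreover have "\<phi> i = compose {0..l} \<psi> (\<lambda>i\<in>{0..l}. if i \<le> j then i else i - 1) i" for i
      using j und by (cases "i \<le> l"; cases "i = Suc j") (auto simp: \<psi>_def compose_def)
    ultimately show thesis using j by (intro degen[of j \<psi>]) (auto simp: degen_def)
  next
    case False
    have st: "\<phi> j < \<phi> (Suc j)" if "j < l" for j
      using False mo[of j "Suc j"] that by (auto simp: order.strict_iff_order)
    have sm: "\<phi> i < \<phi> j" if "i < j" "j \<le> l" for i j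
      using that st[of i] mo[of "Suc i" j] by auto
    then have smo: "strict_mono_on {0..l} \<phi>" by (auto simp: strict_mono_on_def)
    show thesis
    proof (cases "\<phi> ` {0..l} = {0..k}")
      case True
      with mono_bij_id[OF smo True] und show thesis
        by (intro idt) (auto simp: restrict_def)
    next
      case nF: False
      then obtain j where j: "j \<le> k" "j \<notin> \<phi> ` {0..l}" using bd by force
      have "\<phi> 0 \<le> k" "\<phi> 0 \<noteq> j" using bd[of 0] j by auto
      then have k: "k \<ge> 1" using j by auto
      define \<psi> where "\<psi> = (\<lambda>i\<in>{0..l}. if \<phi> i < j then \<phi> i else \<phi> i - 1)"
      have nj: "\<phi> i \<noteq> j" if "i \<le> l" for i using j that by auto
      have "(l, k - 1, \<psi>) \<in> Arr Delta_op"
      proof -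
        have "\<psi> i \<le> k - 1" if "i \<le> l" for i
          using bd[OF that] nj[OF that] j k that by (auto simp: \<psi>_def)
        moreover have "\<psi> i \<le> \<psi> i'" if "i \<le> i'" "i' \<le> l" for i i'
          using mo[OF that] nj[OF that(2)] nj[of i] that by (auto simp: \<psi>_def)
        ultimately show ?thesis by (auto simp: mono_on_def \<psi>_def)
      qed
      moreover have "\<phi> i = compose {0..l} (\<lambda>i\<in>{0..k - 1}. if i < j then i else i + 1) \<psi> i" for i
        using bd[of i] nj[of i] und[of i] j k by (cases "i \<le> l") (auto simp: \<psi>_def compose_def)
      ultimately show thesis using j k by (intro face[of j \<psi>]) (auto simp: face_def)
    qed
  qed
qed

theorem reduced_bar_unique:
  assumes W: "is_reduced_bar D T W" and W': "is_reduced_bar D T W'"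
    and f: "f \<in> Arr Delta_op"
  shows "fnctr_eq (pow_cat D (Dom Delta_op f)) (W f) (W' f)"
proof -
  have FW: "is_functor_to_Cat Delta_op (pow_cat D) W" and FW': "is_functor_to_Cat Delta_op (pow_cat D) W'"
    using W W' unfolding is_reduced_bar_def by blast+
  have comp: "fnctr_eq (pow_cat D (Dom Delta_op f)) (W (Cmp Delta_op g f)) (W' (Cmp Delta_op g f))"
    if a: "f \<in> Arr Delta_op" "g \<in> Arr Delta_op" "Cod Delta_op f = Dom Delta_op g"
      and e: "fnctr_eq (pow_cat D (Dom Delta_op f)) (W f) (W' f)"
        "fnctr_eq (pow_cat D (Dom Delta_op g)) (W g) (W' g)" for f g
  proof -
    have c: "fnctr_eq (pow_cat D (Dom Delta_op f)) (W (Cmp Delta_op g f)) (W g \<circ>\<^sub>F W f)"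
      "fnctr_eq (pow_cat D (Dom Delta_op f)) (W' (Cmp Delta_op g f)) (W' g \<circ>\<^sub>F W' f)"
      using FW FW' a unfolding is_functor_to_Cat_def by blast+
    have F: "is_functor (pow_cat D (Dom Delta_op f)) (pow_cat D (Dom Delta_op g)) (W f)"
      using FW a unfolding is_functor_to_Cat_def by metis
    have "onObj (W f) X \<in> Obj (pow_cat D (Dom Delta_op g))" if "X \<in> Obj (pow_cat D (Dom Delta_op f))" for X
      using F that unfolding is_functor_def by blast
    moreover have "onArr (W f) h \<in> Arr (pow_cat D (Dom Delta_op g))" if "h \<in> Arr (pow_cat D (Dom Delta_op f))" for h
      using F that unfolding is_functor_def hom_def by blast
    ultimately show ?thesis using c e unfolding fnctr_eq_def comp_fnctr_def
      by (simp del: pow_cat_simps)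
  qed
  have faces: "fnctr_eq (pow_cat D n) (W (face i n)) (W' (face i n))" if "n \<ge> 1" "i \<le> n" for i n
  proof -
    consider "i = 0" | "i = n" | "i \<in> {1..n - 1}" using \<open>i \<le> n\<close> by force
    then show ?thesis using W W' that(1) unfolding is_reduced_bar_def fnctr_eq_def
      by cases (simp_all del: pow_cat_simps)
  qed
  have degens: "fnctr_eq (pow_cat D (n - 1)) (W (degen j n)) (W' (degen j n))"
    if "n \<ge> 1" "j \<le> n - 1" for j n
    using W W' that unfolding is_reduced_bar_def fnctr_eq_def by (simp del: pow_cat_simps)
  have idts: "fnctr_eq (pow_cat D k) (W (Idt Delta_op k)) (W' (Idt Delta_op k))" for k
    using FW FW' unfolding is_functor_to_Cat_def fnctr_eq_def
    by (simp del: pow_cat_simps Delta_op_simps(5))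
  have "fnctr_eq (pow_cat D k) (W (l, k, \<phi>)) (W' (l, k, \<phi>))"
    if "(l, k, \<phi>) \<in> Arr Delta_op" for l k \<phi>
    using that
  proof (induction "l + k" arbitrary: l k \<phi> rule: less_induct)
    case less
    from less.prems show ?case
    proof (cases rule: Delta_op_cases)
      case idt then show ?thesis using idts[of k] by simp
    next
      case (degen j \<psi>)
      have "fnctr_eq (pow_cat D k) (W (l - 1, k, \<psi>)) (W' (l - 1, k, \<psi>))"
        using less.hyps degen(1,3) by simp
      then show ?thesis
        using comp[OF degen(3) degen_arr[OF degen(1,2)]] degens[OF degen(1,2)]
        unfolding degen(4) by (simp add: degen_def)
    next
      case (face j \<psi>)
      have "fnctr_eq (pow_cat D (k - 1)) (W (l, k - 1, \<psi>)) (W' (l, k - 1, \<psi>))"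
        using less.hyps face(1,3) by simp
      then show ?thesis
        using comp[OF face_arr[OF face(1,2)] face(3)] faces[OF face(1,2)]
        unfolding face(4) by (simp add: face_def)
    qed
  qed
  with f show ?thesis by (cases f) auto
qed

end

theory Submission
  imports Defs
begin

text \<open>
  Entry \<open>e\<close> of \<open>f\<^sup>*\<close> applied to a family \<open>X\<close> of objects is an iterated tensor of the entries of \<open>X\<close>
  in a box, the product of the slices \<open>{\<phi>\<^sub>i(e\<^sub>i)..<\<phi>\<^sub>i(e\<^sub>i + 1)}\<close> of the monotone maps dual to the
  components of \<open>f\<close>; the first coordinate is tensored innermost and the last one outermost.  In
  \<open>g\<^sup>* \<circ> f\<^sup>*\<close> two such iterations are nested, so a tensor over coordinate \<open>j\<close> that comes from
  \<open>f\<close> sits inside a tensor over coordinate \<open>i < j\<close> that comes from \<open>g\<close>, whereas in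
  \<open>(g \<circ> f)\<^sup>*\<close> every coordinate is tensored in one go.  The constraint \<open>\<omega>\<close> therefore has to move the
  tensor over \<open>i\<close> inside the tensor over \<open>j\<close>.  For a tensor \<open>\<otimes>\<^sub>S\<close> over rows and a tensor
  \<open>\<otimes>\<^sub>T\<close> over columns of a matrix of objects this is an arrow from the \<open>S\<close>-tensor of the
  \<open>T\<close>-tensors of the rows to the \<open>T\<close>-tensor of the \<open>S\<close>-tensors of the columns.  If \<open>S\<close> is
  \<open>\<or>\<close> and \<open>T\<close> is \<open>\<and>\<close>, it is assembled from \<open>\<iota>\<close>, with \<open>\<beta>\<close>, \<open>\<tau>\<close> and \<open>\<kappa>\<close> for matrices
  without rows or columns; if \<open>S = T\<close>, it is a permutation built from the symmetry, which is the
  same construction for the duoidal structure \<open>\<one> \<otimes> \<sigma> \<otimes> \<one>\<close> of a symmetric tensor with itself.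

  Working with matrices of arbitrary size treats the binary and the nullary structure at once, and
  only few facts about the matrix interchange are needed: it is natural, it is the identity for a
  single row or column, it is compatible with concatenation of rows
  (\<open>interchange_row_concat\<close>) and of columns (\<open>interchange_col_concat\<close>, which is the statement
  about rows in the opposite category, because the axioms of an SMI category are self-dual), and the
  two ways of reversing three nested tensors agree (\<open>interchange_hexagon\<close>).  For the hexagon one uses that
  at least two of the three tensors coincide: compatibility of \<open>\<iota>\<close> and \<open>\<tau>\<close> with the symmetry of
  \<open>\<or>\<close> makes an iterated \<open>\<and>\<close> a symmetric lax monoidal functor, and such a functor respects the
  permutation of rows and columns; the case of two \<open>\<and>\<close> is dual.

  From these facts alone, the lax functor is built by splitting off the first coordinate.  The
  functor for the remaining coordinates is lax monoidal for each earlier tensor (\<open>lax_mult\<close>), and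
  \<open>\<omega>\<close> for all coordinates (\<open>laxator\<close>) is \<open>lax_mult\<close> for the remaining coordinates followed by the
  remaining \<open>\<omega>\<close>.  Associativity of \<open>\<omega>\<close> (\<open>laxator_assoc\<close>) follows by induction once \<open>\<omega>\<close> is known to
  be monoidal (\<open>laxator_lax_mult\<close>), and this in turn needs \<open>lax_mult\<close> for two different tensors
  to be compatible with their interchange (\<open>lax_mult_interchange\<close>); the hexagon is used there.

  Up to this point a family is a function on all of \<open>nat \<Rightarrow> nat\<close> and the monotone maps are total, so
  that the equations hold without any side condition on indices.  The last part identifies the
  families with lists in lexicographic order and the iteration above with \<open>multi_bar_arr\<close>.
\<close>

section \<open>Composition in a category\<close>

abbreviation idt :: "('o, 'a) cat \<Rightarrow> 'o \<Rightarrow> 'a" ("\<one>\<index>") where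
  "\<one>\<^bsub>C\<^esub> \<equiv> Idt C"

context category
begin

lemma idt_simps [simp]:
  assumes "A \<in> Obj C"
  shows "Idt C A \<in> Arr C" "Dom C (Idt C A) = A" "Cod C (Idt C A) = A"
  using idt_hom[OF assms] by (auto simp: hom_iff)

lemma cmp_simps [simp]:
  assumes "f \<in> Arr C" "g \<in> Arr C" "Cod C f = Dom C g"
  shows "g \<cdot> f \<in> Arr C" "Dom C (g \<cdot> f) = Dom C f" "Cod C (g \<cdot> f) = Cod C g"
  using cmp_hom[of f "Dom C f" "Cod C f" g "Cod C g"] assms by (auto simp: hom_iff)

lemma dom_obj' [simp]: "f \<in> Arr C \<Longrightarrow> Dom C f \<in> Obj C"
  and cod_obj' [simp]: "f \<in> Arr C \<Longrightarrow> Cod C f \<in> Obj C"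
  by (auto intro: dom_obj cod_obj)

lemma idt_cmp [simp]: "f \<in> Arr C \<Longrightarrow> Cod C f = A \<Longrightarrow> Idt C A \<cdot> f = f"
  and cmp_idt [simp]: "f \<in> Arr C \<Longrightarrow> Dom C f = A \<Longrightarrow> f \<cdot> Idt C A = f"
  using idt_left idt_right by auto

lemma cmp_assoc_right [simp]:
  "\<lbrakk>f \<in> Arr C; g \<in> Arr C; h \<in> Arr C; Cod C f = Dom C g; Cod C g = Dom C h\<rbrakk>
    \<Longrightarrow> (h \<cdot> g) \<cdot> f = h \<cdot> (g \<cdot> f)"
  using cmp_assoc by simp

text \<open>Composites are kept nested to the right.  A commuting square that occurs at the front of a
  longer composite is then not a subterm; this lemma applies it there.\<close>
lemma cmp_square_cmp:
  assumes "g \<cdot> f = k \<cdot> h" "f \<in> Arr C" "g \<in> Arr C" "h \<in> Arr C" "k \<in> Arr C" "x \<in> Arr C"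
    "Cod C f = Dom C g" "Cod C h = Dom C k" "Cod C x = Dom C f"
  shows "g \<cdot> (f \<cdot> x) = k \<cdot> (h \<cdot> x)"
proof -
  have "Dom C (g \<cdot> f) = Dom C (k \<cdot> h)" using assms by simp
  then have "Dom C f = Dom C h" using assms(2-8) by simp
  then show ?thesis
    using assms cmp_assoc_right[of x f g] cmp_assoc_right[of x h k] by simp
qed

end

text \<open>Every statement about rows of a matrix of objects has a counterpart about columns; it is
  obtained by passing to the opposite category.\<close>
lemma hom_op [simp]: "hom (op_cat C) A B = hom C B A"
  by (auto simp: hom_def op_cat_def)

lemma op_cat_simps [simp]:
  "Obj (op_cat C) = Obj C" "Arr (op_cat C) = Arr C" "Dom (op_cat C) = Cod C" "Cod (op_cat C) = Dom C"
  "Idt (op_cat C) = Idt C" "Cmp (op_cat C) g f = Cmp C f g"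
  by (simp_all add: op_cat_def)

lemma (in category) category_op: "category (op_cat C)"
  by unfold_locales (simp_all add: hom_iff)

section \<open>Iterated tensors over index lists\<close>

definition tsum :: "('o, 'a, 'z) tensor_scheme \<Rightarrow> 'i list \<Rightarrow> ('i \<Rightarrow> 'o) \<Rightarrow> 'o" where
  "tsum T is x = foldr (tens T) (map x is) (unt T)"

definition tsumA :: "('o, 'a) cat \<Rightarrow> ('o, 'a, 'z) tensor_scheme \<Rightarrow> 'i list \<Rightarrow> ('i \<Rightarrow> 'a) \<Rightarrow> 'a" where
  "tsumA C T is h = foldr (tensA T) (map h is) (Idt C (unt T))"

lemma tsum_simps [simp]:
  "tsum T [] x = unt T" "tsum T (i # is) x = tens T (x i) (tsum T is x)"
  "tsumA C T [] h = Idt C (unt T)" "tsumA C T (i # is) h = tensA T (h i) (tsumA C T is h)"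
  by (simp_all add: tsum_def tsumA_def)

lemma tsumA_op [simp]: "tsumA (op_cat C) T = tsumA C T"
  by (intro ext) (simp add: tsumA_def)

lemma concat_map_Nil: "concat (map (\<lambda>_. []) xs) = []"
  by (induction xs) auto

lemma tsum_cong: "(\<And>i. i \<in> set is \<Longrightarrow> x i = y i) \<Longrightarrow> tsum T is x = tsum T is y"
  by (induction "is") auto

lemma tsumA_cong: "(\<And>i. i \<in> set is \<Longrightarrow> x i = y i) \<Longrightarrow> tsumA C T is x = tsumA C T is y"
  by (induction "is") auto

context strict_tensor
begin

declare unt_obj [simp] tens_obj [simp] tensA_idt [simp] tens_unt [simp] unt_tens [simp]
  tensA_unt [simp] unt_tensA [simp]

lemma tens_assoc_right [simp]: "\<lbrakk>A \<in> Obj D; B \<in> Obj D; E \<in> Obj D\<rbrakk> \<Longrightarrow>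
    tens T (tens T A B) E = tens T A (tens T B E)"
  and tensA_assoc_right [simp]: "\<lbrakk>f \<in> Arr D; g \<in> Arr D; h \<in> Arr D\<rbrakk> \<Longrightarrow>
    tensA T (tensA T f g) h = tensA T f (tensA T g h)"
  by (simp_all add: tens_assoc tensA_assoc)

lemma tensA_simps [simp]:
  assumes "f \<in> Arr D" "g \<in> Arr D"
  shows "tensA T f g \<in> Arr D" "Dom D (tensA T f g) = tens T (Dom D f) (Dom D g)"
    "Cod D (tensA T f g) = tens T (Cod D f) (Cod D g)"
  using tensA_arr[OF assms] by (auto simp: hom_iff)

lemma tensA_interchange:
  assumes "f \<in> Arr D" "f' \<in> Arr D" "g \<in> Arr D" "g' \<in> Arr D"
    "Cod D f = Dom D f'" "Cod D g = Dom D g'"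
  shows "tensA T f' g' \<cdot> tensA T f g = tensA T (f' \<cdot> f) (g' \<cdot> g)"
  by (rule tensA_cmp[symmetric]) (use assms in \<open>auto simp: hom_iff\<close>)

text \<open>Bifunctoriality at the front of a right-nested composite.\<close>
lemma tensA_interchange_cmp:
  assumes "f \<in> Arr D" "f' \<in> Arr D" "g \<in> Arr D" "g' \<in> Arr D" "h \<in> Arr D"
    "Cod D f = Dom D f'" "Cod D g = Dom D g'" "Cod D h = tens T (Dom D f) (Dom D g)"
  shows "tensA T f' g' \<cdot> (tensA T f g \<cdot> h) = tensA T (f' \<cdot> f) (g' \<cdot> g) \<cdot> h"
proof -
  have "tensA T f' g' \<cdot> (tensA T f g \<cdot> h) = (tensA T f' g' \<cdot> tensA T f g) \<cdot> h"
    using assms by simp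
  then show ?thesis using assms by (simp only: tensA_interchange)
qed

lemma tsum_obj [simp]: "(\<And>i. x i \<in> Obj D) \<Longrightarrow> tsum T is x \<in> Obj D"
  by (induction "is") auto

lemma tsumA_simps [simp]:
  assumes "\<And>i. h i \<in> Arr D"
  shows "tsumA D T is h \<in> Arr D" "Dom D (tsumA D T is h) = tsum T is (\<lambda>i. Dom D (h i))"
    "Cod D (tsumA D T is h) = tsum T is (\<lambda>i. Cod D (h i))"
  using assms by (induction "is") auto

lemma tsumA_idt [simp]: "(\<And>i. x i \<in> Obj D) \<Longrightarrow> tsumA D T is (\<lambda>i. Idt D (x i)) = Idt D (tsum T is x)"
  by (induction "is") auto

lemma tsumA_cmp:
  assumes "\<And>i. f i \<in> Arr D" "\<And>i. g i \<in> Arr D" "\<And>i. Cod D (f i) = Dom D (g i)"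
  shows "tsumA D T is g \<cdot> tsumA D T is f = tsumA D T is (\<lambda>i. g i \<cdot> f i)"
  by (induction "is") (use assms in \<open>auto simp: tensA_interchange\<close>)

lemma tsum_append: "(\<And>i. x i \<in> Obj D) \<Longrightarrow> tsum T (is @ js) x = tens T (tsum T is x) (tsum T js x)"
  by (induction "is") auto

lemma tsumA_append: "(\<And>i. h i \<in> Arr D) \<Longrightarrow> tsumA D T (is @ js) h = tensA T (tsumA D T is h) (tsumA D T js h)"
  by (induction "is") auto

lemma tsum_concat: "(\<And>i. x i \<in> Obj D) \<Longrightarrow>
    tsum T (concat (map f ks)) x = tsum T ks (\<lambda>k. tsum T (f k) x)"
  by (induction ks) (auto simp: tsum_append)

lemma tsumA_concat: "(\<And>i. h i \<in> Arr D) \<Longrightarrow>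
    tsumA D T (concat (map f ks)) h = tsumA D T ks (\<lambda>k. tsumA D T (f k) h)"
  by (induction ks) (auto simp: tsumA_append)

lemma tsum_unt [simp]: "tsum T is (\<lambda>i. unt T) = unt T"
  by (induction "is") auto

lemma strict_tensor_op: "strict_tensor (op_cat D) T"
proof -
  interpret O: category "op_cat D" by (rule category_op)
  show ?thesis
    by unfold_locales (auto simp: hom_iff tensA_interchange)
qed

end

section \<open>Interchange of two iterated tensors\<close>

text \<open>A strict duoidal category.  The axioms say that \<open>\<otimes>\<^sub>T\<close> with \<open>iota\<close>, \<open>beta\<close> and \<open>unt T\<close> with
  \<open>tau\<close>, \<open>kappa\<close> are lax monoidal functors with respect to \<open>\<otimes>\<^sub>S\<close>, and that strict associativity
  and strict units of \<open>\<otimes>\<^sub>T\<close> are monoidal.  The list is invariant under reversing arrows and exchanging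
  \<open>S\<close> with \<open>T\<close>, \<open>beta\<close> with \<open>tau\<close>.  Strict SMI categories and symmetric tensors paired
  with themselves are the two sources of examples below.\<close>
locale duoidal = S: strict_tensor C S + T: strict_tensor C T
  for C :: "('o, 'a) cat" (structure)
    and S :: "('o, 'a, 'y) tensor_scheme" and T :: "('o, 'a, 'z) tensor_scheme" +
  fixes iota :: "'o \<Rightarrow> 'o \<Rightarrow> 'o \<Rightarrow> 'o \<Rightarrow> 'a" and beta tau kappa :: 'a
  assumes iota_arr: "\<lbrakk>A \<in> Obj C; B \<in> Obj C; D \<in> Obj C; E \<in> Obj C\<rbrakk> \<Longrightarrow>
      iota A B D E \<in> hom C (tens S (tens T A B) (tens T D E)) (tens T (tens S A D) (tens S B E))"
    and iota_natural: "\<lbrakk>a \<in> Arr C; b \<in> Arr C; d \<in> Arr C; e \<in> Arr C\<rbrakk> \<Longrightarrow>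
      iota (Cod C a) (Cod C b) (Cod C d) (Cod C e) \<cdot> tensA S (tensA T a b) (tensA T d e)
      = tensA T (tensA S a d) (tensA S b e) \<cdot> iota (Dom C a) (Dom C b) (Dom C d) (Dom C e)"
    and beta_arr: "beta \<in> hom C (unt S) (tens T (unt S) (unt S))"
    and tau_arr: "tau \<in> hom C (tens S (unt T) (unt T)) (unt T)"
    and kappa_arr: "kappa \<in> hom C (unt S) (unt T)"
    and iota_assoc_S: "\<lbrakk>A \<in> Obj C; B \<in> Obj C; X \<in> Obj C; D \<in> Obj C; E \<in> Obj C; F \<in> Obj C\<rbrakk> \<Longrightarrow>
      iota (tens S A B) (tens S D E) X F \<cdot> tensA S (iota A D B E) (Idt C (tens T X F))
      = iota A D (tens S B X) (tens S E F) \<cdot> tensA S (Idt C (tens T A D)) (iota B E X F)"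
    and iota_assoc_T: "\<lbrakk>A \<in> Obj C; B \<in> Obj C; X \<in> Obj C; D \<in> Obj C; E \<in> Obj C; F \<in> Obj C\<rbrakk> \<Longrightarrow>
      tensA T (Idt C (tens S A D)) (iota B X E F) \<cdot> iota A (tens T B X) D (tens T E F)
      = tensA T (iota A B D E) (Idt C (tens S X F)) \<cdot> iota (tens T A B) X (tens T D E) F"
    and iota_unit_S: "\<lbrakk>A \<in> Obj C; B \<in> Obj C\<rbrakk> \<Longrightarrow>
        iota A B (unt S) (unt S) \<cdot> tensA S (Idt C (tens T A B)) beta = Idt C (tens T A B)"
      "\<lbrakk>A \<in> Obj C; B \<in> Obj C\<rbrakk> \<Longrightarrow>
        iota (unt S) (unt S) A B \<cdot> tensA S beta (Idt C (tens T A B)) = Idt C (tens T A B)"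
    and iota_unit_T: "\<lbrakk>A \<in> Obj C; B \<in> Obj C\<rbrakk> \<Longrightarrow>
        tensA T (Idt C (tens S A B)) tau \<cdot> iota A (unt T) B (unt T) = Idt C (tens S A B)"
      "\<lbrakk>A \<in> Obj C; B \<in> Obj C\<rbrakk> \<Longrightarrow>
        tensA T tau (Idt C (tens S A B)) \<cdot> iota (unt T) A (unt T) B = Idt C (tens S A B)"
    and tau_assoc: "tau \<cdot> tensA S tau (Idt C (unt T)) = tau \<cdot> tensA S (Idt C (unt T)) tau"
    and tau_unit: "tau \<cdot> tensA S (Idt C (unt T)) kappa = Idt C (unt T)"
      "tau \<cdot> tensA S kappa (Idt C (unt T)) = Idt C (unt T)"
    and beta_assoc: "tensA T (Idt C (unt S)) beta \<cdot> beta = tensA T beta (Idt C (unt S)) \<cdot> beta"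
    and beta_unit: "tensA T (Idt C (unt S)) kappa \<cdot> beta = Idt C (unt S)"
      "tensA T kappa (Idt C (unt S)) \<cdot> beta = Idt C (unt S)"
begin

lemma structure_simps [simp]:
  "beta \<in> Arr C" "Dom C beta = unt S" "Cod C beta = unt S \<otimes>\<^bsub>T\<^esub> unt S"
  "tau \<in> Arr C" "Dom C tau = unt T \<otimes>\<^bsub>S\<^esub> unt T" "Cod C tau = unt T"
  "kappa \<in> Arr C" "Dom C kappa = unt S" "Cod C kappa = unt T"
  using beta_arr tau_arr kappa_arr by (auto simp: hom_iff)

lemma iota_simps [simp]:
  assumes "A \<in> Obj C" "B \<in> Obj C" "D \<in> Obj C" "E \<in> Obj C"
  shows "iota A B D E \<in> Arr C" "Dom C (iota A B D E) = (A \<otimes>\<^bsub>T\<^esub> B) \<otimes>\<^bsub>S\<^esub> (D \<otimes>\<^bsub>T\<^esub> E)"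
    "Cod C (iota A B D E) = (A \<otimes>\<^bsub>S\<^esub> D) \<otimes>\<^bsub>T\<^esub> (B \<otimes>\<^bsub>S\<^esub> E)"
  using iota_arr[OF assms] by (auto simp: hom_iff)

text \<open>The lax monoidal structure, with respect to \<open>\<otimes>\<^sub>S\<close>, of the functor that sends a row of
  objects to its \<open>T\<close>-tensor: \<open>interchange0\<close> is the unit constraint and \<open>interchange2\<close> the binary
  one.  The interchange for a matrix iterates the binary constraint over the rows.\<close>
primrec interchange0 :: "'j list \<Rightarrow> 'a" where
  "interchange0 [] = kappa"
| "interchange0 (j # js) = (\<one> (unt S) \<boxtimes>\<^bsub>T\<^esub> interchange0 js) \<cdot> beta"

primrec interchange2 :: "'j list \<Rightarrow> ('j \<Rightarrow> 'o) \<Rightarrow> ('j \<Rightarrow> 'o) \<Rightarrow> 'a" where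
  "interchange2 [] x y = tau"
| "interchange2 (j # js) x y = (\<one> (x j \<otimes>\<^bsub>S\<^esub> y j) \<boxtimes>\<^bsub>T\<^esub> interchange2 js x y) \<cdot>
    iota (x j) (tsum T js x) (y j) (tsum T js y)"

primrec interchange :: "'i list \<Rightarrow> 'j list \<Rightarrow> ('i \<Rightarrow> 'j \<Rightarrow> 'o) \<Rightarrow> 'a" where
  "interchange [] js X = interchange0 js"
| "interchange (i # is) js X = interchange2 js (X i) (\<lambda>j. tsum S is (\<lambda>i. X i j)) \<cdot>
    (\<one> (tsum T js (X i)) \<boxtimes>\<^bsub>S\<^esub> interchange is js X)"

lemma interchange0_simps [simp]:
  "interchange0 js \<in> Arr C" "Dom C (interchange0 js) = unt S" "Cod C (interchange0 js)
      = tsum T js (\<lambda>j. unt S)"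
  by (induction js) auto

lemma interchange2_simps [simp]:
  assumes "\<And>j. x j \<in> Obj C" "\<And>j. y j \<in> Obj C"
  shows "interchange2 js x y \<in> Arr C" "Dom C (interchange2 js x y) = tsum T js x \<otimes>\<^bsub>S\<^esub> tsum T js y"
    "Cod C (interchange2 js x y) = tsum T js (\<lambda>j. x j \<otimes>\<^bsub>S\<^esub> y j)"
  using assms by (induction js) auto

lemma interchange_simps [simp]:
  assumes "\<And>i j. X i j \<in> Obj C"
  shows "interchange is js X \<in> Arr C" "Dom C (interchange is js X) = tsum S is (\<lambda>i. tsum T js (X i))"
    "Cod C (interchange is js X) = tsum T js (\<lambda>j. tsum S is (\<lambda>i. X i j))"
  using assms by (induction "is") auto

lemma iota_natural_cmp:
  assumes "a \<in> Arr C" "b \<in> Arr C" "d \<in> Arr C" "e \<in> Arr C" "x \<in> Arr C"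
    "Cod C x = (Dom C a \<otimes>\<^bsub>T\<^esub> Dom C b) \<otimes>\<^bsub>S\<^esub> (Dom C d \<otimes>\<^bsub>T\<^esub> Dom C e)"
  shows "iota (Cod C a) (Cod C b) (Cod C d) (Cod C e) \<cdot> ((a \<boxtimes>\<^bsub>T\<^esub> b) \<boxtimes>\<^bsub>S\<^esub> (d \<boxtimes>\<^bsub>T\<^esub> e)) \<cdot> x
      = ((a \<boxtimes>\<^bsub>S\<^esub> d) \<boxtimes>\<^bsub>T\<^esub> (b \<boxtimes>\<^bsub>S\<^esub> e)) \<cdot> iota (Dom C a) (Dom C b) (Dom C d) (Dom C e) \<cdot> x"
  by (rule S.cmp_square_cmp[OF iota_natural]) (use assms in auto)

lemma interchange2_natural:
  assumes "\<And>j. f j \<in> Arr C" "\<And>j. g j \<in> Arr C"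
  shows "interchange2 js (\<lambda>j. Cod C (f j)) (\<lambda>j. Cod C (g j)) \<cdot> (tsumA C T js f \<boxtimes>\<^bsub>S\<^esub> tsumA C T js g)
    = tsumA C T js (\<lambda>j. f j \<boxtimes>\<^bsub>S\<^esub> g j) \<cdot> interchange2 js (\<lambda>j. Dom C (f j)) (\<lambda>j. Dom C (g j))"
proof (induction js)
  case (Cons j js)
  then show ?case
    using iota_natural[of "f j" "tsumA C T js f" "g j" "tsumA C T js g"] assms
    by (simp add: T.tensA_interchange_cmp)
qed (simp add: assms)

lemma interchange_natural:
  assumes "\<And>i j. h i j \<in> Arr C"
  shows "interchange is js (\<lambda>i j. Cod C (h i j)) \<cdot> tsumA C S is (\<lambda>i. tsumA C T js (h i))
    = tsumA C T js (\<lambda>j. tsumA C S is (\<lambda>i. h i j)) \<cdot> interchange is js (\<lambda>i j. Dom C (h i j))"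
proof (induction "is")
  case (Cons i "is")
  have "interchange2 js (\<lambda>j. Cod C (h i j)) (\<lambda>j. tsum S is (\<lambda>i. Cod C (h i j))) \<cdot>
     (\<one> (tsum T js (\<lambda>j. Cod C (h i j))) \<boxtimes>\<^bsub>S\<^esub> interchange is js (\<lambda>i j. Cod C (h i j))) \<cdot>
     (tsumA C T js (h i) \<boxtimes>\<^bsub>S\<^esub> tsumA C S is (\<lambda>i. tsumA C T js (h i)))
    = interchange2 js (\<lambda>j. Cod C (h i j)) (\<lambda>j. tsum S is (\<lambda>i. Cod C (h i j))) \<cdot>
      (tsumA C T js (h i) \<boxtimes>\<^bsub>S\<^esub> tsumA C T js (\<lambda>j. tsumA C S is (\<lambda>i. h i j))) \<cdot> 
      (\<one> (tsum T js (\<lambda>j. Dom C (h i j))) \<boxtimes>\<^bsub>S\<^esub> interchange is js (\<lambda>i j. Dom C (h i j)))"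
    using Cons by (simp add: assms S.tensA_interchange)
  also have "\<dots> = tsumA C T js (\<lambda>j. h i j \<boxtimes>\<^bsub>S\<^esub> tsumA C S is (\<lambda>i. h i j)) \<cdot>
      interchange2 js (\<lambda>j. Dom C (h i j)) (\<lambda>j. tsum S is (\<lambda>i. Dom C (h i j))) \<cdot>
      (\<one> (tsum T js (\<lambda>j. Dom C (h i j))) \<boxtimes>\<^bsub>S\<^esub> interchange is js (\<lambda>i j. Dom C (h i j)))"
    using interchange2_natural[of "h i" "\<lambda>j. tsumA C S is (\<lambda>i. h i j)" js]
    by (intro S.cmp_square_cmp) (simp_all add: assms)
  finally show ?case by (simp add: assms)
qed (simp add: assms)

text \<open>Splitting off the first column reduces this to associativity of \<open>iota\<close>: naturality moves
  the inner constraint of the remaining columns past \<open>iota\<close>.\<close>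
lemma interchange2_assoc:
  assumes "\<And>j. x j \<in> Obj C" "\<And>j. y j \<in> Obj C" "\<And>j. z j \<in> Obj C"
  shows "interchange2 js (\<lambda>j. x j \<otimes>\<^bsub>S\<^esub> y j) z \<cdot> (interchange2 js x y \<boxtimes>\<^bsub>S\<^esub> \<one> (tsum T js z))
    = interchange2 js x (\<lambda>j. y j \<otimes>\<^bsub>S\<^esub> z j) \<cdot> (\<one> (tsum T js x) \<boxtimes>\<^bsub>S\<^esub> interchange2 js y z)"
proof (induction js)
  case (Cons j js)
  let ?X = "tsum T js x" and ?Y = "tsum T js y" and ?Z = "tsum T js z"
  let ?I = "interchange2 js x y" and ?J = "interchange2 js y z"
  have "interchange2 (j # js) (\<lambda>j. x j \<otimes>\<^bsub>S\<^esub> y j) z \<cdot> (interchange2 (j # js) x y \<boxtimes>\<^bsub>S\<^esub> \<one> (tsum T (j # js) z))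
     = (\<one> (x j \<otimes>\<^bsub>S\<^esub> y j \<otimes>\<^bsub>S\<^esub> z j) \<boxtimes>\<^bsub>T\<^esub> interchange2 js (\<lambda>j. x j \<otimes>\<^bsub>S\<^esub> y j) z) \<cdot>
       iota (x j \<otimes>\<^bsub>S\<^esub> y j) (tsum T js (\<lambda>j. x j \<otimes>\<^bsub>S\<^esub> y j)) (z j) ?Z \<cdot>
       ((\<one> (x j \<otimes>\<^bsub>S\<^esub> y j) \<boxtimes>\<^bsub>T\<^esub> ?I) \<boxtimes>\<^bsub>S\<^esub> (\<one> (z j) \<boxtimes>\<^bsub>T\<^esub> \<one> ?Z)) \<cdot>
       (iota (x j) ?X (y j) ?Y \<boxtimes>\<^bsub>S\<^esub> \<one> (z j \<otimes>\<^bsub>T\<^esub> ?Z))"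
    using assms by (simp add: S.tensA_interchange)
  also have "\<dots> = (\<one> (x j \<otimes>\<^bsub>S\<^esub> y j \<otimes>\<^bsub>S\<^esub> z j) \<boxtimes>\<^bsub>T\<^esub> (interchange2 js (\<lambda>j. x j \<otimes>\<^bsub>S\<^esub> y j) z \<cdot> (?I \<boxtimes>\<^bsub>S\<^esub> \<one> ?Z))) \<cdot>
       iota (x j \<otimes>\<^bsub>S\<^esub> y j) (?X \<otimes>\<^bsub>S\<^esub> ?Y) (z j) ?Z \<cdot>
       (iota (x j) ?X (y j) ?Y \<boxtimes>\<^bsub>S\<^esub> \<one> (z j \<otimes>\<^bsub>T\<^esub> ?Z))"
    using assms iota_natural_cmp[of "\<one> (x j \<otimes>\<^bsub>S\<^esub> y j)" ?I "\<one> (z j)" "\<one> ?Z"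
        "iota (x j) ?X (y j) ?Y \<boxtimes>\<^bsub>S\<^esub> \<one> (z j \<otimes>\<^bsub>T\<^esub> ?Z)"]
    by (simp add: T.tensA_interchange_cmp del: T.tensA_idt)
  also have "\<dots> = (\<one> (x j \<otimes>\<^bsub>S\<^esub> y j \<otimes>\<^bsub>S\<^esub> z j) \<boxtimes>\<^bsub>T\<^esub> (interchange2 js x (\<lambda>j. y j \<otimes>\<^bsub>S\<^esub> z j) \<cdot> (\<one> ?X \<boxtimes>\<^bsub>S\<^esub> ?J))) \<cdot>
       iota (x j) ?X (y j \<otimes>\<^bsub>S\<^esub> z j) (?Y \<otimes>\<^bsub>S\<^esub> ?Z) \<cdot>
       (\<one> (x j \<otimes>\<^bsub>T\<^esub> ?X) \<boxtimes>\<^bsub>S\<^esub> iota (y j) ?Y (z j) ?Z)"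
    using assms Cons iota_assoc_S[of "x j" "y j" "z j" ?X ?Y ?Z] by simp
  also have "\<dots> = (\<one> (x j \<otimes>\<^bsub>S\<^esub> y j \<otimes>\<^bsub>S\<^esub> z j) \<boxtimes>\<^bsub>T\<^esub> interchange2 js x (\<lambda>j. y j \<otimes>\<^bsub>S\<^esub> z j)) \<cdot>
       iota (x j) ?X (y j \<otimes>\<^bsub>S\<^esub> z j) (tsum T js (\<lambda>j. y j \<otimes>\<^bsub>S\<^esub> z j)) \<cdot>
       ((\<one> (x j) \<boxtimes>\<^bsub>T\<^esub> \<one> ?X) \<boxtimes>\<^bsub>S\<^esub> (\<one> (y j \<otimes>\<^bsub>S\<^esub> z j) \<boxtimes>\<^bsub>T\<^esub> ?J)) \<cdot>
       (\<one> (x j \<otimes>\<^bsub>T\<^esub> ?X) \<boxtimes>\<^bsub>S\<^esub> iota (y j) ?Y (z j) ?Z)"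
    using assms iota_natural_cmp[of "\<one> (x j)" "\<one> ?X" "\<one> (y j \<otimes>\<^bsub>S\<^esub> z j)" ?J
        "\<one> (x j \<otimes>\<^bsub>T\<^esub> ?X) \<boxtimes>\<^bsub>S\<^esub> iota (y j) ?Y (z j) ?Z"]
    by (simp add: T.tensA_interchange_cmp del: T.tensA_idt)
  also have "\<dots> = interchange2 (j # js) x (\<lambda>j. y j \<otimes>\<^bsub>S\<^esub> z j) \<cdot>
      (\<one> (tsum T (j # js) x) \<boxtimes>\<^bsub>S\<^esub> interchange2 (j # js) y z)"
    using assms by (simp add: S.tensA_interchange)
  finally show ?case .
qed (simp add: tau_assoc)

lemma interchange2_unit_right:
  assumes "\<And>j. x j \<in> Obj C"
  shows "interchange2 js x (\<lambda>j. unt S) \<cdot> (\<one> (tsum T js x) \<boxtimes>\<^bsub>S\<^esub> interchange0 js) = \<one> (tsum T js x)"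
proof (induction js)
  case (Cons j js)
  let ?X = "tsum T js x" and ?U = "tsum T js (\<lambda>j. unt S)"
  have "interchange2 (j # js) x (\<lambda>j. unt S) \<cdot> (\<one> (tsum T (j # js) x) \<boxtimes>\<^bsub>S\<^esub> interchange0 (j # js))
    = (\<one> (x j) \<boxtimes>\<^bsub>T\<^esub> interchange2 js x (\<lambda>j. unt S)) \<cdot> iota (x j) ?X (unt S) ?U \<cdot>
      ((\<one> (x j) \<boxtimes>\<^bsub>T\<^esub> \<one> ?X) \<boxtimes>\<^bsub>S\<^esub> (\<one> (unt S) \<boxtimes>\<^bsub>T\<^esub> interchange0 js)) \<cdot> (\<one> (x j \<otimes>\<^bsub>T\<^esub> ?X) \<boxtimes>\<^bsub>S\<^esub> beta)"
    using assms by (simp add: S.tensA_interchange)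
  also have "\<dots> = (\<one> (x j) \<boxtimes>\<^bsub>T\<^esub> (interchange2 js x (\<lambda>j. unt S) \<cdot> (\<one> ?X \<boxtimes>\<^bsub>S\<^esub> interchange0 js))) \<cdot>
      iota (x j) ?X (unt S) (unt S) \<cdot> (\<one> (x j \<otimes>\<^bsub>T\<^esub> ?X) \<boxtimes>\<^bsub>S\<^esub> beta)"
    using assms iota_natural_cmp[of "\<one> (x j)" "\<one> ?X" "\<one> (unt S)" "interchange0 js"
        "\<one> (x j \<otimes>\<^bsub>T\<^esub> ?X) \<boxtimes>\<^bsub>S\<^esub> beta"]
    by (simp add: T.tensA_interchange_cmp del: T.tensA_idt)
  also have "\<dots> = \<one> (tsum T (j # js) x)"
    using assms Cons iota_unit_S(1)[of "x j" ?X] by simp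
  finally show ?case .
qed (simp add: tau_unit)

lemma interchange2_unit_left:
  assumes "\<And>j. x j \<in> Obj C"
  shows "interchange2 js (\<lambda>j. unt S) x \<cdot> (interchange0 js \<boxtimes>\<^bsub>S\<^esub> \<one> (tsum T js x)) = \<one> (tsum T js x)"
proof (induction js)
  case (Cons j js)
  let ?X = "tsum T js x" and ?U = "tsum T js (\<lambda>j. unt S)"
  have "interchange2 (j # js) (\<lambda>j. unt S) x \<cdot> (interchange0 (j # js) \<boxtimes>\<^bsub>S\<^esub> \<one> (tsum T (j # js) x))
    = (\<one> (x j) \<boxtimes>\<^bsub>T\<^esub> interchange2 js (\<lambda>j. unt S) x) \<cdot> iota (unt S) ?U (x j) ?X \<cdot>
      ((\<one> (unt S) \<boxtimes>\<^bsub>T\<^esub> interchange0 js) \<boxtimes>\<^bsub>S\<^esub> (\<one> (x j) \<boxtimes>\<^bsub>T\<^esub> \<one> ?X)) \<cdot> (beta \<boxtimes>\<^bsub>S\<^esub> \<one> (x j \<otimes>\<^bsub>T\<^esub> ?X))"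
    using assms by (simp add: S.tensA_interchange)
  also have "\<dots> = (\<one> (x j) \<boxtimes>\<^bsub>T\<^esub> (interchange2 js (\<lambda>j. unt S) x \<cdot> (interchange0 js \<boxtimes>\<^bsub>S\<^esub> \<one> ?X))) \<cdot>
      iota (unt S) (unt S) (x j) ?X \<cdot> (beta \<boxtimes>\<^bsub>S\<^esub> \<one> (x j \<otimes>\<^bsub>T\<^esub> ?X))"
    using assms iota_natural_cmp[of "\<one> (unt S)" "interchange0 js" "\<one> (x j)" "\<one> ?X"
        "beta \<boxtimes>\<^bsub>S\<^esub> \<one> (x j \<otimes>\<^bsub>T\<^esub> ?X)"]
    by (simp add: T.tensA_interchange_cmp del: T.tensA_idt)
  also have "\<dots> = \<one> (tsum T (j # js) x)"
    using assms Cons iota_unit_S(2)[of "x j" ?X] by simp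
  finally show ?case .
qed (simp add: tau_unit)

lemma interchange_row_single:
  assumes "\<And>i j. X i j \<in> Obj C"
  shows "interchange [i] js X = \<one> (tsum T js (X i))"
  using assms interchange2_unit_right[of "X i" js] by simp

text \<open>The usual passage from a binary to an unbiased lax monoidal structure: the left unit law
  starts the induction and associativity carries it on.\<close>
lemma interchange_row_append:
  assumes "\<And>i j. X i j \<in> Obj C"
  shows "interchange (is @ is') js X = interchange2 js (\<lambda>j. tsum S is (\<lambda>i. X i j)) (\<lambda>j. tsum S is'
      (\<lambda>i. X i j))
     \<cdot> (interchange is js X \<boxtimes>\<^bsub>S\<^esub> interchange is' js X)"
proof (induction "is")
  case Nil
  let ?y = "\<lambda>j. tsum S is' (\<lambda>i. X i j)"
  have "interchange2 js (\<lambda>j. unt S) ?y \<cdot> (interchange0 js \<boxtimes>\<^bsub>S\<^esub> interchange is' js X)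
     = interchange2 js (\<lambda>j. unt S) ?y \<cdot> (interchange0 js \<boxtimes>\<^bsub>S\<^esub> \<one> (tsum T js ?y)) \<cdot>
         (\<one> (unt S) \<boxtimes>\<^bsub>S\<^esub> interchange is' js X)"
    using assms by (simp add: S.tensA_interchange del: S.unt_tensA)
  also have "\<dots> = (interchange2 js (\<lambda>j. unt S) ?y \<cdot> (interchange0 js \<boxtimes>\<^bsub>S\<^esub> \<one> (tsum T js ?y))) \<cdot>
      interchange is' js X"
    using assms by simp
  also have "\<dots> = interchange is' js X" unfolding interchange2_unit_left[of ?y, OF S.tsum_obj[OF assms]]
    using assms by simp
  finally show ?case by simp
next
  case (Cons i "is")
  let ?x = "\<lambda>j. tsum S is (\<lambda>i. X i j)" and ?y = "\<lambda>j. tsum S is' (\<lambda>i. X i j)"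
  have "interchange ((i # is) @ is') js X = interchange2 js (X i) (\<lambda>j. ?x j \<otimes>\<^bsub>S\<^esub> ?y j)
     \<cdot> (\<one> (tsum T js (X i)) \<boxtimes>\<^bsub>S\<^esub> interchange2 js ?x ?y) \<cdot>
         (\<one> (tsum T js (X i)) \<boxtimes>\<^bsub>S\<^esub> (interchange is js X \<boxtimes>\<^bsub>S\<^esub> interchange is' js X))"
    using assms Cons by (simp add: S.tensA_interchange S.tsum_append)
  also have "\<dots> = interchange2 js (\<lambda>j. X i j \<otimes>\<^bsub>S\<^esub> ?x j) ?y
     \<cdot> (interchange2 js (X i) ?x \<boxtimes>\<^bsub>S\<^esub> \<one> (tsum T js ?y)) \<cdot>
         (\<one> (tsum T js (X i)) \<boxtimes>\<^bsub>S\<^esub> (interchange is js X \<boxtimes>\<^bsub>S\<^esub> interchange is' js X))"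
    by (rule S.cmp_square_cmp[OF interchange2_assoc[symmetric]]) (use assms in auto)
  also have "\<dots> = interchange2 js (\<lambda>j. X i j \<otimes>\<^bsub>S\<^esub> ?x j) ?y \<cdot> (interchange2 js (X i) ?x \<boxtimes>\<^bsub>S\<^esub> \<one> (tsum T js ?y))
     \<cdot> ((\<one> (tsum T js (X i)) \<boxtimes>\<^bsub>S\<^esub> interchange is js X) \<boxtimes>\<^bsub>S\<^esub> interchange is' js X)"
    using assms by simp
  also have "\<dots> = interchange2 js (\<lambda>j. tsum S (i # is) (\<lambda>i. X i j)) ?y \<cdot>
      (interchange (i # is) js X \<boxtimes>\<^bsub>S\<^esub> interchange is' js X)"
    using assms by (subst S.tensA_interchange) (simp_all del: S.tensA_assoc_right)
  finally show ?case .
qed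

lemma interchange_row_concat:
  assumes "\<And>i j. X i j \<in> Obj C"
  shows "interchange (concat (map f ks)) js X = interchange ks js (\<lambda>k j. tsum S (f k) (\<lambda>i. X i j))
     \<cdot> tsumA C S ks (\<lambda>k. interchange (f k) js X)"
  by (induction ks) (use assms in \<open>simp_all add: S.tensA_interchange interchange_row_append S.tsum_concat\<close>)

lemma interchange_cong:
  assumes "\<And>i j. i \<in> set is \<Longrightarrow> j \<in> set js \<Longrightarrow> X i j = Y i j"
  shows "interchange is js X = interchange is js Y"
proof -
  have b: "interchange2 js x y = interchange2 js x' y'" if "\<And>j. j \<in> set js \<Longrightarrow> x j = x' j" "\<And>j. j
      \<in> set js \<Longrightarrow> y j = y' j"
    for js :: "'c list" and x y x' y'
    using that by (induction js) (auto intro!: arg_cong2[of _ _ _ _ "Cmp C"] intro: tsum_cong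
        simp: tsum_cong[of js x x'] tsum_cong[of js y y'] cong: tsum_cong)
  show ?thesis using assms
  proof (induction "is")
    case (Cons i "is")
    have "tsum T js (X i) = tsum T js (Y i)" using Cons by (intro tsum_cong) auto
    moreover have "interchange is js X = interchange is js Y" using Cons by auto
    moreover have "interchange2 js (X i) (\<lambda>j. tsum S is (\<lambda>i. X i j))
        = interchange2 js (Y i) (\<lambda>j. tsum S is (\<lambda>i. Y i j))"
      using Cons by (intro b tsum_cong) auto
    ultimately show ?case by simp
  qed simp
qed

lemma duoidal_op: "duoidal (op_cat C) T S (\<lambda>A B D E. iota A D B E) tau beta kappa"
proof -
  interpret OT: strict_tensor "op_cat C" T by (rule T.strict_tensor_op)
  interpret OS: strict_tensor "op_cat C" S by (rule S.strict_tensor_op)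
  show ?thesis
    by unfold_locales
      (use iota_natural[symmetric] iota_assoc_S iota_assoc_T iota_unit_S iota_unit_T tau_assoc tau_unit
        beta_assoc beta_unit iota_arr in
        \<open>simp_all add: hom_iff\<close>)
qed

interpretation dual: duoidal "op_cat C" T S "\<lambda>A B D E. iota A D B E" tau beta kappa
  by (rule duoidal_op)

lemma dual_interchange2_simps [simp]:
  assumes "\<And>i. x i \<in> Obj C" "\<And>i. y i \<in> Obj C"
  shows "dual.interchange2 is x y \<in> Arr C" "Dom C (dual.interchange2 is x y) = tsum S is (\<lambda>i. x i \<otimes>\<^bsub>T\<^esub> y i)"
    "Cod C (dual.interchange2 is x y) = tsum S is x \<otimes>\<^bsub>T\<^esub> tsum S is y"
  using dual.interchange2_simps[of x y "is"] assms by auto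

text \<open>The interchange is defined by recursion over rows.  Its dual is the recursion over columns;
  both give the same arrow, as each of them takes \<open>iota\<close> at the corner of the matrix and leaves the
  first row, the first column and the remaining matrix to be interchanged.\<close>
lemma interchange_dual:
  assumes "\<And>i j. X i j \<in> Obj C"
  shows "dual.interchange js is (\<lambda>j i. X i j) = interchange is js X"
proof (induction js)
  case Nil
  show ?case by (induction "is") (use assms in auto)
next
  case (Cons j js)
  have "interchange is (j # js) X = (\<one> (tsum S is (\<lambda>i. X i j)) \<boxtimes>\<^bsub>T\<^esub> interchange is js X) \<cdot>
      dual.interchange2 is (\<lambda>i. X i j) (\<lambda>i. tsum T js (X i))"
  proof (induction "is")
    case (Cons i "is")
    let ?B = "dual.interchange2 is (\<lambda>i. X i j) (\<lambda>i. tsum T js (X i))" and ?R = "\<lambda>j. tsum S is (\<lambda>i. X i j)"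
    let ?P = "tsum T js (X i)"
    have "interchange (i # is) (j # js) X = (\<one> (X i j \<otimes>\<^bsub>S\<^esub> ?R j) \<boxtimes>\<^bsub>T\<^esub> interchange2 js (X i) ?R) \<cdot>
        iota (X i j) ?P (?R j) (tsum T js ?R) \<cdot>
        ((\<one> (X i j) \<boxtimes>\<^bsub>T\<^esub> \<one> ?P) \<boxtimes>\<^bsub>S\<^esub> (\<one> (?R j) \<boxtimes>\<^bsub>T\<^esub> interchange is js X)) \<cdot> (\<one> (X i j \<otimes>\<^bsub>T\<^esub> ?P) \<boxtimes>\<^bsub>S\<^esub> ?B)"
      using Cons assms by (simp add: S.tensA_interchange)
    also have "\<dots> = (\<one> (X i j \<otimes>\<^bsub>S\<^esub> ?R j) \<boxtimes>\<^bsub>T\<^esub> interchange2 js (X i) ?R) \<cdot>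
        (\<one> (X i j \<otimes>\<^bsub>S\<^esub> ?R j) \<boxtimes>\<^bsub>T\<^esub> (\<one> ?P \<boxtimes>\<^bsub>S\<^esub> interchange is js X)) \<cdot>
        iota (X i j) ?P (?R j) (tsum S is (\<lambda>i. tsum T js (X i))) \<cdot> (\<one> (X i j \<otimes>\<^bsub>T\<^esub> ?P) \<boxtimes>\<^bsub>S\<^esub> ?B)"
      using assms iota_natural_cmp[of "\<one> (X i j)" "\<one> ?P" "\<one> (?R j)" "interchange is js X"
          "\<one> (X i j \<otimes>\<^bsub>T\<^esub> ?P) \<boxtimes>\<^bsub>S\<^esub> ?B"]
      by (simp del: T.tensA_idt)
    also have "\<dots> = (\<one> (tsum S (i # is) (\<lambda>i. X i j)) \<boxtimes>\<^bsub>T\<^esub> interchange (i # is) js X) \<cdot>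
        dual.interchange2 (i # is) (\<lambda>i. X i j) (\<lambda>i. tsum T js (X i))"
      using assms by (simp add: T.tensA_interchange_cmp)
    finally show ?case .
  qed simp
  then show ?case using Cons by simp
qed

lemma interchange_col_single:
  assumes "\<And>i j. X i j \<in> Obj C"
  shows "interchange is [j] X = \<one> (tsum S is (\<lambda>i. X i j))"
  using dual.interchange_row_single[of "\<lambda>j i. X i j" j "is"] assms
  by (simp add: interchange_dual del: dual.interchange.simps)

lemma interchange_col_concat:
  assumes "\<And>i j. X i j \<in> Obj C"
  shows "interchange is (concat (map f ks)) X = tsumA C T ks (\<lambda>k. interchange is (f k) X)
     \<cdot> interchange is ks (\<lambda>i k. tsum T (f k) (X i))"
  using dual.interchange_row_concat[of "\<lambda>j i. X i j" f ks "is"]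
    interchange_dual[of "\<lambda>i k. tsum T (f k) (X i)"] assms by (simp add: interchange_dual)

end

section \<open>Symmetric tensors and the hexagon\<close>

locale strict_symmetric = strict_tensor C S
  for C :: "('o, 'a) cat" (structure) and S :: "('o, 'a, 'y) tensor_scheme" +
  fixes symm :: "'o \<Rightarrow> 'o \<Rightarrow> 'a"
  assumes symm_arr: "\<lbrakk>A \<in> Obj C; B \<in> Obj C\<rbrakk> \<Longrightarrow> symm A B \<in> hom C (tens S A B) (tens S B A)"
    and symm_natural: "\<lbrakk>f \<in> Arr C; g \<in> Arr C\<rbrakk> \<Longrightarrow>
      symm (Cod C f) (Cod C g) \<cdot> tensA S f g = tensA S g f \<cdot> symm (Dom C f) (Dom C g)"
    and symm_tens_left: "\<lbrakk>A \<in> Obj C; B \<in> Obj C; D \<in> Obj C\<rbrakk> \<Longrightarrow>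
      symm (tens S A B) D = tensA S (symm A D) (Idt C B) \<cdot> tensA S (Idt C A) (symm B D)"
    and symm_inverse: "\<lbrakk>A \<in> Obj C; B \<in> Obj C\<rbrakk> \<Longrightarrow> symm B A \<cdot> symm A B = Idt C (tens S A B)"
    and symm_unit [simp]: "A \<in> Obj C \<Longrightarrow> symm A (unt S) = Idt C A"
begin

lemma symm_simps [simp]:
  assumes "A \<in> Obj C" "B \<in> Obj C"
  shows "symm A B \<in> Arr C" "Dom C (symm A B) = A \<otimes>\<^bsub>S\<^esub> B" "Cod C (symm A B) = B \<otimes>\<^bsub>S\<^esub> A"
  using symm_arr[OF assms] by (auto simp: hom_iff)

lemma symm_unit_left [simp]:
  assumes "A \<in> Obj C"
  shows "symm (unt S) A = \<one> A"
  using symm_inverse[of A "unt S"] assms by simp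

text \<open>The other hexagon: both sides are inverse to \<open>symm (A \<otimes>\<^bsub>S\<^esub> B) D\<close>.\<close>
lemma symm_tens_right:
  assumes "A \<in> Obj C" "B \<in> Obj C" "D \<in> Obj C"
  shows "symm D (A \<otimes>\<^bsub>S\<^esub> B) = (\<one> A \<boxtimes>\<^bsub>S\<^esub> symm D B) \<cdot> (symm D A \<boxtimes>\<^bsub>S\<^esub> \<one> B)"
proof -
  let ?r = "(\<one> A \<boxtimes>\<^bsub>S\<^esub> symm D B) \<cdot> (symm D A \<boxtimes>\<^bsub>S\<^esub> \<one> B)" and ?l = "symm (A \<otimes>\<^bsub>S\<^esub> B) D"
  have "?r \<cdot> ?l = (\<one> A \<boxtimes>\<^bsub>S\<^esub> symm D B) \<cdot> ((symm D A \<cdot> symm A D) \<boxtimes>\<^bsub>S\<^esub> \<one> B) \<cdot> (\<one> A \<boxtimes>\<^bsub>S\<^esub> symm B D)"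
    using assms by (simp add: symm_tens_left tensA_interchange_cmp del: tensA_idt)
  also have "\<dots> = \<one> (A \<otimes>\<^bsub>S\<^esub> B \<otimes>\<^bsub>S\<^esub> D)"
    using assms by (simp add: symm_inverse tensA_interchange)
  finally have rl: "?r \<cdot> ?l = \<one> (A \<otimes>\<^bsub>S\<^esub> B \<otimes>\<^bsub>S\<^esub> D)" .
  have "symm D (A \<otimes>\<^bsub>S\<^esub> B) = (?r \<cdot> ?l) \<cdot> symm D (A \<otimes>\<^bsub>S\<^esub> B)"
    unfolding rl using assms by simp
  also have "\<dots> = ?r \<cdot> (?l \<cdot> symm D (A \<otimes>\<^bsub>S\<^esub> B))"
    using assms by (subst cmp_assoc_right) simp_all
  also have "\<dots> = ?r" using assms symm_inverse[of D "A \<otimes>\<^bsub>S\<^esub> B"] by simp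
  finally show ?thesis .
qed

text \<open>The middle-four exchange.  It makes a symmetric tensor duoidal with itself, with identities in
  place of \<open>beta\<close>, \<open>tau\<close> and \<open>kappa\<close> (all source and target objects coincide by strictness).\<close>
definition exchange :: "'o \<Rightarrow> 'o \<Rightarrow> 'o \<Rightarrow> 'o \<Rightarrow> 'a" where
  "exchange A B D E = \<one> A \<boxtimes>\<^bsub>S\<^esub> symm B D \<boxtimes>\<^bsub>S\<^esub> \<one> E"

text \<open>Rewriting with this lemma splits leading identities, so that arrows acting on a few adjacent
  factors can be brought to the form \<open>\<one> \<otimes> (f \<otimes> \<one>)\<close> with the same identities on both sides.\<close>
lemma idt_tens_tensA:
  assumes "A \<in> Obj C" "B \<in> Obj C" "f \<in> Arr C"
  shows "\<one> (A \<otimes>\<^bsub>S\<^esub> B) \<boxtimes>\<^bsub>S\<^esub> f = \<one> A \<boxtimes>\<^bsub>S\<^esub> (\<one> B \<boxtimes>\<^bsub>S\<^esub> f)"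
  using tensA_assoc_right[of "\<one> A" "\<one> B" f] assms by simp

lemma whisker_cmp:
  assumes "f \<in> Arr C" "g \<in> Arr C" "Cod C f = Dom C g" "A \<in> Obj C" "F \<in> Obj C"
  shows "(\<one> A \<boxtimes>\<^bsub>S\<^esub> (g \<boxtimes>\<^bsub>S\<^esub> \<one> F)) \<cdot> (\<one> A \<boxtimes>\<^bsub>S\<^esub> (f \<boxtimes>\<^bsub>S\<^esub> \<one> F)) = \<one> A \<boxtimes>\<^bsub>S\<^esub> ((g \<cdot> f) \<boxtimes>\<^bsub>S\<^esub> \<one> F)"
  using assms by (simp add: tensA_interchange)

text \<open>The outer factors \<open>A\<close> and \<open>F\<close> are not moved.  On the middle factors both sides equal
  \<open>\<one> \<otimes> \<sigma>\<^sub>D\<^sub>X \<otimes> \<one>\<close> after \<open>\<sigma>\<^sub>D\<^sub>B \<otimes> \<sigma>\<^sub>E\<^sub>X\<close>, by the two hexagons.\<close>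
lemma exchange_assoc_left:
  assumes "A \<in> Obj C" "B \<in> Obj C" "X \<in> Obj C" "D \<in> Obj C" "E \<in> Obj C" "F \<in> Obj C"
  shows "exchange (A \<otimes>\<^bsub>S\<^esub> B) (D \<otimes>\<^bsub>S\<^esub> E) X F \<cdot> (exchange A D B E \<boxtimes>\<^bsub>S\<^esub> \<one> (X \<otimes>\<^bsub>S\<^esub> F))
      = exchange A D (B \<otimes>\<^bsub>S\<^esub> X) (E \<otimes>\<^bsub>S\<^esub> F) \<cdot> (\<one> (A \<otimes>\<^bsub>S\<^esub> D) \<boxtimes>\<^bsub>S\<^esub> exchange B E X F)"
proof -
  have 1: "\<one> B \<boxtimes>\<^bsub>S\<^esub> symm (D \<otimes>\<^bsub>S\<^esub> E) X = (\<one> B \<boxtimes>\<^bsub>S\<^esub> (symm D X \<boxtimes>\<^bsub>S\<^esub> \<one> E)) \<cdot> (\<one> B \<boxtimes>\<^bsub>S\<^esub> (\<one> D \<boxtimes>\<^bsub>S\<^esub> symm E X))"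
    using assms by (simp add: symm_tens_left tensA_interchange)
  have 2: "(\<one> B \<boxtimes>\<^bsub>S\<^esub> (\<one> D \<boxtimes>\<^bsub>S\<^esub> symm E X)) \<cdot> (symm D B \<boxtimes>\<^bsub>S\<^esub> \<one> (E \<otimes>\<^bsub>S\<^esub> X)) = symm D B \<boxtimes>\<^bsub>S\<^esub> symm E X"
    using assms tensA_interchange[of "symm D B" "\<one> (B \<otimes>\<^bsub>S\<^esub> D)" "\<one> (E \<otimes>\<^bsub>S\<^esub> X)" "symm E X"]
    by (simp add: idt_tens_tensA)
  have 3: "symm D (B \<otimes>\<^bsub>S\<^esub> X) \<boxtimes>\<^bsub>S\<^esub> \<one> E = (\<one> B \<boxtimes>\<^bsub>S\<^esub> (symm D X \<boxtimes>\<^bsub>S\<^esub> \<one> E)) \<cdot> (symm D B \<boxtimes>\<^bsub>S\<^esub> \<one> (X \<otimes>\<^bsub>S\<^esub> E))"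
    using assms whisker_cmp[of "symm D B \<boxtimes>\<^bsub>S\<^esub> \<one> X" "\<one> B \<boxtimes>\<^bsub>S\<^esub> symm D X" "unt S" E]
    by (simp add: symm_tens_right)
  have 4: "(symm D B \<boxtimes>\<^bsub>S\<^esub> \<one> (X \<otimes>\<^bsub>S\<^esub> E)) \<cdot> (\<one> D \<boxtimes>\<^bsub>S\<^esub> (\<one> B \<boxtimes>\<^bsub>S\<^esub> symm E X)) = symm D B \<boxtimes>\<^bsub>S\<^esub> symm E X"
    using assms tensA_interchange[of "\<one> (D \<otimes>\<^bsub>S\<^esub> B)" "symm D B" "symm E X" "\<one> (X \<otimes>\<^bsub>S\<^esub> E)"]
    by (simp add: idt_tens_tensA)
  have mid: "(\<one> B \<boxtimes>\<^bsub>S\<^esub> symm (D \<otimes>\<^bsub>S\<^esub> E) X) \<cdot> (symm D B \<boxtimes>\<^bsub>S\<^esub> \<one> (E \<otimes>\<^bsub>S\<^esub> X))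
     = (symm D (B \<otimes>\<^bsub>S\<^esub> X) \<boxtimes>\<^bsub>S\<^esub> \<one> E) \<cdot> (\<one> D \<boxtimes>\<^bsub>S\<^esub> (\<one> B \<boxtimes>\<^bsub>S\<^esub> symm E X))"
    unfolding 1 3 using assms by (simp add: 2 4)
  show ?thesis
    using whisker_cmp[of "symm D B \<boxtimes>\<^bsub>S\<^esub> \<one> (E \<otimes>\<^bsub>S\<^esub> X)" "\<one> B \<boxtimes>\<^bsub>S\<^esub> symm (D \<otimes>\<^bsub>S\<^esub> E) X" A F]
      whisker_cmp[of "\<one> D \<boxtimes>\<^bsub>S\<^esub> (\<one> B \<boxtimes>\<^bsub>S\<^esub> symm E X)" "symm D (B \<otimes>\<^bsub>S\<^esub> X) \<boxtimes>\<^bsub>S\<^esub> \<one> E" A F] mid assms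
    by (simp add: exchange_def idt_tens_tensA)
qed

lemma exchange_assoc_right:
  assumes "A \<in> Obj C" "B \<in> Obj C" "X \<in> Obj C" "D \<in> Obj C" "E \<in> Obj C" "F \<in> Obj C"
  shows "(\<one> (A \<otimes>\<^bsub>S\<^esub> D) \<boxtimes>\<^bsub>S\<^esub> exchange B X E F) \<cdot> exchange A (B \<otimes>\<^bsub>S\<^esub> X) D (E \<otimes>\<^bsub>S\<^esub> F)
      = (exchange A B D E \<boxtimes>\<^bsub>S\<^esub> \<one> (X \<otimes>\<^bsub>S\<^esub> F)) \<cdot> exchange (A \<otimes>\<^bsub>S\<^esub> B) X (D \<otimes>\<^bsub>S\<^esub> E) F"
proof -
  have 1: "symm (B \<otimes>\<^bsub>S\<^esub> X) D \<boxtimes>\<^bsub>S\<^esub> \<one> E = (symm B D \<boxtimes>\<^bsub>S\<^esub> \<one> (X \<otimes>\<^bsub>S\<^esub> E)) \<cdot> (\<one> B \<boxtimes>\<^bsub>S\<^esub> (symm X D \<boxtimes>\<^bsub>S\<^esub> \<one> E))"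
    using assms whisker_cmp[of "\<one> B \<boxtimes>\<^bsub>S\<^esub> symm X D" "symm B D \<boxtimes>\<^bsub>S\<^esub> \<one> X" "unt S" E]
    by (simp add: symm_tens_left)
  have 2: "(\<one> D \<boxtimes>\<^bsub>S\<^esub> (\<one> B \<boxtimes>\<^bsub>S\<^esub> symm X E)) \<cdot> (symm B D \<boxtimes>\<^bsub>S\<^esub> \<one> (X \<otimes>\<^bsub>S\<^esub> E)) = symm B D \<boxtimes>\<^bsub>S\<^esub> symm X E"
    using assms tensA_interchange[of "symm B D" "\<one> (D \<otimes>\<^bsub>S\<^esub> B)" "\<one> (X \<otimes>\<^bsub>S\<^esub> E)" "symm X E"]
    by (simp add: idt_tens_tensA)
  have 3: "\<one> B \<boxtimes>\<^bsub>S\<^esub> symm X (D \<otimes>\<^bsub>S\<^esub> E) = (\<one> B \<boxtimes>\<^bsub>S\<^esub> (\<one> D \<boxtimes>\<^bsub>S\<^esub> symm X E)) \<cdot> (\<one> B \<boxtimes>\<^bsub>S\<^esub> (symm X D \<boxtimes>\<^bsub>S\<^esub> \<one> E))"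
    using assms by (simp add: symm_tens_right tensA_interchange)
  have 4: "(symm B D \<boxtimes>\<^bsub>S\<^esub> \<one> (E \<otimes>\<^bsub>S\<^esub> X)) \<cdot> (\<one> B \<boxtimes>\<^bsub>S\<^esub> (\<one> D \<boxtimes>\<^bsub>S\<^esub> symm X E)) = symm B D \<boxtimes>\<^bsub>S\<^esub> symm X E"
    using assms tensA_interchange[of "\<one> (B \<otimes>\<^bsub>S\<^esub> D)" "symm B D" "symm X E" "\<one> (E \<otimes>\<^bsub>S\<^esub> X)"]
    by (simp add: idt_tens_tensA)
  have "(\<one> D \<boxtimes>\<^bsub>S\<^esub> (\<one> B \<boxtimes>\<^bsub>S\<^esub> symm X E)) \<cdot> (symm B D \<boxtimes>\<^bsub>S\<^esub> \<one> (X \<otimes>\<^bsub>S\<^esub> E)) \<cdot> (\<one> B \<boxtimes>\<^bsub>S\<^esub> (symm X D \<boxtimes>\<^bsub>S\<^esub> \<one> E))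
     = (symm B D \<boxtimes>\<^bsub>S\<^esub> \<one> (E \<otimes>\<^bsub>S\<^esub> X)) \<cdot> (\<one> B \<boxtimes>\<^bsub>S\<^esub> (\<one> D \<boxtimes>\<^bsub>S\<^esub> symm X E)) \<cdot> (\<one> B \<boxtimes>\<^bsub>S\<^esub> (symm X D \<boxtimes>\<^bsub>S\<^esub> \<one> E))"
    by (rule cmp_square_cmp) (use assms in \<open>simp_all add: 2 4\<close>)
  then have mid: "(\<one> D \<boxtimes>\<^bsub>S\<^esub> (\<one> B \<boxtimes>\<^bsub>S\<^esub> symm X E)) \<cdot> (symm (B \<otimes>\<^bsub>S\<^esub> X) D \<boxtimes>\<^bsub>S\<^esub> \<one> E)
     = (symm B D \<boxtimes>\<^bsub>S\<^esub> \<one> (E \<otimes>\<^bsub>S\<^esub> X)) \<cdot> (\<one> B \<boxtimes>\<^bsub>S\<^esub> symm X (D \<otimes>\<^bsub>S\<^esub> E))"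
    unfolding 1 3 .
  show ?thesis
    using whisker_cmp[of "symm (B \<otimes>\<^bsub>S\<^esub> X) D \<boxtimes>\<^bsub>S\<^esub> \<one> E" "\<one> D \<boxtimes>\<^bsub>S\<^esub> (\<one> B \<boxtimes>\<^bsub>S\<^esub> symm X E)" A F]
      whisker_cmp[of "\<one> B \<boxtimes>\<^bsub>S\<^esub> symm X (D \<otimes>\<^bsub>S\<^esub> E)" "symm B D \<boxtimes>\<^bsub>S\<^esub> \<one> (E \<otimes>\<^bsub>S\<^esub> X)" A F] mid assms
    by (simp add: exchange_def idt_tens_tensA)
qed

lemma exchange_natural:
  assumes "a \<in> Arr C" "b \<in> Arr C" "d \<in> Arr C" "e \<in> Arr C"
  shows "exchange (Cod C a) (Cod C b) (Cod C d) (Cod C e) \<cdot> ((a \<boxtimes>\<^bsub>S\<^esub> b) \<boxtimes>\<^bsub>S\<^esub> (d \<boxtimes>\<^bsub>S\<^esub> e))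
     = ((a \<boxtimes>\<^bsub>S\<^esub> d) \<boxtimes>\<^bsub>S\<^esub> (b \<boxtimes>\<^bsub>S\<^esub> e)) \<cdot> exchange (Dom C a) (Dom C b) (Dom C d) (Dom C e)"
proof -
  have "exchange (Cod C a) (Cod C b) (Cod C d) (Cod C e) \<cdot> ((a \<boxtimes>\<^bsub>S\<^esub> b) \<boxtimes>\<^bsub>S\<^esub> (d \<boxtimes>\<^bsub>S\<^esub> e))
     = a \<boxtimes>\<^bsub>S\<^esub> ((symm (Cod C b) (Cod C d) \<cdot> (b \<boxtimes>\<^bsub>S\<^esub> d)) \<boxtimes>\<^bsub>S\<^esub> e)"
    using assms tensA_interchange[of "b \<boxtimes>\<^bsub>S\<^esub> d" "symm (Cod C b) (Cod C d)" e "\<one> (Cod C e)"]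
    by (simp add: exchange_def tensA_interchange)
  also have "\<dots> = a \<boxtimes>\<^bsub>S\<^esub> (((d \<boxtimes>\<^bsub>S\<^esub> b) \<cdot> symm (Dom C b) (Dom C d)) \<boxtimes>\<^bsub>S\<^esub> e)"
    using assms by (simp add: symm_natural)
  also have "\<dots> = ((a \<boxtimes>\<^bsub>S\<^esub> d) \<boxtimes>\<^bsub>S\<^esub> (b \<boxtimes>\<^bsub>S\<^esub> e)) \<cdot> exchange (Dom C a) (Dom C b) (Dom C d) (Dom C e)"
    using assms tensA_interchange[of "symm (Dom C b) (Dom C d)" "d \<boxtimes>\<^bsub>S\<^esub> b" "\<one> (Dom C e)" e]
    by (simp add: exchange_def tensA_interchange)
  finally show ?thesis .
qed

lemma duoidal_exchange: "duoidal C S S exchange (\<one> (unt S)) (\<one> (unt S)) (\<one> (unt S))"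
  by unfold_locales
    ((rule exchange_natural exchange_assoc_left exchange_assoc_right; assumption) |
      simp add: exchange_def hom_iff)+

lemma exchange_symm:
  assumes "A \<in> Obj C" "B \<in> Obj C" "X \<in> Obj C" "D \<in> Obj C"
  shows "exchange B D A X \<cdot> symm (A \<otimes>\<^bsub>S\<^esub> X) (B \<otimes>\<^bsub>S\<^esub> D) = (symm A B \<boxtimes>\<^bsub>S\<^esub> symm X D) \<cdot> exchange A X B D"
proof -
  have 1: "symm A (B \<otimes>\<^bsub>S\<^esub> D) \<boxtimes>\<^bsub>S\<^esub> \<one> X = (\<one> B \<boxtimes>\<^bsub>S\<^esub> (symm A D \<boxtimes>\<^bsub>S\<^esub> \<one> X)) \<cdot> (symm A B \<boxtimes>\<^bsub>S\<^esub> \<one> (D \<otimes>\<^bsub>S\<^esub> X))"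
    using assms whisker_cmp[of "symm A B \<boxtimes>\<^bsub>S\<^esub> \<one> D" "\<one> B \<boxtimes>\<^bsub>S\<^esub> symm A D" "unt S" X]
    by (simp add: symm_tens_right)
  have 2: "\<one> A \<boxtimes>\<^bsub>S\<^esub> symm X (B \<otimes>\<^bsub>S\<^esub> D) = (\<one> A \<boxtimes>\<^bsub>S\<^esub> (\<one> B \<boxtimes>\<^bsub>S\<^esub> symm X D)) \<cdot> (\<one> A \<boxtimes>\<^bsub>S\<^esub> (symm X B \<boxtimes>\<^bsub>S\<^esub> \<one> D))"
    using assms by (simp add: symm_tens_right tensA_interchange)
  have 3: "(symm A B \<boxtimes>\<^bsub>S\<^esub> \<one> (D \<otimes>\<^bsub>S\<^esub> X)) \<cdot> (\<one> A \<boxtimes>\<^bsub>S\<^esub> (\<one> B \<boxtimes>\<^bsub>S\<^esub> symm X D)) = symm A B \<boxtimes>\<^bsub>S\<^esub> symm X D"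
    using assms tensA_interchange[of "\<one> (A \<otimes>\<^bsub>S\<^esub> B)" "symm A B" "symm X D" "\<one> (D \<otimes>\<^bsub>S\<^esub> X)"]
    by (simp add: idt_tens_tensA)
  have 4: "exchange B D A X \<cdot> (\<one> B \<boxtimes>\<^bsub>S\<^esub> (symm A D \<boxtimes>\<^bsub>S\<^esub> \<one> X)) = \<one> (B \<otimes>\<^bsub>S\<^esub> A \<otimes>\<^bsub>S\<^esub> D \<otimes>\<^bsub>S\<^esub> X)"
    using assms whisker_cmp[of "symm A D" "symm D A" B X] by (simp add: exchange_def symm_inverse)
  have ex [simp]: "exchange B D A X \<in> Arr C" "Dom C (exchange B D A X) = B \<otimes>\<^bsub>S\<^esub> D \<otimes>\<^bsub>S\<^esub> A \<otimes>\<^bsub>S\<^esub> X"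
    using assms by (simp_all add: exchange_def)
  have "exchange B D A X \<cdot> symm (A \<otimes>\<^bsub>S\<^esub> X) (B \<otimes>\<^bsub>S\<^esub> D)
     = (exchange B D A X \<cdot> (\<one> B \<boxtimes>\<^bsub>S\<^esub> (symm A D \<boxtimes>\<^bsub>S\<^esub> \<one> X))) \<cdot>
       (((symm A B \<boxtimes>\<^bsub>S\<^esub> \<one> (D \<otimes>\<^bsub>S\<^esub> X)) \<cdot> (\<one> A \<boxtimes>\<^bsub>S\<^esub> (\<one> B \<boxtimes>\<^bsub>S\<^esub> symm X D))) \<cdot> (\<one> A \<boxtimes>\<^bsub>S\<^esub> (symm X B \<boxtimes>\<^bsub>S\<^esub> \<one> D)))"
    using assms by (simp add: symm_tens_left[of A X "B \<otimes>\<^bsub>S\<^esub> D"] 1 2)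
  also have "\<dots> = (symm A B \<boxtimes>\<^bsub>S\<^esub> symm X D) \<cdot> exchange A X B D"
    unfolding 3 4 using assms by (simp add: exchange_def)
  finally show ?thesis .
qed

sublocale self: duoidal C S S exchange "\<one> (unt S)" "\<one> (unt S)" "\<one> (unt S)"
  by (rule duoidal_exchange)

lemma strict_symmetric_op: "strict_symmetric (op_cat C) S (\<lambda>A B. symm B A)"
proof -
  interpret O: strict_tensor "op_cat C" S by (rule strict_tensor_op)
  show ?thesis
    by unfold_locales (simp_all add: hom_iff symm_natural symm_tens_right symm_inverse)
qed

end

text \<open>The two axioms say that \<open>\<otimes>\<^sub>T\<close> and \<open>unt T\<close> are symmetric as lax monoidal functors with
  respect to \<open>\<otimes>\<^sub>S\<close>.\<close>
locale symmetric_duoidal = duoidal C S T iota beta tau kappa + Sy: strict_symmetric C S symm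
  for C :: "('o, 'a) cat" (structure)
    and S :: "('o, 'a, 'y) tensor_scheme" and T :: "('o, 'a, 'z) tensor_scheme"
    and iota :: "'o \<Rightarrow> 'o \<Rightarrow> 'o \<Rightarrow> 'o \<Rightarrow> 'a" and beta tau kappa :: 'a and symm :: "'o \<Rightarrow> 'o \<Rightarrow> 'a" +
  assumes iota_symm: "\<lbrakk>A \<in> Obj C; B \<in> Obj C; X \<in> Obj C; D \<in> Obj C\<rbrakk> \<Longrightarrow>
      iota B D A X \<cdot> symm (tens T A X) (tens T B D) = tensA T (symm A B) (symm X D) \<cdot> iota A X B D"
    and tau_symm: "tau \<cdot> symm (unt T) (unt T) = tau"
begin

lemma interchange2_symm:
  assumes "\<And>j. x j \<in> Obj C" "\<And>j. y j \<in> Obj C"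
  shows "interchange2 js y x \<cdot> symm (tsum T js x) (tsum T js y)
    = tsumA C T js (\<lambda>j. symm (x j) (y j)) \<cdot> interchange2 js x y"
  by (induction js) (use assms in \<open>simp_all add: tau_symm iota_symm T.tensA_interchange_cmp\<close>)

text \<open>The fourfold constraint, bracketed so that the two middle arguments meet first.  In this form
  exchanging them comes down to \<open>interchange2_symm\<close> for \<open>b\<close> and \<open>c\<close>.\<close>
lemma interchange2_four:
  assumes "\<And>j. a j \<in> Obj C" "\<And>j. b j \<in> Obj C" "\<And>j. c j \<in> Obj C" "\<And>j. d j \<in> Obj C"
  shows "interchange2 js (\<lambda>j. a j \<otimes>\<^bsub>S\<^esub> b j) (\<lambda>j. c j \<otimes>\<^bsub>S\<^esub> d j) \<cdot>
      (interchange2 js a b \<boxtimes>\<^bsub>S\<^esub> interchange2 js c d)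
    = interchange2 js a (\<lambda>j. b j \<otimes>\<^bsub>S\<^esub> c j \<otimes>\<^bsub>S\<^esub> d j) \<cdot>
      (\<one> (tsum T js a) \<boxtimes>\<^bsub>S\<^esub> (interchange2 js (\<lambda>j. b j \<otimes>\<^bsub>S\<^esub> c j) d \<cdot>
          (interchange2 js b c \<boxtimes>\<^bsub>S\<^esub> \<one> (tsum T js d))))"
proof -
  have "interchange2 js (\<lambda>j. a j \<otimes>\<^bsub>S\<^esub> b j) (\<lambda>j. c j \<otimes>\<^bsub>S\<^esub> d j) \<cdot>
      (interchange2 js a b \<boxtimes>\<^bsub>S\<^esub> interchange2 js c d)
    = interchange2 js (\<lambda>j. a j \<otimes>\<^bsub>S\<^esub> b j) (\<lambda>j. c j \<otimes>\<^bsub>S\<^esub> d j) \<cdot>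
        (interchange2 js a b \<boxtimes>\<^bsub>S\<^esub> \<one> (tsum T js (\<lambda>j. c j \<otimes>\<^bsub>S\<^esub> d j)))
      \<cdot> (\<one> (tsum T js a \<otimes>\<^bsub>S\<^esub> tsum T js b) \<boxtimes>\<^bsub>S\<^esub> interchange2 js c d)"
    using assms by (simp add: S.tensA_interchange)
  also have "\<dots> = interchange2 js a (\<lambda>j. b j \<otimes>\<^bsub>S\<^esub> c j \<otimes>\<^bsub>S\<^esub> d j) \<cdot>
      (\<one> (tsum T js a) \<boxtimes>\<^bsub>S\<^esub> interchange2 js b (\<lambda>j. c j \<otimes>\<^bsub>S\<^esub> d j))
      \<cdot> (\<one> (tsum T js a \<otimes>\<^bsub>S\<^esub> tsum T js b) \<boxtimes>\<^bsub>S\<^esub> interchange2 js c d)"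
    by (rule S.cmp_square_cmp[OF interchange2_assoc]) (simp_all add: assms)
  also have "\<dots> = interchange2 js a (\<lambda>j. b j \<otimes>\<^bsub>S\<^esub> c j \<otimes>\<^bsub>S\<^esub> d j) \<cdot>
      (\<one> (tsum T js a) \<boxtimes>\<^bsub>S\<^esub> (interchange2 js b (\<lambda>j. c j \<otimes>\<^bsub>S\<^esub> d j) \<cdot>
          (\<one> (tsum T js b) \<boxtimes>\<^bsub>S\<^esub> interchange2 js c d)))"
    using assms Sy.idt_tens_tensA[of "tsum T js a" "tsum T js b" "interchange2 js c d"]
    by (simp add: S.tensA_interchange)
  also have "interchange2 js b (\<lambda>j. c j \<otimes>\<^bsub>S\<^esub> d j) \<cdot> (\<one> (tsum T js b) \<boxtimes>\<^bsub>S\<^esub> interchange2 js c d)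
      = interchange2 js (\<lambda>j. b j \<otimes>\<^bsub>S\<^esub> c j) d \<cdot> (interchange2 js b c \<boxtimes>\<^bsub>S\<^esub> \<one> (tsum T js d))"
    using interchange2_assoc[of b c d js] assms by simp
  finally show ?thesis .
qed

lemma interchange2_exchange:
  assumes "\<And>j. a j \<in> Obj C" "\<And>j. b j \<in> Obj C" "\<And>j. c j \<in> Obj C" "\<And>j. d j \<in> Obj C"
  shows "tsumA C T js (\<lambda>j. Sy.exchange (a j) (b j) (c j) (d j)) \<cdot>
      interchange2 js (\<lambda>j. a j \<otimes>\<^bsub>S\<^esub> b j) (\<lambda>j. c j \<otimes>\<^bsub>S\<^esub> d j) \<cdot> (interchange2 js a b \<boxtimes>\<^bsub>S\<^esub> interchange2 js c d)
    = interchange2 js (\<lambda>j. a j \<otimes>\<^bsub>S\<^esub> c j) (\<lambda>j. b j \<otimes>\<^bsub>S\<^esub> d j) \<cdot>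
        (interchange2 js a c \<boxtimes>\<^bsub>S\<^esub> interchange2 js b d) \<cdot>
      Sy.exchange (tsum T js a) (tsum T js b) (tsum T js c) (tsum T js d)"
proof -
  let ?s = "tsumA C T js (\<lambda>j. symm (b j) (c j))" and ?D = "tsum T js d"
  let ?g = "tsumA C T js (\<lambda>j. symm (b j) (c j) \<boxtimes>\<^bsub>S\<^esub> \<one> (d j))"
  have g: "?g \<cdot> interchange2 js (\<lambda>j. b j \<otimes>\<^bsub>S\<^esub> c j) d = interchange2 js (\<lambda>j. c j \<otimes>\<^bsub>S\<^esub> b j) d \<cdot>
      (?s \<boxtimes>\<^bsub>S\<^esub> \<one> ?D)"
    using interchange2_natural[of "\<lambda>j. symm (b j) (c j)" "\<lambda>j. \<one> (d j)" js] assms by simp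
  have "?g \<cdot> interchange2 js (\<lambda>j. b j \<otimes>\<^bsub>S\<^esub> c j) d \<cdot> (interchange2 js b c \<boxtimes>\<^bsub>S\<^esub> \<one> ?D)
     = interchange2 js (\<lambda>j. c j \<otimes>\<^bsub>S\<^esub> b j) d \<cdot> (?s \<boxtimes>\<^bsub>S\<^esub> \<one> ?D) \<cdot> (interchange2 js b c \<boxtimes>\<^bsub>S\<^esub> \<one> ?D)"
    by (rule S.cmp_square_cmp[OF g]) (use assms in auto)
  also have "\<dots> = interchange2 js (\<lambda>j. c j \<otimes>\<^bsub>S\<^esub> b j) d \<cdot> (interchange2 js c b \<boxtimes>\<^bsub>S\<^esub> \<one> ?D) \<cdot>
      (symm (tsum T js b) (tsum T js c) \<boxtimes>\<^bsub>S\<^esub> \<one> ?D)"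
    using interchange2_symm[of b c js] assms by (simp add: S.tensA_interchange)
  finally have 1: "?g \<cdot> interchange2 js (\<lambda>j. b j \<otimes>\<^bsub>S\<^esub> c j) d \<cdot> (interchange2 js b c \<boxtimes>\<^bsub>S\<^esub> \<one> ?D) = \<dots>" .
  have "tsumA C T js (\<lambda>j. Sy.exchange (a j) (b j) (c j) (d j)) \<cdot>
      interchange2 js a (\<lambda>j. b j \<otimes>\<^bsub>S\<^esub> c j \<otimes>\<^bsub>S\<^esub> d j) = interchange2 js a (\<lambda>j. c j \<otimes>\<^bsub>S\<^esub> b j \<otimes>\<^bsub>S\<^esub> d j) \<cdot>
          (\<one> (tsum T js a) \<boxtimes>\<^bsub>S\<^esub> ?g)"
    using interchange2_natural[of "\<lambda>j. \<one> (a j)" "\<lambda>j. symm (b j) (c j) \<boxtimes>\<^bsub>S\<^esub> \<one> (d j)" js] assms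
    by (simp add: Sy.exchange_def)
  from S.cmp_square_cmp[OF this, of "\<one> (tsum T js a) \<boxtimes>\<^bsub>S\<^esub> (interchange2 js (\<lambda>j. b j \<otimes>\<^bsub>S\<^esub> c j) d \<cdot>
      (interchange2 js b c \<boxtimes>\<^bsub>S\<^esub> \<one> ?D))"]
  have "tsumA C T js (\<lambda>j. Sy.exchange (a j) (b j) (c j) (d j)) \<cdot>
      interchange2 js (\<lambda>j. a j \<otimes>\<^bsub>S\<^esub> b j) (\<lambda>j. c j \<otimes>\<^bsub>S\<^esub> d j) \<cdot> (interchange2 js a b \<boxtimes>\<^bsub>S\<^esub> interchange2 js c d)
     = interchange2 js a (\<lambda>j. c j \<otimes>\<^bsub>S\<^esub> b j \<otimes>\<^bsub>S\<^esub> d j) \<cdot> (\<one> (tsum T js a) \<boxtimes>\<^bsub>S\<^esub> ?g) \<cdot>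
      (\<one> (tsum T js a) \<boxtimes>\<^bsub>S\<^esub> (interchange2 js (\<lambda>j. b j \<otimes>\<^bsub>S\<^esub> c j) d \<cdot> (interchange2 js b c \<boxtimes>\<^bsub>S\<^esub> \<one> ?D)))"
    unfolding interchange2_four[of a b c d, OF assms] using assms by (simp add: Sy.exchange_def)
  also have "\<dots> = (interchange2 js a (\<lambda>j. c j \<otimes>\<^bsub>S\<^esub> b j \<otimes>\<^bsub>S\<^esub> d j) \<cdot> (\<one> (tsum T js a) \<boxtimes>\<^bsub>S\<^esub>
      (interchange2 js (\<lambda>j. c j \<otimes>\<^bsub>S\<^esub> b j) d \<cdot> (interchange2 js c b \<boxtimes>\<^bsub>S\<^esub> \<one> ?D)))) \<cdot>
          Sy.exchange (tsum T js a) (tsum T js b) (tsum T js c) ?D"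
    using assms by (simp add: 1 S.tensA_interchange Sy.exchange_def)
  also have "\<dots> = interchange2 js (\<lambda>j. a j \<otimes>\<^bsub>S\<^esub> c j) (\<lambda>j. b j \<otimes>\<^bsub>S\<^esub> d j) \<cdot>
      (interchange2 js a c \<boxtimes>\<^bsub>S\<^esub> interchange2 js b d) \<cdot>
      Sy.exchange (tsum T js a) (tsum T js b) (tsum T js c) (tsum T js d)"
    unfolding interchange2_four[of a c b d, OF assms(1,3,2,4), symmetric] using assms by simp
  finally show ?thesis .
qed

text \<open>The hexagon for two rows, with respect to \<open>S\<close> twice and \<open>T\<close>: one more element of \<open>js\<close> costs
  one middle-four exchange, supplied by \<open>interchange2_exchange\<close>.\<close>
lemma interchange_interchange2:
  assumes "\<And>j k. x j k \<in> Obj C" "\<And>j k. y j k \<in> Obj C"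
  shows "interchange js ks (\<lambda>j k. x j k \<otimes>\<^bsub>S\<^esub> y j k) \<cdot> tsumA C S js (\<lambda>j. interchange2 ks (x j) (y j))
     \<cdot> Sy.self.interchange2 js (\<lambda>j. tsum T ks (x j)) (\<lambda>j. tsum T ks (y j))
   = tsumA C T ks (\<lambda>k. Sy.self.interchange2 js (\<lambda>j. x j k) (\<lambda>j. y j k))
     \<cdot> interchange2 ks (\<lambda>k. tsum S js (\<lambda>j. x j k)) (\<lambda>k. tsum S js (\<lambda>j. y j k))
     \<cdot> (interchange js ks x \<boxtimes>\<^bsub>S\<^esub> interchange js ks y)"
proof (induction js)
  case Nil
  have "interchange2 ks (\<lambda>k. unt S) (\<lambda>k. unt S) \<cdot> (interchange0 ks \<boxtimes>\<^bsub>S\<^esub> interchange0 ks)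
     = interchange2 ks (\<lambda>k. unt S) (\<lambda>k. unt S) \<cdot> ((interchange0 ks \<boxtimes>\<^bsub>S\<^esub> \<one> (tsum T ks (\<lambda>k. unt S))) \<cdot>
         (\<one> (unt S) \<boxtimes>\<^bsub>S\<^esub> interchange0 ks))"
    by (simp add: S.tensA_interchange del: S.unt_tensA)
  also have "\<dots> = (interchange2 ks (\<lambda>k. unt S) (\<lambda>k. unt S) \<cdot>
      (interchange0 ks \<boxtimes>\<^bsub>S\<^esub> \<one> (tsum T ks (\<lambda>k. unt S)))) \<cdot> interchange0 ks"
    by simp
  also have "\<dots> = interchange0 ks" by (subst interchange2_unit_left) simp_all
  finally show ?case by simp
next
  case (Cons j js)
  let ?X = "\<lambda>k. tsum S js (\<lambda>j. x j k)" and ?Y = "\<lambda>k. tsum S js (\<lambda>j. y j k)"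
  let ?Z = "\<lambda>k. tsum S js (\<lambda>j. x j k \<otimes>\<^bsub>S\<^esub> y j k)"
  let ?P = "tsum T ks (x j)" and ?Q = "tsum T ks (y j)"
  let ?PX = "tsum S js (\<lambda>j. tsum T ks (x j))" and ?QY = "tsum S js (\<lambda>j. tsum T ks (y j))"
  let ?I = "interchange js ks x" and ?J = "interchange js ks y" and ?W =
      "interchange js ks (\<lambda>j k. x j k \<otimes>\<^bsub>S\<^esub> y j k)"
  let ?sb = "\<lambda>k. Sy.self.interchange2 js (\<lambda>j. x j k) (\<lambda>j. y j k)"
  let ?sT = "Sy.self.interchange2 js (\<lambda>j. tsum T ks (x j)) (\<lambda>j. tsum T ks (y j))"
  let ?L = "tsumA C S js (\<lambda>j. interchange2 ks (x j) (y j))"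
  let ?ab = "\<lambda>k. x j k \<otimes>\<^bsub>S\<^esub> y j k"
  note [simp] = assms
  have "interchange (j # js) ks (\<lambda>j k. x j k \<otimes>\<^bsub>S\<^esub> y j k) \<cdot>
      tsumA C S (j # js) (\<lambda>j. interchange2 ks (x j) (y j))
     \<cdot> Sy.self.interchange2 (j # js) (\<lambda>j. tsum T ks (x j)) (\<lambda>j. tsum T ks (y j))
    = interchange2 ks ?ab ?Z \<cdot> (interchange2 ks (x j) (y j) \<boxtimes>\<^bsub>S\<^esub> (?W \<cdot> ?L \<cdot> ?sT)) \<cdot>
        Sy.exchange ?P ?PX ?Q ?QY"
    using S.tensA_interchange_cmp[of "\<one> (?P \<otimes>\<^bsub>S\<^esub> ?Q)" "interchange2 ks (x j) (y j)" ?sT ?L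
        "Sy.exchange ?P ?PX ?Q ?QY"]
      S.tensA_interchange_cmp[of "interchange2 ks (x j) (y j)" "\<one> (tsum T ks ?ab)" "?L \<cdot> ?sT" ?W
          "Sy.exchange ?P ?PX ?Q ?QY"]
    by simp
  also have "\<dots> = interchange2 ks ?ab ?Z \<cdot> (\<one> (tsum T ks ?ab) \<boxtimes>\<^bsub>S\<^esub> tsumA C T ks ?sb) \<cdot>
      (interchange2 ks (x j) (y j) \<boxtimes>\<^bsub>S\<^esub> interchange2 ks ?X ?Y) \<cdot> (\<one> (?P \<otimes>\<^bsub>S\<^esub> ?Q) \<boxtimes>\<^bsub>S\<^esub> (?I \<boxtimes>\<^bsub>S\<^esub> ?J)) \<cdot>
          Sy.exchange ?P ?PX ?Q ?QY"
    unfolding Cons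
    using S.tensA_interchange_cmp[of "\<one> (?P \<otimes>\<^bsub>S\<^esub> ?Q)" "interchange2 ks (x j) (y j)" "?I \<boxtimes>\<^bsub>S\<^esub> ?J"
        "interchange2 ks ?X ?Y" "Sy.exchange ?P ?PX ?Q ?QY"]
      S.tensA_interchange_cmp[of "interchange2 ks (x j) (y j)" "\<one> (tsum T ks ?ab)"
          "interchange2 ks ?X ?Y \<cdot> (?I \<boxtimes>\<^bsub>S\<^esub> ?J)" "tsumA C T ks ?sb" "Sy.exchange ?P ?PX ?Q ?QY"]
    by simp
  also have "\<dots> = tsumA C T ks (\<lambda>k. \<one> (x j k \<otimes>\<^bsub>S\<^esub> y j k) \<boxtimes>\<^bsub>S\<^esub> ?sb k) \<cdot>
      interchange2 ks ?ab (\<lambda>k. ?X k \<otimes>\<^bsub>S\<^esub> ?Y k) \<cdot>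
      (interchange2 ks (x j) (y j) \<boxtimes>\<^bsub>S\<^esub> interchange2 ks ?X ?Y) \<cdot> (\<one> (?P \<otimes>\<^bsub>S\<^esub> ?Q) \<boxtimes>\<^bsub>S\<^esub> (?I \<boxtimes>\<^bsub>S\<^esub> ?J)) \<cdot>
          Sy.exchange ?P ?PX ?Q ?QY"
    using interchange2_natural[of "\<lambda>k. \<one> (x j k \<otimes>\<^bsub>S\<^esub> y j k)" ?sb ks]
    by (intro S.cmp_square_cmp) simp_all
  also have "(\<one> (?P \<otimes>\<^bsub>S\<^esub> ?Q) \<boxtimes>\<^bsub>S\<^esub> (?I \<boxtimes>\<^bsub>S\<^esub> ?J)) \<cdot> Sy.exchange ?P ?PX ?Q ?QY
      = Sy.exchange ?P (tsum T ks ?X) ?Q (tsum T ks ?Y) \<cdot> ((\<one> ?P \<boxtimes>\<^bsub>S\<^esub> ?I) \<boxtimes>\<^bsub>S\<^esub> (\<one> ?Q \<boxtimes>\<^bsub>S\<^esub> ?J))"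
    using Sy.exchange_natural[of "\<one> ?P" ?I "\<one> ?Q" ?J] by simp
  also have "interchange2 ks ?ab (\<lambda>k. ?X k \<otimes>\<^bsub>S\<^esub> ?Y k) \<cdot>
      (interchange2 ks (x j) (y j) \<boxtimes>\<^bsub>S\<^esub> interchange2 ks ?X ?Y) \<cdot>
       Sy.exchange ?P (tsum T ks ?X) ?Q (tsum T ks ?Y) \<cdot> ((\<one> ?P \<boxtimes>\<^bsub>S\<^esub> ?I) \<boxtimes>\<^bsub>S\<^esub> (\<one> ?Q \<boxtimes>\<^bsub>S\<^esub> ?J))
     = (interchange2 ks ?ab (\<lambda>k. ?X k \<otimes>\<^bsub>S\<^esub> ?Y k) \<cdot>
         (interchange2 ks (x j) (y j) \<boxtimes>\<^bsub>S\<^esub> interchange2 ks ?X ?Y) \<cdot>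
       Sy.exchange ?P (tsum T ks ?X) ?Q (tsum T ks ?Y)) \<cdot> ((\<one> ?P \<boxtimes>\<^bsub>S\<^esub> ?I) \<boxtimes>\<^bsub>S\<^esub> (\<one> ?Q \<boxtimes>\<^bsub>S\<^esub> ?J))"
    by simp
  also have "\<dots> = (tsumA C T ks (\<lambda>k. Sy.exchange (x j k) (?X k) (y j k) (?Y k)) \<cdot>
      interchange2 ks (\<lambda>k. x j k \<otimes>\<^bsub>S\<^esub> ?X k) (\<lambda>k. y j k \<otimes>\<^bsub>S\<^esub> ?Y k) \<cdot>
          (interchange2 ks (x j) ?X \<boxtimes>\<^bsub>S\<^esub> interchange2 ks (y j) ?Y)) \<cdot>
      ((\<one> ?P \<boxtimes>\<^bsub>S\<^esub> ?I) \<boxtimes>\<^bsub>S\<^esub> (\<one> ?Q \<boxtimes>\<^bsub>S\<^esub> ?J))"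
    by (subst interchange2_exchange) simp_all
  also have "tsumA C T ks (\<lambda>k. \<one> (x j k \<otimes>\<^bsub>S\<^esub> y j k) \<boxtimes>\<^bsub>S\<^esub> ?sb k) \<cdot> \<dots>
      = (tsumA C T ks (\<lambda>k. \<one> (x j k \<otimes>\<^bsub>S\<^esub> y j k) \<boxtimes>\<^bsub>S\<^esub> ?sb k) \<cdot>
          tsumA C T ks (\<lambda>k. Sy.exchange (x j k) (?X k) (y j k) (?Y k))) \<cdot>
      interchange2 ks (\<lambda>k. x j k \<otimes>\<^bsub>S\<^esub> ?X k) (\<lambda>k. y j k \<otimes>\<^bsub>S\<^esub> ?Y k) \<cdot>
          (interchange2 ks (x j) ?X \<boxtimes>\<^bsub>S\<^esub> interchange2 ks (y j) ?Y) \<cdot>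
      ((\<one> ?P \<boxtimes>\<^bsub>S\<^esub> ?I) \<boxtimes>\<^bsub>S\<^esub> (\<one> ?Q \<boxtimes>\<^bsub>S\<^esub> ?J))"
    by simp
  also have "\<dots> = tsumA C T ks (\<lambda>k. Sy.self.interchange2 (j # js) (\<lambda>j. x j k) (\<lambda>j. y j k))
     \<cdot> interchange2 ks (\<lambda>k. tsum S (j # js) (\<lambda>j. x j k)) (\<lambda>k. tsum S (j # js) (\<lambda>j. y j k))
     \<cdot> (interchange (j # js) ks x \<boxtimes>\<^bsub>S\<^esub> interchange (j # js) ks y)"
    using S.tensA_interchange[of "\<one> ?P \<boxtimes>\<^bsub>S\<^esub> ?I" "interchange2 ks (x j) ?X" "\<one> ?Q \<boxtimes>\<^bsub>S\<^esub> ?J"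
        "interchange2 ks (y j) ?Y"]
    by (simp add: T.tsumA_cmp)
  finally show ?case .
qed

lemma self_interchange0 [simp]: "Sy.self.interchange0 js = \<one> (unt S)"
  by (induction js) auto

theorem interchange_hexagon:
  assumes "\<And>i j k. X i j k \<in> Obj C"
  shows "interchange js ks (\<lambda>j k. tsum S is (\<lambda>i. X i j k)) \<cdot>
      tsumA C S js (\<lambda>j. interchange is ks (\<lambda>i. X i j))
     \<cdot> Sy.self.interchange is js (\<lambda>i j. tsum T ks (X i j))
   = tsumA C T ks (\<lambda>k. Sy.self.interchange is js (\<lambda>i j. X i j k))
     \<cdot> interchange is ks (\<lambda>i k. tsum S js (\<lambda>j. X i j k)) \<cdot> tsumA C S is (\<lambda>i. interchange js ks (X i))"
proof (induction "is")
  case Nil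
  then show ?case
    using interchange_row_concat[of "\<lambda>_ _. unt S" "\<lambda>_. []" js ks] by (simp add: concat_map_Nil)
next
  case (Cons i "is")
  let ?x = "X i" and ?y = "\<lambda>j k. tsum S is (\<lambda>i. X i j k)"
  let ?Sx = "\<lambda>k. tsum S js (\<lambda>j. X i j k)" and ?Sy = "\<lambda>k. tsum S js (\<lambda>j. ?y j k)"
  let ?Sy' = "\<lambda>k. tsum S is (\<lambda>i. tsum S js (\<lambda>j. X i j k))"
  let ?Tx = "\<lambda>j. tsum T ks (X i j)"
  let ?R = "\<lambda>j. interchange is ks (\<lambda>i. X i j)"
  let ?N = "Sy.self.interchange is js (\<lambda>i j. tsum T ks (X i j))"
  let ?n = "\<lambda>k. Sy.self.interchange is js (\<lambda>i j. X i j k)"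
  let ?u = "\<one> (tsum S js ?Tx)"
  note [simp] = assms
  have "tsumA C S js (\<lambda>j. \<one> (?Tx j) \<boxtimes>\<^bsub>S\<^esub> ?R j) \<cdot>
      Sy.self.interchange2 js ?Tx (\<lambda>j. tsum S is (\<lambda>i. tsum T ks (X i j)))
      = Sy.self.interchange2 js ?Tx (\<lambda>j. tsum T ks (?y j)) \<cdot> (?u \<boxtimes>\<^bsub>S\<^esub> tsumA C S js ?R)"
    using Sy.self.interchange2_natural[of "\<lambda>j. \<one> (?Tx j)" ?R js] by simp
  from S.cmp_square_cmp[OF this, of "?u \<boxtimes>\<^bsub>S\<^esub> ?N"]
  have nat: "tsumA C S js (\<lambda>j. \<one> (?Tx j) \<boxtimes>\<^bsub>S\<^esub> ?R j) \<cdot>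
      Sy.self.interchange2 js ?Tx (\<lambda>j. tsum S is (\<lambda>i. tsum T ks (X i j))) \<cdot> (?u \<boxtimes>\<^bsub>S\<^esub> ?N)
      = Sy.self.interchange2 js ?Tx (\<lambda>j. tsum T ks (?y j)) \<cdot> (?u \<boxtimes>\<^bsub>S\<^esub> (tsumA C S js ?R \<cdot> ?N))"
    by (simp add: S.tensA_interchange)
  have "interchange js ks (\<lambda>j k. tsum S (i # is) (\<lambda>i. X i j k)) \<cdot>
      tsumA C S js (\<lambda>j. interchange (i # is) ks (\<lambda>i. X i j))
     \<cdot> Sy.self.interchange (i # is) js (\<lambda>i j. tsum T ks (X i j))
    = interchange js ks (\<lambda>j k. ?x j k \<otimes>\<^bsub>S\<^esub> ?y j k) \<cdot>
        (tsumA C S js (\<lambda>j. interchange2 ks (?x j) (?y j)) \<cdot> tsumA C S js (\<lambda>j. \<one> (?Tx j) \<boxtimes>\<^bsub>S\<^esub> ?R j))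
     \<cdot> Sy.self.interchange2 js ?Tx (\<lambda>j. tsum S is (\<lambda>i. tsum T ks (X i j))) \<cdot> (?u \<boxtimes>\<^bsub>S\<^esub> ?N)"
    by (simp add: S.tsumA_cmp)
  also have "\<dots> = interchange js ks (\<lambda>j k. ?x j k \<otimes>\<^bsub>S\<^esub> ?y j k) \<cdot>
      tsumA C S js (\<lambda>j. interchange2 ks (?x j) (?y j)) \<cdot> 
     (tsumA C S js (\<lambda>j. \<one> (?Tx j) \<boxtimes>\<^bsub>S\<^esub> ?R j)
     \<cdot> Sy.self.interchange2 js ?Tx (\<lambda>j. tsum S is (\<lambda>i. tsum T ks (X i j))) \<cdot> (?u \<boxtimes>\<^bsub>S\<^esub> ?N))"
    by simp
  also have "\<dots> = (interchange js ks (\<lambda>j k. ?x j k \<otimes>\<^bsub>S\<^esub> ?y j k) \<cdot>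
      tsumA C S js (\<lambda>j. interchange2 ks (?x j) (?y j)) \<cdot>
      Sy.self.interchange2 js ?Tx (\<lambda>j. tsum T ks (?y j))) \<cdot> (?u \<boxtimes>\<^bsub>S\<^esub> (tsumA C S js ?R \<cdot> ?N))"
    unfolding nat by simp
  also have "\<dots> = (tsumA C T ks (\<lambda>k. Sy.self.interchange2 js (\<lambda>j. ?x j k) (\<lambda>j. ?y j k)) \<cdot>
      interchange2 ks ?Sx ?Sy
      \<cdot> (interchange js ks ?x \<boxtimes>\<^bsub>S\<^esub> interchange js ks ?y)) \<cdot> (?u \<boxtimes>\<^bsub>S\<^esub> (tsumA C S js ?R \<cdot> ?N))"
    by (subst interchange_interchange2) simp_all
  also have "\<dots> = tsumA C T ks (\<lambda>k. Sy.self.interchange2 js (\<lambda>j. ?x j k) (\<lambda>j. ?y j k)) \<cdot>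
      interchange2 ks ?Sx ?Sy
      \<cdot> (interchange js ks ?x \<boxtimes>\<^bsub>S\<^esub> (interchange js ks ?y \<cdot> tsumA C S js ?R \<cdot> ?N))"
    by (simp add: S.tensA_interchange)
  also have "\<dots> = tsumA C T ks (\<lambda>k. Sy.self.interchange2 js (\<lambda>j. ?x j k) (\<lambda>j. ?y j k)) \<cdot>
      interchange2 ks ?Sx ?Sy
      \<cdot> (\<one> (tsum T ks ?Sx) \<boxtimes>\<^bsub>S\<^esub> tsumA C T ks ?n) \<cdot>
          (\<one> (tsum T ks ?Sx) \<boxtimes>\<^bsub>S\<^esub> interchange is ks (\<lambda>i k. tsum S js (\<lambda>j. X i j k)))
      \<cdot> (interchange js ks ?x \<boxtimes>\<^bsub>S\<^esub> tsumA C S is (\<lambda>i. interchange js ks (X i)))"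
    unfolding Cons by (simp add: S.tensA_interchange)
  also have "interchange2 ks ?Sx ?Sy
      \<cdot> (\<one> (tsum T ks ?Sx) \<boxtimes>\<^bsub>S\<^esub> tsumA C T ks ?n) \<cdot>
          (\<one> (tsum T ks ?Sx) \<boxtimes>\<^bsub>S\<^esub> interchange is ks (\<lambda>i k. tsum S js (\<lambda>j. X i j k)))
      \<cdot> (interchange js ks ?x \<boxtimes>\<^bsub>S\<^esub> tsumA C S is (\<lambda>i. interchange js ks (X i)))
    = tsumA C T ks (\<lambda>k. \<one> (?Sx k) \<boxtimes>\<^bsub>S\<^esub> ?n k) \<cdot> interchange2 ks ?Sx ?Sy' \<cdot>
        (\<one> (tsum T ks ?Sx) \<boxtimes>\<^bsub>S\<^esub> interchange is ks (\<lambda>i k. tsum S js (\<lambda>j. X i j k)))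
      \<cdot> (interchange js ks ?x \<boxtimes>\<^bsub>S\<^esub> tsumA C S is (\<lambda>i. interchange js ks (X i)))"
    using interchange2_natural[of "\<lambda>k. \<one> (?Sx k)" ?n ks] by (intro S.cmp_square_cmp) simp_all
  also have "tsumA C T ks (\<lambda>k. Sy.self.interchange2 js (\<lambda>j. ?x j k) (\<lambda>j. ?y j k)) \<cdot> \<dots>
    = (tsumA C T ks (\<lambda>k. Sy.self.interchange2 js (\<lambda>j. ?x j k) (\<lambda>j. ?y j k)) \<cdot>
        tsumA C T ks (\<lambda>k. \<one> (?Sx k) \<boxtimes>\<^bsub>S\<^esub> ?n k)) \<cdot>
      (interchange2 ks ?Sx ?Sy' \<cdot> (\<one> (tsum T ks ?Sx) \<boxtimes>\<^bsub>S\<^esub> interchange is ks (\<lambda>i k. tsum S js (\<lambda>j. X i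
          j k))))
      \<cdot> (interchange js ks ?x \<boxtimes>\<^bsub>S\<^esub> tsumA C S is (\<lambda>i. interchange js ks (X i)))"
    by simp
  also have "\<dots> = tsumA C T ks (\<lambda>k. Sy.self.interchange (i # is) js (\<lambda>i j. X i j k))
     \<cdot> interchange (i # is) ks (\<lambda>i k. tsum S js (\<lambda>j. X i j k)) \<cdot>
         tsumA C S (i # is) (\<lambda>i. interchange js ks (X i))"
    by (simp add: T.tsumA_cmp)
  finally show ?case .
qed

end

text \<open>Taking \<open>S = T\<close> yields the hexagon for three equal tensors.\<close>
lemma (in strict_symmetric) symmetric_duoidal_self:
  "symmetric_duoidal C S S exchange (\<one> (unt S)) (\<one> (unt S)) (\<one> (unt S)) symm"
  by unfold_locales (simp_all add: exchange_symm)

text \<open>The dual situation, where the hexagon involves \<open>S\<close> once and \<open>T\<close> twice.  In the opposite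
  category the symmetry of \<open>T\<close> runs the other way, whence the flipped arguments.\<close>
locale cosymmetric_duoidal = duoidal C S T iota beta tau kappa + Sy: strict_symmetric C T symm
  for C :: "('o, 'a) cat" (structure)
    and S :: "('o, 'a, 'y) tensor_scheme" and T :: "('o, 'a, 'z) tensor_scheme"
    and iota :: "'o \<Rightarrow> 'o \<Rightarrow> 'o \<Rightarrow> 'o \<Rightarrow> 'a" and beta tau kappa :: 'a and symm :: "'o \<Rightarrow> 'o \<Rightarrow> 'a" +
  assumes symm_iota: "\<lbrakk>A \<in> Obj C; B \<in> Obj C; X \<in> Obj C; D \<in> Obj C\<rbrakk> \<Longrightarrow>
      symm (tens S A X) (tens S B D) \<cdot> iota A B X D = iota B A D X \<cdot> tensA S (symm A B) (symm X D)"
    and symm_beta: "symm (unt S) (unt S) \<cdot> beta = beta"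
begin

interpretation opp: symmetric_duoidal "op_cat C" T S "\<lambda>A B D E. iota A D B E" tau beta kappa
    "\<lambda>A B. symm B A"
proof -
  interpret d: duoidal "op_cat C" T S "\<lambda>A B D E. iota A D B E" tau beta kappa
    by (rule duoidal_op)
  interpret s: strict_symmetric "op_cat C" T "\<lambda>A B. symm B A"
    by (rule Sy.strict_symmetric_op)
  show "symmetric_duoidal (op_cat C) T S (\<lambda>A B D E. iota A D B E) tau beta kappa (\<lambda>A B. symm B A)"
    by unfold_locales (simp_all add: symm_iota symm_beta)
qed

lemma opp_exchange: "opp.Sy.exchange = (\<lambda>A B D E. Sy.exchange A D B E)"
  by (intro ext) (simp add: opp.Sy.exchange_def Sy.exchange_def)

lemma opp_self_interchange:
  "(\<And>j k. X j k \<in> Obj C) \<Longrightarrow> opp.Sy.self.interchange ks js (\<lambda>k j. X j k) = Sy.self.interchange js ks X"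
  using Sy.self.interchange_dual[of X ks js] by (simp add: opp_exchange)

theorem interchange_hexagon:
  assumes "\<And>i j k. X i j k \<in> Obj C"
  shows "Sy.self.interchange js ks (\<lambda>j k. tsum S is (\<lambda>i. X i j k)) \<cdot>
      tsumA C T js (\<lambda>j. interchange is ks (\<lambda>i. X i j))
     \<cdot> interchange is js (\<lambda>i j. tsum T ks (X i j))
   = tsumA C T ks (\<lambda>k. interchange is js (\<lambda>i j. X i j k))
     \<cdot> interchange is ks (\<lambda>i k. tsum T js (\<lambda>j. X i j k)) \<cdot>
         tsumA C S is (\<lambda>i. Sy.self.interchange js ks (X i))"
  using opp.interchange_hexagon[of "\<lambda>k j i. X i j k" js "is" ks] assms
    interchange_dual[of "\<lambda>i j. tsum T ks (X i j)" js "is"] 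
    interchange_dual[of "\<lambda>i k. X i j k" ks "is" for j]
    interchange_dual[of "\<lambda>i j. X i j k" js "is" for k]
    interchange_dual[of "\<lambda>i k. tsum T js (\<lambda>j. X i j k)" ks "is"]
    opp_self_interchange[of "\<lambda>j k. tsum S is (\<lambda>i. X i j k)" ks js]
    opp_self_interchange[of "X i" ks js for i]
  by simp

end

section \<open>Strict SMI categories\<close>

lemma (in symmetric_monoidal) strict_symmetricI:
  assumes "strict_structure C T"
  shows "strict_symmetric C T (symm T)"
proof -
  interpret strict_tensor C T by (rule strict_tensorI[OF assms])
  have st: "assoc T A B D = Idt C (tens T A (tens T B D))" "runit T A = Idt C A" "lunit T A = Idt C A"
    if "A \<in> Obj C" "B \<in> Obj C" "D \<in> Obj C" for A B D
    using assms that by (auto simp: strict_structure_def)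
  have si: "symm T A B \<in> Arr C" "Dom C (symm T A B) = tens T A B" "Cod C (symm T A B) = tens T B A"
    if "A \<in> Obj C" "B \<in> Obj C" for A B
    using symm_iso[OF that] by (auto simp: iso_def hom_iff)
  show ?thesis
  proof
    fix f g assume "f \<in> Arr C" "g \<in> Arr C"
    then show "symm T (Cod C f) (Cod C g) \<cdot> tensA T f g = tensA T g f \<cdot> symm T (Dom C f) (Dom C g)"
      by (intro symm_natural) (auto simp: hom_iff)
  next
    fix A B D assume "A \<in> Obj C" "B \<in> Obj C" "D \<in> Obj C"
    then show "symm T (tens T A B) D = tensA T (symm T A D) (Idt C B) \<cdot> tensA T (Idt C A) (symm T B D)"
      using hexagon[of A B D] by (simp add: st si)
  next
    fix A assume "A \<in> Obj C"
    then show "symm T A (unt T) = Idt C A"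
      using lunit_symm[of A] by (simp add: st si)
  qed (simp_all add: symm_symm hom_iff si)
qed

text \<open>An SMI category has unit axioms on the right only.  The ones on the left are obtained by
  conjugating with the symmetries, which are identities at the units by strictness.\<close>
lemma SMI_duoidal:
  fixes C :: "('o, 'a) cat" (structure)
  assumes "SMI_category C V M iota beta tau kappa" "strict_structure C V" "strict_structure C M"
  shows "symmetric_duoidal C V M iota beta tau kappa (symm V)"
    "cosymmetric_duoidal C V M iota beta tau kappa (symm M)"
proof -
  interpret SMI_category C V M iota beta tau kappa by fact
  interpret SV: strict_symmetric C V "symm V" by (rule V.strict_symmetricI) fact
  interpret SM: strict_symmetric C M "symm M" by (rule M.strict_symmetricI) fact
  have st: "assoc V A B D = \<one> (tens V A (tens V B D))" "runit V A = \<one> A" 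
     "assoc M A B D = \<one> (tens M A (tens M B D))" "runit M A = \<one> A" 
    if "A \<in> Obj C" "B \<in> Obj C" "D \<in> Obj C" for A B D
    using assms that by (auto simp: strict_structure_def)
  have st': "runit V A = \<one> A" "runit M A = \<one> A" if "A \<in> Obj C" for A using st that by auto
  have [simp]: "beta \<in> Arr C" "Dom C beta = unt V" "Cod C beta = tens M (unt V) (unt V)"
     "tau \<in> Arr C" "Dom C tau = tens V (unt M) (unt M)" "Cod C tau = unt M"
     "kappa \<in> Arr C" "Dom C kappa = unt V" "Cod C kappa = unt M"
    using beta_iso tau_iso kappa_hom by (auto simp: iso_def hom_iff)
  have [simp]: "iota A B D E \<in> Arr C" "Dom C (iota A B D E) = tens V (tens M A B) (tens M D E)"
    "Cod C (iota A B D E) = tens M (tens V A D) (tens V B E)"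
    if "A \<in> Obj C" "B \<in> Obj C" "D \<in> Obj C" "E \<in> Obj C" for A B D E
    using iota_hom[OF that] by (auto simp: hom_iff)
  have uS: "iota A B (unt V) (unt V) \<cdot> tensA V (\<one> (tens M A B)) beta = \<one> (tens M A B)"
    if "A \<in> Obj C" "B \<in> Obj C" for A B
    using smi3[OF that] that by (simp add: st')
  have uT: "tensA M (\<one> (tens V A B)) tau \<cdot> iota A (unt M) B (unt M) = \<one> (tens V A B)"
    if "A \<in> Obj C" "B \<in> Obj C" for A B
    using smi11[OF that] that by (simp add: st')
  interpret duoidal C V M iota beta tau kappa
  proof
    fix a b d e assume "a \<in> Arr C" "b \<in> Arr C" "d \<in> Arr C" "e \<in> Arr C"
    then show "iota (Cod C a) (Cod C b) (Cod C d) (Cod C e) \<cdot> tensA V (tensA M a b) (tensA M d e)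
      = tensA M (tensA V a d) (tensA V b e) \<cdot> iota (Dom C a) (Dom C b) (Dom C d) (Dom C e)"
      by (intro iota_natural) (auto simp: hom_iff)
  next
    fix A B X D E F assume "A \<in> Obj C" "B \<in> Obj C" "X \<in> Obj C" "D \<in> Obj C" "E \<in> Obj C" "F \<in> Obj C"
    then show "iota (tens V A B) (tens V D E) X F \<cdot> tensA V (iota A D B E) (\<one> (tens M X F))
      = iota A D (tens V B X) (tens V E F) \<cdot> tensA V (\<one> (tens M A D)) (iota B E X F)"
      and "tensA M (\<one> (tens V A D)) (iota B X E F) \<cdot> iota A (tens M B X) D (tens M E F)
      = tensA M (iota A B D E) (\<one> (tens V X F)) \<cdot> iota (tens M A B) X (tens M D E) F"
      using smi1[of A B X D E F] smi7[of A B X D E F] by (simp_all add: st)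
  next
    fix A B assume AB: "A \<in> Obj C" "B \<in> Obj C"
    note [simp] = AB
    have "iota (unt V) (unt V) A B \<cdot> tensA V beta (\<one> (tens M A B))
       = iota (unt V) (unt V) A B \<cdot> (tensA V beta (\<one> (tens M A B)) \<cdot> symm V (tens M A B) (unt V))"
      by simp
    also have "\<dots> = iota (unt V) (unt V) A B \<cdot> symm V (tens M A B) (tens M (unt V) (unt V)) \<cdot>
        tensA V (\<one> (tens M A B)) beta"
      using SV.symm_natural[of "\<one> (tens M A B)" beta] by simp
    also have "\<dots> = (iota (unt V) (unt V) A B \<cdot> symm V (tens M A B) (tens M (unt V) (unt V))) \<cdot>
        tensA V (\<one> (tens M A B)) beta"
      by (subst V.cmp_assoc_right) simp_all
    also have "\<dots> = \<one> (tens M A B)"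
      using smi2[of A "unt V" B "unt V"] uS[OF AB] by simp
    finally show "iota (unt V) (unt V) A B \<cdot> tensA V beta (\<one> (tens M A B)) = \<one> (tens M A B)" .
    have "tensA M tau (\<one> (tens V A B)) \<cdot> iota (unt M) A (unt M) B
       = (symm M (unt M) (tens V A B) \<cdot> tensA M tau (\<one> (tens V A B))) \<cdot> iota (unt M) A (unt M) B"
      by simp
    also have "\<dots> = (tensA M (\<one> (tens V A B)) tau \<cdot> symm M (tens V (unt M) (unt M)) (tens V A B)) \<cdot>
        iota (unt M) A (unt M) B"
      using SM.symm_natural[of tau "\<one> (tens V A B)"] by simp
    also have "\<dots> = tensA M (\<one> (tens V A B)) tau \<cdot> symm M (tens V (unt M) (unt M)) (tens V A B) \<cdot>
        iota (unt M) A (unt M) B"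
      by (subst V.cmp_assoc_right) simp_all
    also have "\<dots> = \<one> (tens V A B)"
      using smi9[of "unt M" A "unt M" B] uT[OF AB] by simp
    finally show "tensA M tau (\<one> (tens V A B)) \<cdot> iota (unt M) A (unt M) B = \<one> (tens V A B)" .
  next
    have "tau \<cdot> tensA V kappa (\<one> (unt M)) = tau \<cdot> (tensA V kappa (\<one> (unt M)) \<cdot> symm V (unt M) (unt V))"
      by simp
    also have "\<dots> = tau \<cdot> (symm V (unt M) (unt M) \<cdot> tensA V (\<one> (unt M)) kappa)"
      using SV.symm_natural[of "\<one> (unt M)" kappa] by simp
    also have "\<dots> = (tau \<cdot> symm V (unt M) (unt M)) \<cdot> tensA V (\<one> (unt M)) kappa"
      by (subst V.cmp_assoc_right) simp_all
    also have "\<dots> = \<one> (unt M)" using smi6 by (simp add: smi5 st')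
    finally show "tau \<cdot> tensA V kappa (\<one> (unt M)) = \<one> (unt M)" .
    have "tensA M kappa (\<one> (unt V)) \<cdot> beta = tensA M kappa (\<one> (unt V)) \<cdot> symm M (unt V) (unt V) \<cdot> beta"
      by (simp add: smi10)
    also have "\<dots> = (tensA M kappa (\<one> (unt V)) \<cdot> symm M (unt V) (unt V)) \<cdot> beta"
      by (subst V.cmp_assoc_right) simp_all
    also have "\<dots> = (symm M (unt V) (unt M) \<cdot> tensA M (\<one> (unt V)) kappa) \<cdot> beta"
      using SM.symm_natural[of "\<one> (unt V)" kappa] by simp
    also have "\<dots> = \<one> (unt V)" using smi12 by (simp add: st')
    finally show "tensA M kappa (\<one> (unt V)) \<cdot> beta = \<one> (unt V)" .
  qed (use uS uT smi4 smi6 smi8 smi12 in \<open>simp_all add: hom_iff st st'\<close>)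
  show "symmetric_duoidal C V M iota beta tau kappa (symm V)"
    by unfold_locales (simp_all add: smi2 smi5)
  show "cosymmetric_duoidal C V M iota beta tau kappa (symm M)"
    by unfold_locales (simp_all add: smi9 smi10)
qed

section \<open>Slices of a monotone map and multi-indices\<close>

text \<open>The indices that are tensored into entry \<open>b\<close> of the bar construction.\<close>
definition slice :: "(nat \<Rightarrow> nat) \<Rightarrow> nat \<Rightarrow> nat list" where
  "slice f b = [f b..<f (Suc b)]"

lemma concat_slice_upt:
  assumes "mono f" "a \<le> b"
  shows "concat (map (slice f) [a..<b]) = [f a..<f b]"
  using assms(2)
proof (induction b rule: dec_induct)
  case (step b)
  then have "f a \<le> f b" "f b \<le> f (Suc b)" using assms(1) by (auto simp: mono_def)
  then show ?case using step upt_add_eq_append[of "f a" "f b" "f (Suc b) - f b"]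
    by (simp add: slice_def)
qed simp

text \<open>Functoriality of slicing; by this equation the tensors of \<open>g\<^sup>* \<circ> f\<^sup>*\<close> over a single coordinate
  merge strictly.\<close>
lemma concat_slice:
  assumes "mono f" "mono g"
  shows "concat (map (slice f) (slice g c)) = slice (\<lambda>b. f (g b)) c"
  using concat_slice_upt[OF assms(1), of "g c" "g (Suc c)"] assms(2)
  by (simp add: slice_def monoD)

lemma slice_id [simp]: "slice (\<lambda>b. b) c = [c]"
  by (simp add: slice_def)

definition scons :: "nat \<Rightarrow> (nat \<Rightarrow> nat) \<Rightarrow> nat \<Rightarrow> nat"  (infixr "##" 65) where
  "a ## e = case_nat a e"

lemma scons_simps [simp]: "(a ## e) 0 = a" "(a ## e) (Suc i) = e i"
  by (simp_all add: scons_def)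

lemma scons_eta [simp]: "e 0 ## (\<lambda>i. e (Suc i)) = e"
  by (rule ext) (simp add: scons_def split: nat.split)

section \<open>The lax structure on families\<close>

text \<open>The facts about interchange that the construction of the lax functor relies on.  The tensors
  are indexed by an order, and \<open>swap s t\<close> is only required for \<open>s \<le> t\<close>: in the application there are
  two tensors, with \<open>\<or>\<close> below \<open>\<and>\<close>, and no interchange from \<open>\<and>\<close> over \<open>\<or>\<close>.\<close>
locale interchange_family = category C
  for C :: "('o, 'a) cat" (structure) +
  fixes tn :: "'t::order \<Rightarrow> ('o, 'a, 'z) tensor_scheme"
    and swap :: "'t \<Rightarrow> 't \<Rightarrow> nat list \<Rightarrow> nat list \<Rightarrow> (nat \<Rightarrow> nat \<Rightarrow> 'o) \<Rightarrow> 'a"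
  assumes strict: "strict_tensor C (tn s)"
    and swap_arr: "\<lbrakk>s \<le> t; \<And>i j. X i j \<in> Obj C\<rbrakk> \<Longrightarrow> swap s t is js X \<in>
      hom C (tsum (tn s) is (\<lambda>i. tsum (tn t) js (X i))) (tsum (tn t) js (\<lambda>j. tsum (tn s) is (\<lambda>i. X i j)))"
    and swap_natural: "\<lbrakk>s \<le> t; \<And>i j. h i j \<in> Arr C\<rbrakk> \<Longrightarrow>
      swap s t is js (\<lambda>i j. Cod C (h i j)) \<cdot> tsumA C (tn s) is (\<lambda>i. tsumA C (tn t) js (h i))
      = tsumA C (tn t) js (\<lambda>j. tsumA C (tn s) is (\<lambda>i. h i j)) \<cdot> swap s t is js (\<lambda>i j. Dom C (h i j))"
    and swap_row_single: "\<lbrakk>s \<le> t; \<And>i j. X i j \<in> Obj C\<rbrakk> \<Longrightarrow>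
      swap s t [i] js X = \<one> (tsum (tn t) js (X i))"
    and swap_col_single: "\<lbrakk>s \<le> t; \<And>i j. X i j \<in> Obj C\<rbrakk> \<Longrightarrow>
      swap s t is [j] X = \<one> (tsum (tn s) is (\<lambda>i. X i j))"
    and swap_row_concat: "\<lbrakk>s \<le> t; \<And>i j. X i j \<in> Obj C\<rbrakk> \<Longrightarrow>
      swap s t (concat (map f ks)) js X
      = swap s t ks js (\<lambda>k j. tsum (tn s) (f k) (\<lambda>i. X i j)) \<cdot> tsumA C (tn s) ks (\<lambda>k. swap s t (f k) js X)"
    and swap_col_concat: "\<lbrakk>s \<le> t; \<And>i j. X i j \<in> Obj C\<rbrakk> \<Longrightarrow>
      swap s t is (concat (map f ks)) X
      = tsumA C (tn t) ks (\<lambda>k. swap s t is (f k) X) \<cdot> swap s t is ks (\<lambda>i k. tsum (tn t) (f k) (X i))"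
    and swap_cong: "(\<And>i j. i \<in> set is \<Longrightarrow> j \<in> set js \<Longrightarrow> X i j = Y i j) \<Longrightarrow>
      swap s t is js X = swap s t is js Y"
    and swap_hexagon: "\<lbrakk>r \<le> s; s \<le> t; \<And>i j k. Z i j k \<in> Obj C\<rbrakk> \<Longrightarrow>
      swap s t js ks (\<lambda>j k. tsum (tn r) is (\<lambda>i. Z i j k)) \<cdot>
          tsumA C (tn s) js (\<lambda>j. swap r t is ks (\<lambda>i. Z i j))
        \<cdot> swap r s is js (\<lambda>i j. tsum (tn t) ks (Z i j))
      = tsumA C (tn t) ks (\<lambda>k. swap r s is js (\<lambda>i j. Z i j k))
        \<cdot> swap r t is ks (\<lambda>i k. tsum (tn s) js (\<lambda>j. Z i j k)) \<cdot>
            tsumA C (tn r) is (\<lambda>i. swap s t js ks (Z i))"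
begin

sublocale T: strict_tensor C "tn s" for s by (rule strict)

lemma swap_simps [simp]:
  assumes "s \<le> t" "\<And>i j. X i j \<in> Obj C"
  shows "swap s t is js X \<in> Arr C"
    "Dom C (swap s t is js X) = tsum (tn s) is (\<lambda>i. tsum (tn t) js (X i))"
    "Cod C (swap s t is js X) = tsum (tn t) js (\<lambda>j. tsum (tn s) is (\<lambda>i. X i j))"
  using swap_arr[OF assms] by (auto simp: hom_iff)

abbreviation slab :: "'t \<Rightarrow> nat list \<Rightarrow> ((nat \<Rightarrow> nat) \<Rightarrow> 'o) \<Rightarrow> (nat \<Rightarrow> nat) \<Rightarrow> 'o" where
  "slab t K X \<equiv> (\<lambda>e. tsum (tn t) K (\<lambda>a. X (a ## e)))"

abbreviation slabA :: "'t \<Rightarrow> nat list \<Rightarrow> ((nat \<Rightarrow> nat) \<Rightarrow> 'a) \<Rightarrow> (nat \<Rightarrow> nat) \<Rightarrow> 'a" where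
  "slabA t K h \<equiv> (\<lambda>e. tsumA C (tn t) K (\<lambda>a. h (a ## e)))"

text \<open>The bar construction on families of objects and of arrows.  A multi-index is a function
  \<open>nat \<Rightarrow> nat\<close> whose values at the first \<open>length ts\<close> arguments matter; \<open>\<phi> i\<close> is the monotone map for
  coordinate \<open>i\<close>.\<close>
primrec barO :: "'t list \<Rightarrow> (nat \<Rightarrow> nat \<Rightarrow> nat) \<Rightarrow> ((nat \<Rightarrow> nat) \<Rightarrow> 'o) \<Rightarrow> (nat \<Rightarrow> nat) \<Rightarrow> 'o" where
  "barO [] \<phi> X e = X e"
| "barO (t # ts) \<phi> X e = barO ts (\<lambda>i. \<phi> (Suc i)) (slab t (slice (\<phi> 0) (e 0)) X) (\<lambda>i. e (Suc i))"

primrec barA :: "'t list \<Rightarrow> (nat \<Rightarrow> nat \<Rightarrow> nat) \<Rightarrow> ((nat \<Rightarrow> nat) \<Rightarrow> 'a) \<Rightarrow> (nat \<Rightarrow> nat) \<Rightarrow> 'a" where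
  "barA [] \<phi> h e = h e"
| "barA (t # ts) \<phi> h e = barA ts (\<lambda>i. \<phi> (Suc i)) (slabA t (slice (\<phi> 0) (e 0)) h) (\<lambda>i. e (Suc i))"

text \<open>The lax monoidal structure of \<open>barO ts \<phi>\<close> for a tensor \<open>s\<close> below all of \<open>ts\<close>, for any number of
  arguments: the \<open>s\<close>-tensor is moved inside the remaining coordinates first and then
  inside the first one, which is the innermost.\<close>
primrec lax_mult :: "'t \<Rightarrow> 't list \<Rightarrow> (nat \<Rightarrow> nat \<Rightarrow> nat) \<Rightarrow> nat list \<Rightarrow> (nat \<Rightarrow> (nat \<Rightarrow> nat) \<Rightarrow> 'o) \<Rightarrow> (nat \<Rightarrow>
    nat) \<Rightarrow> 'a" where
  "lax_mult s [] \<phi> is X e = \<one> (tsum (tn s) is (\<lambda>i. X i e))"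
| "lax_mult s (t # ts) \<phi> is X e =
     barA ts (\<lambda>i. \<phi> (Suc i)) (\<lambda>e'. swap s t is (slice (\<phi> 0) (e 0)) (\<lambda>i a. X i (a ## e'))) (\<lambda>i. e (Suc i))
     \<cdot> lax_mult s ts (\<lambda>i. \<phi> (Suc i)) is (\<lambda>i. slab t (slice (\<phi> 0) (e 0)) (X i)) (\<lambda>i. e (Suc i))"

text \<open>The constraint from \<open>barO ts \<psi> \<circ> barO ts \<phi>\<close> to \<open>barO\<close> of the composite maps.  In the source, the
  tensors over the first coordinate that come from \<open>\<psi>\<close> are separated from those that come from \<open>\<phi>\<close>
  by the remaining coordinates of \<open>\<phi>\<close>; \<open>lax_mult\<close> moves them together.\<close>
primrec laxator :: "'t list \<Rightarrow> (nat \<Rightarrow> nat \<Rightarrow> nat) \<Rightarrow> (nat \<Rightarrow> nat \<Rightarrow> nat) \<Rightarrow> ((nat \<Rightarrow> nat) \<Rightarrow> 'o) \<Rightarrow> (nat \<Rightarrow> nat)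
    \<Rightarrow> 'a" where
  "laxator [] \<psi> \<phi> X e = \<one> (X e)"
| "laxator (t # ts) \<psi> \<phi> X e =
     laxator ts (\<lambda>i. \<psi> (Suc i)) (\<lambda>i. \<phi> (Suc i)) (slab t (slice (\<lambda>b. \<phi> 0 (\<psi> 0 b)) (e 0)) X) (\<lambda>i. e (Suc i))
     \<cdot> barA ts (\<lambda>i. \<psi> (Suc i))
         (lax_mult t ts (\<lambda>i. \<phi> (Suc i)) (slice (\<psi> 0) (e 0)) (\<lambda>b. slab t (slice (\<phi> 0) b) X)) (\<lambda>i. e (Suc i))"

lemma barO_obj [simp]: "(\<And>e. X e \<in> Obj C) \<Longrightarrow> barO ts \<phi> X e \<in> Obj C"
  by (induction ts arbitrary: \<phi> X e) auto

lemma barA_simps [simp]: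
  assumes "\<And>e. h e \<in> Arr C"
  shows "barA ts \<phi> h e \<in> Arr C" "Dom C (barA ts \<phi> h e) = barO ts \<phi> (\<lambda>e. Dom C (h e)) e"
    "Cod C (barA ts \<phi> h e) = barO ts \<phi> (\<lambda>e. Cod C (h e)) e"
  using assms by (induction ts arbitrary: \<phi> h e) auto

lemma barA_idt [simp]: "(\<And>e. X e \<in> Obj C) \<Longrightarrow> barA ts \<phi> (\<lambda>e. \<one> (X e)) e = \<one> (barO ts \<phi> X e)"
  by (induction ts arbitrary: \<phi> X e) auto

lemma barA_cmp:
  "\<lbrakk>\<And>e. f e \<in> Arr C; \<And>e. g e \<in> Arr C; \<And>e. Cod C (f e) = Dom C (g e)\<rbrakk> \<Longrightarrow>
    barA ts \<phi> g e \<cdot> barA ts \<phi> f e = barA ts \<phi> (\<lambda>e. g e \<cdot> f e) e"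
  by (induction ts arbitrary: \<phi> f g e) (simp_all add: T.tsumA_cmp)

lemma barO_ident [simp]: "(\<And>e. X e \<in> Obj C) \<Longrightarrow> barO ts (\<lambda>i b. b) X = X"
  by (induction ts arbitrary: X) (auto intro!: ext)

lemma barA_ident [simp]: "(\<And>e. h e \<in> Arr C) \<Longrightarrow> barA ts (\<lambda>i b. b) h = h"
  by (induction ts arbitrary: h) (auto intro!: ext)

lemma lax_mult_simps [simp]:
  assumes "\<forall>t\<in>set ts. s \<le> t" "\<And>i e. X i e \<in> Obj C"
  shows "lax_mult s ts \<phi> is X e \<in> Arr C"
    "Dom C (lax_mult s ts \<phi> is X e) = tsum (tn s) is (\<lambda>i. barO ts \<phi> (X i) e)"
    "Cod C (lax_mult s ts \<phi> is X e) = barO ts \<phi> (\<lambda>e. tsum (tn s) is (\<lambda>i. X i e)) e"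
  using assms by (induction ts arbitrary: \<phi> X e) auto

lemma lax_mult_natural:
  assumes "\<forall>t\<in>set ts. s \<le> t" "\<And>i e. h i e \<in> Arr C"
  shows "lax_mult s ts \<phi> is (\<lambda>i e. Cod C (h i e)) e \<cdot> tsumA C (tn s) is (\<lambda>i. barA ts \<phi> (h i) e)
    = barA ts \<phi> (\<lambda>e. tsumA C (tn s) is (\<lambda>i. h i e)) e \<cdot> lax_mult s ts \<phi> is (\<lambda>i e. Dom C (h i e)) e"
  using assms
proof (induction ts arbitrary: \<phi> h e)
  case (Cons t ts)
  let ?K = "slice (\<phi> 0) (e 0)" and ?e = "\<lambda>i. e (Suc i)" and ?\<phi> = "\<lambda>i. \<phi> (Suc i)"
  note [simp] = Cons.prems
  have st [simp]: "s \<le> t" by simp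
  have IH: "lax_mult s ts ?\<phi> is (\<lambda>i. slab t ?K (\<lambda>e. Cod C (h i e))) ?e \<cdot>
      tsumA C (tn s) is (\<lambda>i. barA ts ?\<phi> (slabA t ?K (h i)) ?e)
    = barA ts ?\<phi> (\<lambda>e. tsumA C (tn s) is (\<lambda>i. slabA t ?K (h i) e)) ?e \<cdot>
        lax_mult s ts ?\<phi> is (\<lambda>i. slab t ?K (\<lambda>e. Dom C (h i e))) ?e"
    using Cons.IH[of "\<lambda>i. slabA t ?K (h i)" ?\<phi> ?e] by simp
  have "lax_mult s (t # ts) \<phi> is (\<lambda>i e. Cod C (h i e)) e \<cdot> tsumA C (tn s) is (\<lambda>i. barA (t # ts) \<phi> (h i) e)
    = barA ts ?\<phi> (\<lambda>e'. swap s t is ?K (\<lambda>i a. Cod C (h i (a ## e')))) ?e \<cdot>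
      barA ts ?\<phi> (\<lambda>e. tsumA C (tn s) is (\<lambda>i. slabA t ?K (h i) e)) ?e \<cdot>
          lax_mult s ts ?\<phi> is (\<lambda>i. slab t ?K (\<lambda>e. Dom C (h i e))) ?e"
    by (simp add: IH)
  also have "\<dots> = (barA ts ?\<phi> (\<lambda>e'. swap s t is ?K (\<lambda>i a. Cod C (h i (a ## e')))) ?e \<cdot>
      barA ts ?\<phi> (\<lambda>e. tsumA C (tn s) is (\<lambda>i. slabA t ?K (h i) e)) ?e) \<cdot>
          lax_mult s ts ?\<phi> is (\<lambda>i. slab t ?K (\<lambda>e. Dom C (h i e))) ?e"
    by simp
  also have "barA ts ?\<phi> (\<lambda>e'. swap s t is ?K (\<lambda>i a. Cod C (h i (a ## e')))) ?e \<cdot>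
      barA ts ?\<phi> (\<lambda>e. tsumA C (tn s) is (\<lambda>i. slabA t ?K (h i) e)) ?e
     = barA ts ?\<phi> (slabA t ?K (\<lambda>e. tsumA C (tn s) is (\<lambda>i. h i e))) ?e \<cdot>
      barA ts ?\<phi> (\<lambda>e'. swap s t is ?K (\<lambda>i a. Dom C (h i (a ## e')))) ?e"
    by (simp add: barA_cmp swap_natural)
  finally show ?case by simp
qed simp

lemma lax_mult_single:
  assumes "\<forall>t\<in>set ts. s \<le> t" "\<And>i e. X i e \<in> Obj C"
  shows "lax_mult s ts \<phi> [i] X = (\<lambda>e. \<one> (barO ts \<phi> (X i) e))"
  using assms by (induction ts arbitrary: \<phi> X) (auto intro!: ext simp: swap_row_single)

lemma lax_mult_ident:
  assumes "\<forall>t\<in>set ts. s \<le> t" "\<And>i e. X i e \<in> Obj C"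
  shows "lax_mult s ts (\<lambda>i b. b) is X = (\<lambda>e. \<one> (tsum (tn s) is (\<lambda>i. X i e)))"
  using assms by (induction ts arbitrary: X) (auto intro!: ext simp: swap_col_single)

lemma lax_mult_concat:
  assumes "\<forall>t\<in>set ts. s \<le> t" "\<And>i e. X i e \<in> Obj C"
  shows "lax_mult s ts \<phi> (concat (map f ks)) X e
    = lax_mult s ts \<phi> ks (\<lambda>k e. tsum (tn s) (f k) (\<lambda>i. X i e)) e \<cdot>
        tsumA C (tn s) ks (\<lambda>k. lax_mult s ts \<phi> (f k) X e)"
  using assms
proof (induction ts arbitrary: \<phi> X e)
  case (Cons t ts)
  let ?K = "slice (\<phi> 0) (e 0)" and ?e = "\<lambda>i. e (Suc i)" and ?\<phi> = "\<lambda>i. \<phi> (Suc i)"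
  let ?X = "\<lambda>i. slab t ?K (X i)"
  note [simp] = Cons.prems
  have st [simp]: "s \<le> t" by simp
  have IH: "lax_mult s ts ?\<phi> (concat (map f ks)) ?X ?e
    = lax_mult s ts ?\<phi> ks (\<lambda>k e. tsum (tn s) (f k) (\<lambda>i. ?X i e)) ?e \<cdot>
        tsumA C (tn s) ks (\<lambda>k. lax_mult s ts ?\<phi> (f k) ?X ?e)"
    using Cons.IH[of ?X ?\<phi> ?e] by simp
  have nat: "lax_mult s ts ?\<phi> ks (\<lambda>k. slab t ?K (\<lambda>e. tsum (tn s) (f k) (\<lambda>i. X i e))) ?e
       \<cdot> tsumA C (tn s) ks (\<lambda>k. barA ts ?\<phi> (\<lambda>e'. swap s t (f k) ?K (\<lambda>i a. X i (a ## e'))) ?e)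
    = barA ts ?\<phi> (\<lambda>e'. tsumA C (tn s) ks (\<lambda>k. swap s t (f k) ?K (\<lambda>i a. X i (a ## e')))) ?e
       \<cdot> lax_mult s ts ?\<phi> ks (\<lambda>k e. tsum (tn s) (f k) (\<lambda>i. ?X i e)) ?e"
    using lax_mult_natural[of ts s "\<lambda>k e'. swap s t (f k) ?K (\<lambda>i a. X i (a ## e'))" ?\<phi> ks ?e] by simp
  let ?A = "barA ts ?\<phi> (\<lambda>e'. swap s t ks ?K (\<lambda>k a. tsum (tn s) (f k) (\<lambda>i. X i (a ## e')))) ?e"
  let ?B = "barA ts ?\<phi> (\<lambda>e'. tsumA C (tn s) ks (\<lambda>k. swap s t (f k) ?K (\<lambda>i a. X i (a ## e')))) ?e"
  have "lax_mult s (t # ts) \<phi> (concat (map f ks)) X e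
    = (?A \<cdot> ?B) \<cdot> (lax_mult s ts ?\<phi> ks (\<lambda>k e. tsum (tn s) (f k) (\<lambda>i. ?X i e)) ?e \<cdot>
        tsumA C (tn s) ks (\<lambda>k. lax_mult s ts ?\<phi> (f k) ?X ?e))"
    by (simp add: IH swap_row_concat barA_cmp)
  also have "\<dots> = ?A \<cdot> (?B \<cdot> lax_mult s ts ?\<phi> ks (\<lambda>k e. tsum (tn s) (f k) (\<lambda>i. ?X i e)) ?e) \<cdot>
      tsumA C (tn s) ks (\<lambda>k. lax_mult s ts ?\<phi> (f k) ?X ?e)"
    by (simp add: T.tsum_concat)
  also have "\<dots> = (?A \<cdot> lax_mult s ts ?\<phi> ks (\<lambda>k. slab t ?K (\<lambda>e. tsum (tn s) (f k) (\<lambda>i. X i e))) ?e) \<cdot>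
      (tsumA C (tn s) ks (\<lambda>k. barA ts ?\<phi> (\<lambda>e'. swap s t (f k) ?K (\<lambda>i a. X i (a ## e'))) ?e)
       \<cdot> tsumA C (tn s) ks (\<lambda>k. lax_mult s ts ?\<phi> (f k) ?X ?e))"
    unfolding nat[symmetric] by simp
  also have "\<dots> = lax_mult s (t # ts) \<phi> ks (\<lambda>k e. tsum (tn s) (f k) (\<lambda>i. X i e)) e \<cdot>
      tsumA C (tn s) ks (\<lambda>k. lax_mult s (t # ts) \<phi> (f k) X e)"
    by (simp add: T.tsumA_cmp)
  finally show ?case .
qed (simp add: T.tsum_concat)

text \<open>That \<open>barO ts \<phi>\<close> respects the interchange of two tensors is proved by inserting the first
  coordinate: \<open>swap_hexagon\<close> for \<open>r\<close>, \<open>s\<close> and the tensor of that coordinate, between two applications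
  of naturality of \<open>lax_mult\<close>.\<close>
lemma lax_mult_interchange:
  assumes "r \<le> s" "\<forall>t\<in>set ts. s \<le> t" "\<And>i j e. X i j e \<in> Obj C"
  shows "barA ts \<phi> (\<lambda>e. swap r s is js (\<lambda>i j. X i j e)) e \<cdot>
      lax_mult r ts \<phi> is (\<lambda>i e. tsum (tn s) js (\<lambda>j. X i j e)) e
      \<cdot> tsumA C (tn r) is (\<lambda>i. lax_mult s ts \<phi> js (X i) e)
    = lax_mult s ts \<phi> js (\<lambda>j e. tsum (tn r) is (\<lambda>i. X i j e)) e \<cdot>
        tsumA C (tn s) js (\<lambda>j. lax_mult r ts \<phi> is (\<lambda>i. X i j) e)
      \<cdot> swap r s is js (\<lambda>i j. barO ts \<phi> (X i j) e)"
  using assms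
proof (induction ts arbitrary: \<phi> X e)
  case (Cons t ts)
  let ?K = "slice (\<phi> 0) (e 0)" and ?e = "\<lambda>i. e (Suc i)" and ?\<phi> = "\<lambda>i. \<phi> (Suc i)"
  let ?Y = "\<lambda>i j. slab t ?K (X i j)"
  note [simp] = Cons.prems
  have t [simp]: "s \<le> t" "r \<le> t" "\<forall>t\<in>set ts. r \<le> t"
    using Cons.prems(1,2) order_trans[of r s] by auto
  let ?RS = "\<lambda>e'. tsumA C (tn t) ?K (\<lambda>a. swap r s is js (\<lambda>i j. X i j (a ## e')))"
  let ?RT = "\<lambda>e'. swap r t is ?K (\<lambda>i a. tsum (tn s) js (\<lambda>j. X i j (a ## e')))"
  let ?ST = "\<lambda>i e'. swap s t js ?K (\<lambda>j a. X i j (a ## e'))"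
  let ?ST' = "\<lambda>e'. swap s t js ?K (\<lambda>j a. tsum (tn r) is (\<lambda>i. X i j (a ## e')))"
  let ?RT' = "\<lambda>j e'. swap r t is ?K (\<lambda>i a. X i j (a ## e'))"
  let ?RS' = "\<lambda>e'. swap r s is js (\<lambda>i j. ?Y i j e')"
  let ?Ms = "\<lambda>i. lax_mult s ts ?\<phi> js (?Y i) ?e" and ?Mr = "\<lambda>j. lax_mult r ts ?\<phi> is (\<lambda>i. ?Y i j) ?e"
  let ?MrA = "lax_mult r ts ?\<phi> is (\<lambda>i. slab t ?K (\<lambda>e. tsum (tn s) js (\<lambda>j. X i j e))) ?e"
  let ?MsA = "lax_mult s ts ?\<phi> js (\<lambda>j. slab t ?K (\<lambda>e. tsum (tn r) is (\<lambda>i. X i j e))) ?e"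
  let ?MrB = "lax_mult r ts ?\<phi> is (\<lambda>i e. tsum (tn s) js (\<lambda>j. ?Y i j e)) ?e"
  let ?MsB = "lax_mult s ts ?\<phi> js (\<lambda>j e. tsum (tn r) is (\<lambda>i. ?Y i j e)) ?e"
  let ?F = "\<lambda>h. barA ts ?\<phi> h ?e"
  let ?end = "swap r s is js (\<lambda>i j. barO ts ?\<phi> (?Y i j) ?e)"
  have nat1: "?MrA \<cdot> tsumA C (tn r) is (\<lambda>i. ?F (?ST i)) = ?F (\<lambda>e'. tsumA C (tn r) is (\<lambda>i. ?ST i e')) \<cdot> ?MrB"
    using lax_mult_natural[of ts r ?ST ?\<phi> "is" ?e] by simp
  have nat2: "?MsA \<cdot> tsumA C (tn s) js (\<lambda>j. ?F (?RT' j))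
      = ?F (\<lambda>e'. tsumA C (tn s) js (\<lambda>j. ?RT' j e')) \<cdot> ?MsB"
    using lax_mult_natural[of ts s ?RT' ?\<phi> js ?e] by simp
  have hex: "?RS e' \<cdot> ?RT e' \<cdot> tsumA C (tn r) is (\<lambda>i. ?ST i e')
      = ?ST' e' \<cdot> tsumA C (tn s) js (\<lambda>j. ?RT' j e') \<cdot> ?RS' e'" for e'
    using swap_hexagon[of r s t "\<lambda>i j a. X i j (a ## e')" js ?K "is"] by simp
  have IH: "?F ?RS' \<cdot> ?MrB \<cdot> tsumA C (tn r) is ?Ms = ?MsB \<cdot> tsumA C (tn s) js ?Mr \<cdot> ?end"
    using Cons.IH[of ?Y ?\<phi> ?e] by simp
  have "barA (t # ts) \<phi> (\<lambda>e. swap r s is js (\<lambda>i j. X i j e)) e \<cdot>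
      lax_mult r (t # ts) \<phi> is (\<lambda>i e. tsum (tn s) js (\<lambda>j. X i j e)) e
      \<cdot> tsumA C (tn r) is (\<lambda>i. lax_mult s (t # ts) \<phi> js (X i) e)
    = ?F ?RS \<cdot> ?F ?RT \<cdot> (?MrA \<cdot> tsumA C (tn r) is (\<lambda>i. ?F (?ST i))) \<cdot> tsumA C (tn r) is ?Ms"
    by (simp add: T.tsumA_cmp[symmetric])
  also have "\<dots> = (?F ?RS \<cdot> ?F ?RT \<cdot> ?F (\<lambda>e'. tsumA C (tn r) is (\<lambda>i. ?ST i e'))) \<cdot> ?MrB \<cdot>
      tsumA C (tn r) is ?Ms"
    unfolding nat1 by simp
  also have "?F ?RS \<cdot> ?F ?RT \<cdot> ?F (\<lambda>e'. tsumA C (tn r) is (\<lambda>i. ?ST i e'))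
     = ?F ?ST' \<cdot> ?F (\<lambda>e'. tsumA C (tn s) js (\<lambda>j. ?RT' j e')) \<cdot> ?F ?RS'"
    by (simp add: barA_cmp hex)
  also have "(?F ?ST' \<cdot> ?F (\<lambda>e'. tsumA C (tn s) js (\<lambda>j. ?RT' j e')) \<cdot> ?F ?RS') \<cdot> ?MrB \<cdot>
      tsumA C (tn r) is ?Ms
     = ?F ?ST' \<cdot> ?F (\<lambda>e'. tsumA C (tn s) js (\<lambda>j. ?RT' j e')) \<cdot> (?F ?RS' \<cdot> ?MrB \<cdot> tsumA C (tn r) is ?Ms)"
    by simp
  also have "\<dots> = ?F ?ST' \<cdot> (?F (\<lambda>e'. tsumA C (tn s) js (\<lambda>j. ?RT' j e')) \<cdot> ?MsB) \<cdot>
      tsumA C (tn s) js ?Mr \<cdot> ?end"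
    unfolding IH by simp
  also have "\<dots> = (?F ?ST' \<cdot> ?MsA) \<cdot> (tsumA C (tn s) js (\<lambda>j. ?F (?RT' j)) \<cdot> tsumA C (tn s) js ?Mr) \<cdot> ?end"
    unfolding nat2[symmetric] by simp
  also have "\<dots> = lax_mult s (t # ts) \<phi> js (\<lambda>j e. tsum (tn r) is (\<lambda>i. X i j e)) e \<cdot>
      tsumA C (tn s) js (\<lambda>j. lax_mult r (t # ts) \<phi> is (\<lambda>i. X i j) e)
      \<cdot> swap r s is js (\<lambda>i j. barO (t # ts) \<phi> (X i j) e)"
    by (simp add: T.tsumA_cmp)
  finally show ?case .
qed simp

lemma tsum_slice_slice [simp]:
  assumes "mono f" "mono g" "\<And>a. x a \<in> Obj C"
  shows "tsum (tn t) (slice g c) (\<lambda>b. tsum (tn t) (slice f b) x) = tsum (tn t) (slice (\<lambda>b. f (g b)) c) x"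
  unfolding concat_slice[OF assms(1,2), symmetric] using assms(3) by (simp add: T.tsum_concat)

lemma tsumA_slice_slice [simp]:
  assumes "mono f" "mono g" "\<And>a. x a \<in> Arr C"
  shows "tsumA C (tn t) (slice g c) (\<lambda>b. tsumA C (tn t) (slice f b) x)
      = tsumA C (tn t) (slice (\<lambda>b. f (g b)) c) x"
  unfolding concat_slice[OF assms(1,2), symmetric] using assms(3) by (simp add: T.tsumA_concat)

lemma laxator_simps [simp]:
  assumes "sorted_wrt (\<le>) ts" "\<And>i. mono (\<psi> i)" "\<And>i. mono (\<phi> i)" "\<And>e. X e \<in> Obj C"
  shows "laxator ts \<psi> \<phi> X e \<in> Arr C" "Dom C (laxator ts \<psi> \<phi> X e) = barO ts \<psi> (barO ts \<phi> X) e"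
    "Cod C (laxator ts \<psi> \<phi> X e) = barO ts (\<lambda>i b. \<phi> i (\<psi> i b)) X e"
  using assms by (induction ts arbitrary: \<psi> \<phi> X e) auto

lemma laxator_natural:
  assumes "sorted_wrt (\<le>) ts" "\<And>i. mono (\<psi> i)" "\<And>i. mono (\<phi> i)" "\<And>e. h e \<in> Arr C"
  shows "laxator ts \<psi> \<phi> (\<lambda>e. Cod C (h e)) e \<cdot> barA ts \<psi> (barA ts \<phi> h) e
    = barA ts (\<lambda>i b. \<phi> i (\<psi> i b)) h e \<cdot> laxator ts \<psi> \<phi> (\<lambda>e. Dom C (h e)) e"
  using assms
proof (induction ts arbitrary: \<psi> \<phi> h e)
  case (Cons t ts)
  let ?e = "\<lambda>i. e (Suc i)" and ?\<phi> = "\<lambda>i. \<phi> (Suc i)" and ?\<psi> = "\<lambda>i. \<psi> (Suc i)"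
  let ?K = "slice (\<lambda>b. \<phi> 0 (\<psi> 0 b)) (e 0)" and ?B = "slice (\<psi> 0) (e 0)"
  let ?k = "\<lambda>b. slabA t (slice (\<phi> 0) b) h"
  note [simp] = Cons.prems(2-)
  have t [simp]: "sorted_wrt (\<le>) ts" "\<forall>t'\<in>set ts. t \<le> t'" using Cons.prems(1) by auto
  let ?mC = "lax_mult t ts ?\<phi> ?B (\<lambda>b e. Cod C (?k b e))" and ?mD =
      "lax_mult t ts ?\<phi> ?B (\<lambda>b e. Dom C (?k b e))"
  have nat: "?mC e' \<cdot> tsumA C (tn t) ?B (\<lambda>b. barA ts ?\<phi> (?k b) e')
      = barA ts ?\<phi> (\<lambda>e. tsumA C (tn t) ?B (\<lambda>b. ?k b e)) e' \<cdot> ?mD e'" for e'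
    by (rule lax_mult_natural) simp_all
  have IH: "laxator ts ?\<psi> ?\<phi> (\<lambda>e. Cod C (slabA t ?K h e)) ?e \<cdot> barA ts ?\<psi> (barA ts ?\<phi> (slabA t ?K h)) ?e
    = barA ts (\<lambda>i b. ?\<phi> i (?\<psi> i b)) (slabA t ?K h) ?e \<cdot> laxator ts ?\<psi> ?\<phi> (\<lambda>e. Dom C (slabA t ?K h e)) ?e"
    by (rule Cons.IH) simp_all
  have "laxator (t # ts) \<psi> \<phi> (\<lambda>e. Cod C (h e)) e \<cdot> barA (t # ts) \<psi> (barA (t # ts) \<phi> h) e
    = laxator ts ?\<psi> ?\<phi> (\<lambda>e. Cod C (slabA t ?K h e)) ?e \<cdot> barA ts ?\<psi> (\<lambda>e'. ?mC e' \<cdot>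
        tsumA C (tn t) ?B (\<lambda>b. barA ts ?\<phi> (?k b) e')) ?e"
    by (simp add: barA_cmp[symmetric])
  also have "\<dots> = (laxator ts ?\<psi> ?\<phi> (\<lambda>e. Cod C (slabA t ?K h e)) ?e \<cdot>
      barA ts ?\<psi> (barA ts ?\<phi> (slabA t ?K h)) ?e) \<cdot> barA ts ?\<psi> ?mD ?e"
    unfolding nat by (simp add: barA_cmp[symmetric])
  also have "\<dots> = barA (t # ts) (\<lambda>i b. \<phi> i (\<psi> i b)) h e \<cdot> laxator (t # ts) \<psi> \<phi> (\<lambda>e. Dom C (h e)) e"
    unfolding IH by simp
  finally show ?case .
qed simp

lemma laxator_ident_left:
  assumes "sorted_wrt (\<le>) ts" "\<And>i. mono (\<phi> i)" "\<And>e. X e \<in> Obj C"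
  shows "laxator ts (\<lambda>i b. b) \<phi> X e = \<one> (barO ts \<phi> X e)"
  using assms by (induction ts arbitrary: \<phi> X e) (simp_all add: lax_mult_single monoI)

lemma laxator_ident_right:
  assumes "sorted_wrt (\<le>) ts" "\<And>i. mono (\<psi> i)" "\<And>e. X e \<in> Obj C"
  shows "laxator ts \<psi> (\<lambda>i b. b) X e = \<one> (barO ts \<psi> X e)"
  using assms by (induction ts arbitrary: \<psi> X e) (simp_all add: lax_mult_ident monoI)

text \<open>The constraint is a monoidal transformation for every tensor \<open>s\<close> below \<open>ts\<close>.  In the induction
  step the columns of the first coordinate are regrouped by \<open>swap_col_concat\<close>, and
  \<open>lax_mult_interchange\<close> is applied to \<open>s\<close> and the tensor of the first coordinate.\<close>
lemma laxator_lax_mult: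
  assumes "sorted_wrt (\<le>) ts" "\<forall>t\<in>set ts. s \<le> t" "\<And>i. mono (\<psi> i)" "\<And>i. mono (\<phi> i)" "\<And>i e. X i e \<in> Obj C"
  shows "laxator ts \<psi> \<phi> (\<lambda>e. tsum (tn s) is (\<lambda>i. X i e)) e \<cdot> barA ts \<psi> (lax_mult s ts \<phi> is X) e
      \<cdot> lax_mult s ts \<psi> is (\<lambda>i. barO ts \<phi> (X i)) e
    = lax_mult s ts (\<lambda>i b. \<phi> i (\<psi> i b)) is X e \<cdot> tsumA C (tn s) is (\<lambda>i. laxator ts \<psi> \<phi> (X i) e)"
  using assms
proof (induction ts arbitrary: \<psi> \<phi> X e)
  case (Cons t ts)
  let ?e = "\<lambda>i. e (Suc i)" and ?\<phi> = "\<lambda>i. \<phi> (Suc i)" and ?\<psi> = "\<lambda>i. \<psi> (Suc i)"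
  let ?\<phi>\<psi> = "\<lambda>i b. ?\<phi> i (?\<psi> i b)"
  let ?K = "slice (\<lambda>b. \<phi> 0 (\<psi> 0 b)) (e 0)" and ?B = "slice (\<psi> 0) (e 0)"
  let ?Y = "\<lambda>i b. slab t (slice (\<phi> 0) b) (X i)" and ?Z = "\<lambda>i. slab t ?K (X i)"
  note [simp] = Cons.prems(3-)
  have t [simp]: "sorted_wrt (\<le>) ts" "\<forall>t'\<in>set ts. t \<le> t'" "\<forall>t'\<in>set ts. s \<le> t'" "s \<le> t"
    using Cons.prems(1,2) by auto
  let ?P = "\<lambda>h. barA ts ?\<psi> h ?e"
  let ?SW = "\<lambda>b e'. swap s t is (slice (\<phi> 0) b) (\<lambda>i a. X i (a ## e'))"
  let ?SWK = "\<lambda>e'. swap s t is ?K (\<lambda>i a. X i (a ## e'))"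
  let ?SWB = "\<lambda>e'. swap s t is ?B (\<lambda>i b. barO ts ?\<phi> (?Y i b) e')"
  let ?MS = "\<lambda>b. lax_mult s ts ?\<phi> is (\<lambda>i. ?Y i b)" and ?MZ = "lax_mult s ts ?\<phi> is ?Z"
  let ?MT = "\<lambda>i. lax_mult t ts ?\<phi> ?B (?Y i)"
  let ?MTA = "lax_mult t ts ?\<phi> ?B (\<lambda>b. slab t (slice (\<phi> 0) b) (\<lambda>e. tsum (tn s) is (\<lambda>i. X i e)))"
  let ?MTB = "lax_mult t ts ?\<phi> ?B (\<lambda>b e. tsum (tn s) is (\<lambda>i. ?Y i b e))"
  let ?MSA = "lax_mult s ts ?\<psi> is (\<lambda>i e'. tsum (tn t) ?B (\<lambda>b. barO ts ?\<phi> (?Y i b) e')) ?e"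
  let ?MSB = "lax_mult s ts ?\<psi> is (\<lambda>i. barO ts ?\<phi> (?Z i)) ?e"
  let ?OA = "laxator ts ?\<psi> ?\<phi> (slab t ?K (\<lambda>e. tsum (tn s) is (\<lambda>i. X i e))) ?e"
  let ?OB = "laxator ts ?\<psi> ?\<phi> (\<lambda>e. tsum (tn s) is (\<lambda>i. ?Z i e)) ?e"
  have nat1: "?MTA e' \<cdot> tsumA C (tn t) ?B (\<lambda>b. barA ts ?\<phi> (?SW b) e')
     = barA ts ?\<phi> (\<lambda>e. tsumA C (tn t) ?B (\<lambda>b. ?SW b e)) e' \<cdot> ?MTB e'" for e'
    using lax_mult_natural[of ts t ?SW ?\<phi> ?B e'] by simp
  have mi: "?MTB e' \<cdot> tsumA C (tn t) ?B (\<lambda>b. ?MS b e') \<cdot> ?SWB e'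
     = barA ts ?\<phi> (\<lambda>e. swap s t is ?B (\<lambda>i b. ?Y i b e)) e' \<cdot> ?MZ e' \<cdot>
         tsumA C (tn s) is (\<lambda>i. ?MT i e')" for e'
    using lax_mult_interchange[of s t ts ?Y ?\<phi> "is" ?B e'] by simp
  have col: "tsumA C (tn t) ?B (\<lambda>b. ?SW b e') \<cdot> swap s t is ?B (\<lambda>i b. ?Y i b e') = ?SWK e'" for e'
    using swap_col_concat[of s t "\<lambda>i a. X i (a ## e')" "is" "slice (\<phi> 0)" ?B] by (simp add: concat_slice)
  have "?MTA e' \<cdot> tsumA C (tn t) ?B (\<lambda>b. barA ts ?\<phi> (?SW b) e' \<cdot> ?MS b e') \<cdot> ?SWB e'
     = (?MTA e' \<cdot> tsumA C (tn t) ?B (\<lambda>b. barA ts ?\<phi> (?SW b) e')) \<cdot> tsumA C (tn t) ?B (\<lambda>b. ?MS b e') \<cdot>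
         ?SWB e'" for e'
    by (simp add: T.tsumA_cmp[symmetric])
  also have "\<dots> e' = barA ts ?\<phi> (\<lambda>e. tsumA C (tn t) ?B (\<lambda>b. ?SW b e)) e' \<cdot>
     (?MTB e' \<cdot> tsumA C (tn t) ?B (\<lambda>b. ?MS b e') \<cdot> ?SWB e')" for e'
    unfolding nat1 by simp
  also have "\<dots> e' = (barA ts ?\<phi> (\<lambda>e. tsumA C (tn t) ?B (\<lambda>b. ?SW b e)) e' \<cdot>
      barA ts ?\<phi> (\<lambda>e. swap s t is ?B (\<lambda>i b. ?Y i b e)) e') \<cdot> ?MZ e' \<cdot>
          tsumA C (tn s) is (\<lambda>i. ?MT i e')" for e'
    unfolding mi by simp
  also have "\<dots> e' = barA ts ?\<phi> ?SWK e' \<cdot> ?MZ e' \<cdot> tsumA C (tn s) is (\<lambda>i. ?MT i e')" for e'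
    by (simp add: barA_cmp col)
  finally have mid: "?MTA e' \<cdot> tsumA C (tn t) ?B (\<lambda>b. barA ts ?\<phi> (?SW b) e' \<cdot> ?MS b e') \<cdot> ?SWB e'
     = barA ts ?\<phi> ?SWK e' \<cdot> ?MZ e' \<cdot> tsumA C (tn s) is (\<lambda>i. ?MT i e')" for e' .
  have nat2: "?OA \<cdot> ?P (barA ts ?\<phi> ?SWK) = barA ts ?\<phi>\<psi> ?SWK ?e \<cdot> ?OB"
    using laxator_natural[of ts ?\<psi> ?\<phi> ?SWK ?e] by simp
  have nat3: "?P (\<lambda>e'. tsumA C (tn s) is (\<lambda>i. ?MT i e')) \<cdot> ?MSA = ?MSB \<cdot> tsumA C (tn s) is (\<lambda>i. ?P (?MT i))"
    using lax_mult_natural[of ts s ?MT ?\<psi> "is" ?e] by simp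
  have IH: "?OB \<cdot> ?P ?MZ \<cdot> ?MSB = lax_mult s ts ?\<phi>\<psi> is ?Z ?e \<cdot>
      tsumA C (tn s) is (\<lambda>i. laxator ts ?\<psi> ?\<phi> (?Z i) ?e)"
    by (rule Cons.IH) simp_all
  have "laxator (t # ts) \<psi> \<phi> (\<lambda>e. tsum (tn s) is (\<lambda>i. X i e)) e \<cdot>
      barA (t # ts) \<psi> (lax_mult s (t # ts) \<phi> is X) e
      \<cdot> lax_mult s (t # ts) \<psi> is (\<lambda>i. barO (t # ts) \<phi> (X i)) e
     = ?OA \<cdot> ?P (\<lambda>e'. ?MTA e' \<cdot> tsumA C (tn t) ?B (\<lambda>b. barA ts ?\<phi> (?SW b) e' \<cdot> ?MS b e') \<cdot> ?SWB e') \<cdot> ?MSA"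
    by (simp add: barA_cmp[symmetric])
  also have "\<dots> = (?OA \<cdot> ?P (barA ts ?\<phi> ?SWK)) \<cdot> ?P ?MZ \<cdot> ?P (\<lambda>e'. tsumA C (tn s) is (\<lambda>i. ?MT i e')) \<cdot> ?MSA"
    unfolding mid by (simp add: barA_cmp[symmetric])
  also have "\<dots> = barA ts ?\<phi>\<psi> ?SWK ?e \<cdot> (?OB \<cdot> ?P ?MZ \<cdot> ?MSB) \<cdot> tsumA C (tn s) is (\<lambda>i. ?P (?MT i))"
    unfolding nat2 nat3 by simp
  also have "\<dots> = lax_mult s (t # ts) (\<lambda>i b. \<phi> i (\<psi> i b)) is X e \<cdot>
      tsumA C (tn s) is (\<lambda>i. laxator (t # ts) \<psi> \<phi> (X i) e)"
    unfolding IH by (simp add: T.tsumA_cmp[symmetric])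
  finally show ?case .
qed simp

text \<open>After naturality and the induction hypothesis, the two sides differ by an equation between
  ways of merging the tensors over the first coordinate through the remaining ones; this equation is
  \<open>laxator_lax_mult\<close> for the tensor of that coordinate itself.\<close>
theorem laxator_assoc:
  assumes "sorted_wrt (\<le>) ts" "\<And>i. mono (\<chi> i)" "\<And>i. mono (\<psi> i)" "\<And>i. mono (\<phi> i)" "\<And>e. X e \<in> Obj C"
  shows "laxator ts (\<lambda>i b. \<psi> i (\<chi> i b)) \<phi> X e \<cdot> laxator ts \<chi> \<psi> (barO ts \<phi> X) e
    = laxator ts \<chi> (\<lambda>i b. \<phi> i (\<psi> i b)) X e \<cdot> barA ts \<chi> (laxator ts \<psi> \<phi> X) e"
  using assms
proof (induction ts arbitrary: \<chi> \<psi> \<phi> X e)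
  case (Cons t ts)
  let ?e = "\<lambda>i. e (Suc i)" and ?\<phi> = "\<lambda>i. \<phi> (Suc i)" and ?\<psi> = "\<lambda>i. \<psi> (Suc i)" and ?\<chi> = "\<lambda>i. \<chi> (Suc i)"
  let ?\<phi>\<psi> = "\<lambda>i b. ?\<phi> i (?\<psi> i b)" and ?\<psi>\<chi> = "\<lambda>i b. ?\<psi> i (?\<chi> i b)"
  let ?K = "slice (\<lambda>b. \<phi> 0 (\<psi> 0 (\<chi> 0 b))) (e 0)"
  let ?L = "slice (\<lambda>b. \<psi> 0 (\<chi> 0 b)) (e 0)" and ?B = "slice (\<chi> 0) (e 0)"
  let ?Y = "\<lambda>b. slab t (slice (\<phi> 0) b) X" and ?Z = "slab t ?K X"
  let ?W = "\<lambda>c. slab t (slice (\<lambda>b. \<phi> 0 (\<psi> 0 b)) c) X"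
  note [simp] = Cons.prems(2-)
  have t [simp]: "sorted_wrt (\<le>) ts" "\<forall>t'\<in>set ts. t \<le> t'" using Cons.prems(1) by auto
  have mono [simp]: "mono (\<lambda>b. \<psi> i (\<chi> i b))" "mono (\<lambda>b. \<phi> i (\<psi> i b))" for i
    using Cons.prems(2-4) by (auto simp: mono_def)
  let ?P = "\<lambda>h. barA ts ?\<chi> h ?e"
  let ?OZ = "laxator ts ?\<chi> ?\<phi>\<psi> ?Z ?e" and ?oZ = "laxator ts ?\<psi> ?\<phi> ?Z"
  let ?M = "lax_mult t ts ?\<phi> ?L ?Y" and ?m = "\<lambda>c. lax_mult t ts ?\<phi> (slice (\<psi> 0) c) ?Y"
  let ?N = "lax_mult t ts ?\<psi> ?B (\<lambda>c e. tsum (tn t) (slice (\<psi> 0) c) (\<lambda>b. barO ts ?\<phi> (?Y b) e))"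
  have nat: "barA ts ?\<psi>\<chi> ?M ?e \<cdot> laxator ts ?\<chi> ?\<psi> (\<lambda>e. tsum (tn t) ?L (\<lambda>b. barO ts ?\<phi> (?Y b) e)) ?e
     = laxator ts ?\<chi> ?\<psi> (barO ts ?\<phi> ?Z) ?e \<cdot> ?P (barA ts ?\<psi> ?M)"
    using laxator_natural[of ts ?\<chi> ?\<psi> ?M ?e] by simp
  have IH: "laxator ts ?\<psi>\<chi> ?\<phi> ?Z ?e \<cdot> laxator ts ?\<chi> ?\<psi> (barO ts ?\<phi> ?Z) ?e = ?OZ \<cdot> ?P ?oZ"
    by (rule Cons.IH) simp_all
  have mid: "?oZ e' \<cdot> barA ts ?\<psi> ?M e' \<cdot> ?N e' = lax_mult t ts ?\<phi>\<psi> ?B ?W e' \<cdot>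
     tsumA C (tn t) ?B (\<lambda>c. laxator ts ?\<psi> ?\<phi> (?W c) e' \<cdot> barA ts ?\<psi> (?m c) e')" for e'
  proof -
    have cc: "?M = (\<lambda>e'. lax_mult t ts ?\<phi> ?B ?W e' \<cdot> tsumA C (tn t) ?B (\<lambda>c. ?m c e'))"
      using lax_mult_concat[of ts t ?Y ?\<phi> "slice (\<psi> 0)" ?B] by (intro ext) (simp add: concat_slice)
    have nt: "lax_mult t ts ?\<psi> ?B (\<lambda>c. barO ts ?\<phi> (?W c)) e' \<cdot> tsumA C (tn t) ?B (\<lambda>c. barA ts ?\<psi> (?m c) e')
       = barA ts ?\<psi> (\<lambda>e. tsumA C (tn t) ?B (\<lambda>c. ?m c e)) e' \<cdot> ?N e'"
      using lax_mult_natural[of ts t ?m ?\<psi> ?B e'] by simp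
    have omu: "?oZ e' \<cdot> barA ts ?\<psi> (lax_mult t ts ?\<phi> ?B ?W) e' \<cdot>
        lax_mult t ts ?\<psi> ?B (\<lambda>c. barO ts ?\<phi> (?W c)) e'
      = lax_mult t ts ?\<phi>\<psi> ?B ?W e' \<cdot> tsumA C (tn t) ?B (\<lambda>c. laxator ts ?\<psi> ?\<phi> (?W c) e')"
      using laxator_lax_mult[of ts t ?\<psi> ?\<phi> ?W ?B e'] by simp
    have "?oZ e' \<cdot> barA ts ?\<psi> ?M e' \<cdot> ?N e'
      = ?oZ e' \<cdot> barA ts ?\<psi> (lax_mult t ts ?\<phi> ?B ?W) e' \<cdot>
          (barA ts ?\<psi> (\<lambda>e. tsumA C (tn t) ?B (\<lambda>c. ?m c e)) e' \<cdot> ?N e')"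
      unfolding cc by (simp add: barA_cmp[symmetric])
    also have "\<dots> = (?oZ e' \<cdot> barA ts ?\<psi> (lax_mult t ts ?\<phi> ?B ?W) e' \<cdot>
        lax_mult t ts ?\<psi> ?B (\<lambda>c. barO ts ?\<phi> (?W c)) e') \<cdot>
        tsumA C (tn t) ?B (\<lambda>c. barA ts ?\<psi> (?m c) e')"
      unfolding nt[symmetric] by simp
    also have "\<dots> = lax_mult t ts ?\<phi>\<psi> ?B ?W e' \<cdot>
       tsumA C (tn t) ?B (\<lambda>c. laxator ts ?\<psi> ?\<phi> (?W c) e' \<cdot> barA ts ?\<psi> (?m c) e')"
      unfolding omu by (simp add: T.tsumA_cmp[symmetric])
    finally show ?thesis .
  qed
  have "laxator (t # ts) (\<lambda>i b. \<psi> i (\<chi> i b)) \<phi> X e \<cdot> laxator (t # ts) \<chi> \<psi> (barO (t # ts) \<phi> X) e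
     = laxator ts ?\<psi>\<chi> ?\<phi> ?Z ?e \<cdot>
       (barA ts ?\<psi>\<chi> ?M ?e \<cdot> laxator ts ?\<chi> ?\<psi> (\<lambda>e. tsum (tn t) ?L (\<lambda>b. barO ts ?\<phi> (?Y b) e)) ?e) \<cdot> ?P ?N"
    by simp
  also have "\<dots> = (laxator ts ?\<psi>\<chi> ?\<phi> ?Z ?e \<cdot> laxator ts ?\<chi> ?\<psi> (barO ts ?\<phi> ?Z) ?e) \<cdot>
      ?P (barA ts ?\<psi> ?M) \<cdot> ?P ?N"
    unfolding nat by simp
  also have "\<dots> = ?OZ \<cdot> ?P (\<lambda>e'. ?oZ e' \<cdot> barA ts ?\<psi> ?M e' \<cdot> ?N e')"
    unfolding IH by (simp add: barA_cmp[symmetric])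
  also have "\<dots> = laxator (t # ts) \<chi> (\<lambda>i b. \<phi> i (\<psi> i b)) X e \<cdot> barA (t # ts) \<chi> (laxator (t # ts) \<psi> \<phi> X) e"
    unfolding mid by (simp add: barA_cmp[symmetric])
  finally show ?case .
qed simp

end

section \<open>Families as lists in lexicographic order\<close>

primrec indices :: "nat list \<Rightarrow> (nat \<Rightarrow> nat) list" where
  "indices [] = [\<lambda>_. 0]"
| "indices (k # ks) = concat (map (\<lambda>a. map ((##) a) (indices ks)) [0..<k])"

lemma length_indices [simp]: "length (indices ks) = prod_list ks"
  by (induction ks) (simp_all add: length_concat o_def sum_list_triv)

lemma in_indices_Cons [simp]:
  "e \<in> set (indices (k # ks)) \<longleftrightarrow> e 0 < k \<and> (\<lambda>i. e (Suc i)) \<in> set (indices ks)"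
proof
  assume "e 0 < k \<and> (\<lambda>i. e (Suc i)) \<in> set (indices ks)"
  then show "e \<in> set (indices (k # ks))" using scons_eta[of e] by (auto intro!: bexI[of _ "e 0"] image_eqI)
qed auto

declare indices.simps(2) [simp del]

lemma chunks_Suc: "chunks (Suc k) r xs = take r xs # chunks k r (drop r xs)"
  by (simp add: chunks_def upt_conv_Cons[of 0
      "Suc k"] map_Suc_upt[symmetric] o_def add.commute del: upt_Suc)

lemma chunks_concat:
  "length yss = k \<Longrightarrow> (\<And>ys. ys \<in> set yss \<Longrightarrow> length ys = r) \<Longrightarrow> chunks k r (concat yss) = yss"
proof (induction yss arbitrary: k)
  case Nil then show ?case by (simp add: chunks_def)
next
  case (Cons ys yss) then show ?case by (auto simp: chunks_Suc)
qed

lemma concat_chunks: "length xs = k * r \<Longrightarrow> concat (chunks k r xs) = xs"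
proof (induction k arbitrary: xs)
  case 0 then show ?case by (simp add: chunks_def)
next
  case (Suc k) then show ?case by (simp add: chunks_Suc)
qed

lemma ex_unflat: "length xs = prod_list ks \<Longrightarrow> \<exists>X. map X (indices ks) = xs"
proof (induction ks arbitrary: xs)
  case Nil
  then show ?case by (intro exI[of _ "\<lambda>_. hd xs"]) (cases xs; simp)
next
  case (Cons k ks)
  let ?q = "prod_list ks"
  have "\<exists>Y. map Y (indices ks) = take ?q (drop (a * ?q) xs)" if "a < k" for a
  proof (rule Cons.IH)
    have "a * ?q + ?q \<le> k * ?q" using that mult_le_mono1[of "Suc a" k ?q] by simp
    then show "length (take ?q (drop (a * ?q) xs)) = ?q" using Cons.prems by simp
  qed
  then obtain Y where Y: "\<And>a. a < k \<Longrightarrow> map (Y a) (indices ks) = take ?q (drop (a * ?q) xs)"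
    by metis
  have "map (\<lambda>e. Y (e 0) (\<lambda>i. e (Suc i))) (indices (k # ks)) = concat (chunks k ?q xs)"
    by (auto simp: indices.simps(2) map_concat o_def chunks_def Y intro!: arg_cong[of _ _ concat])
  then show ?case using concat_chunks[of xs k ?q] Cons.prems by auto
qed

text \<open>The family with a given list of entries; the default value outside the box keeps total families
  of composable arrows composable everywhere.\<close>
definition unflat :: "'x \<Rightarrow> nat list \<Rightarrow> 'x list \<Rightarrow> (nat \<Rightarrow> nat) \<Rightarrow> 'x" where
  "unflat d ks xs = (SOME X. map X (indices ks) = xs \<and> (\<forall>e. e \<notin> set (indices ks) \<longrightarrow> X e = d))"

lemma unflat:
  assumes "length xs = prod_list ks"
  shows "map (unflat d ks xs) (indices ks) = xs" "e \<notin> set (indices ks) \<Longrightarrow> unflat d ks xs e = d"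
proof -
  obtain X where X: "map X (indices ks) = xs" using ex_unflat[OF assms] by auto
  have "\<exists>X. map X (indices ks) = xs \<and> (\<forall>e. e \<notin> set (indices ks) \<longrightarrow> X e = d)"
    using X by (intro exI[of _ "\<lambda>e. if e \<in> set (indices ks) then X e else d"]) auto
  from someI_ex[OF this] show "map (unflat d ks xs) (indices ks) = xs" 
    "e \<notin> set (indices ks) \<Longrightarrow> unflat d ks xs e = d"
    unfolding unflat_def by auto
qed

lemma unflat_mem:
  assumes "length xs = prod_list ks" "set xs \<subseteq> A" "d \<in> A"
  shows "unflat d ks xs e \<in> A"
proof (cases "e \<in> set (indices ks)")
  case True
  then have "unflat d ks xs e \<in> set (map (unflat d ks xs) (indices ks))" by simp
  then show ?thesis unfolding unflat(1)[OF assms(1)] using assms by auto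
next
  case False
  then show ?thesis using unflat(2)[OF assms(1)] assms(3) by simp
qed

definition glue :: "nat \<Rightarrow> (nat \<Rightarrow> nat) \<Rightarrow> nat \<Rightarrow> (nat \<Rightarrow> nat) \<Rightarrow> nat \<Rightarrow> nat" where
  "glue n e a e' = (\<lambda>j. if j < n then e j else if j = n then a else e' (j - n - 1))"

lemma glue_0: "glue 0 e a e' = a ## e'"
  by (rule ext) (simp add: glue_def scons_def split: nat.split)

lemma glue_Suc: "glue (Suc n) (b ## e) a = (\<lambda>e'. b ## glue n e a e')"
  by (intro ext) (simp add: glue_def scons_def split: nat.split)

lemma glue_upd [simp]: "(glue n e b e')(n := a) = glue n e a e'" "glue n e b e' n = b"
  by (auto simp: glue_def)

text \<open>The nested form in which \<open>nest_fnctr\<close> presents the coordinates around the one that is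
  acted on.\<close>
lemma indices_split: "indices (ks1 @ k # ks2)
   = concat (concat (map (\<lambda>e. map (\<lambda>a. map (glue (length ks1) e a) (indices ks2)) [0..<k]) (indices ks1)))"
proof (induction ks1)
  case Nil
  show ?case by (simp add: glue_0 indices.simps(2))
next
  case (Cons k1 ks1)
  have c: "concat (concat (concat xsss)) = concat (map (\<lambda>xss. concat (concat xss)) xsss)" for xsss ::
      "'x list list list list"
    by (induction xsss) auto
  show ?case
    by (simp add: Cons indices.simps(2) map_concat o_def glue_Suc c)
qed

lemma concat_concat': "concat (concat Z) = concat (map concat Z)"
  by (induction Z) auto

lemma nest_concat:
  assumes "length Z = p" "\<And>z. z \<in> set Z \<Longrightarrow> length z = k" "\<And>z y. z \<in> set Z \<Longrightarrow> y \<in> set z \<Longrightarrow> length y = q"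
  shows "map (chunks k q) (chunks p (k * q) (concat (concat Z))) = Z"
proof -
  have lc: "length (concat z) = k * q" if "z \<in> set Z" for z
    using assms(2)[OF that] assms(3)[OF that]
    by (simp add: length_concat sum_list_triv cong: map_cong)
  have "chunks p (k * q) (concat (concat Z)) = map concat Z"
    unfolding concat_concat' using assms(1) lc by (intro chunks_concat) auto
  then show ?thesis using assms by (auto intro!: map_idI chunks_concat)
qed

section \<open>The bar construction on families\<close>

declare op_cat_simps [simp del]

text \<open>Beyond \<open>l\<close> the map is continued with slope 1, so that extension takes identities to
  identities and composites to composites.\<close>
definition extend :: "simp_arr \<Rightarrow> nat \<Rightarrow> nat" where
  "extend = (\<lambda>(l, k, \<phi>) i. if i \<le> l then \<phi> i else k + (i - l))"

lemma mono_extend: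
  assumes "f \<in> Arr Delta_op"
  shows "mono (extend f)"
proof (cases f)
  case (fields l k \<phi>)
  then have le: "\<phi> i \<le> \<phi> j" if "i \<le> j" "j \<le> l" for i j
    using that assms by (auto simp: mono_on_def)
  have bd: "\<phi> i \<le> k" if "i \<le> l" for i
    using fields that assms by (auto simp: PiE_def Pi_def)
  show ?thesis
  proof
    fix x y :: nat assume "x \<le> y"
    then show "extend f x \<le> extend f y"
      using le[of x y] bd[of x] by (auto simp: fields extend_def)
  qed
qed

lemma extend_idt: "extend (Idt Delta_op k) = (\<lambda>b. b)"
  by (auto simp: extend_def)

lemma extend_cmp:
  assumes "f \<in> Arr Delta_op" "g \<in> Arr Delta_op" "Cod Delta_op f = Dom Delta_op g"
  shows "extend (Cmp Delta_op g f) = (\<lambda>b. extend f (extend g b))"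
  using assms by (cases f; cases g) (auto simp: extend_def compose_def PiE_def Pi_def intro!: ext)

lemma extend_le: "f \<in> Arr Delta_op \<Longrightarrow> b \<le> Cod Delta_op f \<Longrightarrow> extend f b \<le> Dom Delta_op f"
  by (cases f) (auto simp: extend_def PiE_def Pi_def)

definition coord_bar :: "('x \<Rightarrow> 'x \<Rightarrow> 'x) \<Rightarrow> 'x \<Rightarrow> nat \<Rightarrow> (nat \<Rightarrow> nat) \<Rightarrow> ((nat \<Rightarrow> nat) \<Rightarrow> 'x) \<Rightarrow> (nat \<Rightarrow> nat) \<Rightarrow>
    'x" where
  "coord_bar t u n g X e = foldr t (map (\<lambda>a. X (e(n := a))) (slice g (e n))) u"

lemma foldr_map2:
  assumes "length es = q"
  shows "foldr (map2 t) (map (\<lambda>a. map (h a) es) as) (replicate q u)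
      = map (\<lambda>e. foldr t (map (\<lambda>a. h a e) as) u) es"
  using assms by (induction as) (auto simp: map_replicate_const zip_map_map zip_same_conv_map)

lemma bar_list_pow:
  assumes "f \<in> Arr Delta_op" "length es = q" "k = Dom Delta_op f" "l = Cod Delta_op f"
  shows "bar_list (map2 t) (replicate q u) f (map (\<lambda>a. map (h a) es) [0..<k])
    = map (\<lambda>b. map (\<lambda>e. foldr t (map (\<lambda>a. h a e) (slice (extend f) b)) u) es) [0..<l]"
proof -
  obtain \<phi> where f: "f = (l, k, \<phi>)" using assms by (cases f) (auto)
  have "take (\<phi> (Suc b) - \<phi> b) (drop (\<phi> b) [0..<k]) = slice (extend f) b" if "b < l" for b
  proof -
    have "\<phi> b \<le> \<phi> (Suc b)" "\<phi> (Suc b) \<le> k" using assms(1) that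
      by (auto simp: f mono_on_def PiE_def Pi_def)
    then show ?thesis using that by (simp add: slice_def extend_def f drop_upt take_upt)
  qed
  then show ?thesis
    using assms(2) by (simp add: bar_list_def f take_map drop_map foldr_map2)
qed

text \<open>The reduced bar functor is only determined up to equality on its source, hence the
  hypothesis that all entries are objects, respectively arrows; on them it is the explicit functor
  \<open>bar_fnctr\<close> by uniqueness.\<close>
lemma bar_coord_map:
  assumes st: "strict_tensor C (if length ks1 < n then V else M)" and f: "(l, k, \<phi>) \<in> Arr Delta_op"
  defines "T \<equiv> if length ks1 < n then V else M"
  shows "(\<And>e. X e \<in> Obj C) \<Longrightarrow>
      onObj (bar_coord C V M n (ks1 @ k # ks2) (length ks1) (l, k, \<phi>)) (map X (indices (ks1 @ k # ks2)))
      = map (coord_bar (tens T) (unt T) (length ks1) (extend (l, k, \<phi>)) X) (indices (ks1 @ l # ks2))"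
    and "(\<And>e. h e \<in> Arr C) \<Longrightarrow>
      onArr (bar_coord C V M n (ks1 @ k # ks2) (length ks1) (l, k, \<phi>)) (map h (indices (ks1 @ k # ks2)))
      = map (coord_bar (tensA T) (Idt C (unt T)) (length ks1) (extend (l, k, \<phi>)) h) (indices (ks1 @ l
          # ks2))"
proof -
  let ?p = "prod_list ks1" and ?q = "prod_list ks2" and ?n = "length ks1"
  interpret T: strict_tensor C T using st unfolding T_def .
  interpret P: strict_tensor "pow_cat C ?q" "pow_tensor ?q T" by (rule T.strict_tensor_pow)
  let ?W = "reduced_bar (pow_cat C ?q) (pow_tensor ?q T) (l, k, \<phi>)"
  have W: "fnctr_eq (pow_cat (pow_cat C ?q) k) ?W (bar_fnctr (pow_cat C ?q) (pow_tensor ?q T) (l, k, \<phi>))"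
    using reduced_bar_unique[OF P.reduced_bar_is_reduced_bar P.bar_fnctr_is_reduced_bar f] by simp
  have bc: "bar_coord C V M n (ks1 @ k # ks2) ?n (l, k, \<phi>)
     = flatten_fnctr \<circ>\<^sub>F pow_fnctr ?W \<circ>\<^sub>F nest_fnctr ?p k ?q"
    by (simp add: bar_coord_def T_def Let_def)
  have idt: "Idt (pow_cat C ?q) (replicate ?q (unt T)) = replicate ?q (Idt C (unt T))"
    by simp
  have nest: "map (chunks k ?q) (chunks ?p (k * ?q) (map Y (indices (ks1 @ k # ks2))))
     = map (\<lambda>e. map (\<lambda>a. map (\<lambda>e'. Y (glue ?n e a e')) (indices ks2)) [0..<k]) (indices ks1)"
    for Y :: "(nat \<Rightarrow> nat) \<Rightarrow> 'x"
    by (simp add: indices_split map_concat o_def) (rule nest_concat; auto)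
  have flat: "concat (concat (map (\<lambda>e. map (\<lambda>b. map (\<lambda>e'. foldr t (map (\<lambda>a. Y (glue ?n e a e')) (slice
      g b)) u) (indices ks2)) [0..<l]) (indices ks1)))
     = map (coord_bar t u ?n g Y) (indices (ks1 @ l # ks2))"
    for Y :: "(nat \<Rightarrow> nat) \<Rightarrow> 'x" and t u g
    by (simp add: indices_split map_concat o_def coord_bar_def)
  show "onObj (bar_coord C V M n (ks1 @ k # ks2) ?n (l, k, \<phi>)) (map X (indices (ks1 @ k # ks2)))
      = map (coord_bar (tens T) (unt T) ?n (extend (l, k, \<phi>)) X) (indices (ks1 @ l # ks2))"
    if X: "\<And>e. X e \<in> Obj C" for X
  proof -
    have "onObj ?W (map (\<lambda>a. map (\<lambda>e'. X (glue ?n e a e')) (indices ks2)) [0..<k])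
        = map (\<lambda>b. map (\<lambda>e'. foldr (tens T) (map (\<lambda>a. X (glue ?n e a e')) (slice (extend (l, k, \<phi>))
            b)) (unt T)) (indices ks2)) [0..<l]" for e
    proof -
      have "map (\<lambda>a. map (\<lambda>e'. X (glue ?n e a e')) (indices ks2)) [0..<k] \<in> Obj (pow_cat (pow_cat C ?q) k)"
        using X by auto
      then have "onObj ?W (map (\<lambda>a. map (\<lambda>e'. X (glue ?n e a e')) (indices ks2)) [0..<k])
         = bar_list (map2 (tens T)) (replicate ?q (unt T)) (l, k, \<phi>) (map (\<lambda>a. map (\<lambda>e'. X (glue ?n e
             a e')) (indices ks2)) [0..<k])"
        using W by (simp add: fnctr_eq_def bar_fnctr_def pow_tensor_def del: pow_cat_simps)
      then show ?thesis using bar_list_pow[OF f, of "indices ks2" ?q k l "tens T" "unt T"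
          "\<lambda>a e'. X (glue ?n e a e')"] by simp
    qed
    moreover have "onObj (bar_coord C V M n (ks1 @ k # ks2) ?n (l, k, \<phi>)) (map X (indices (ks1 @ k # ks2)))
        = concat (concat (map (onObj ?W) (map (\<lambda>e. map (\<lambda>a. map (\<lambda>e'. X (glue ?n e a e')) (indices
            ks2)) [0..<k]) (indices ks1))))"
      unfolding bc nest[symmetric] by (simp add: comp_fnctr_def flatten_fnctr_def pow_fnctr_def
          nest_fnctr_def)
    ultimately show ?thesis by (simp add: o_def flat)
  qed
  show "onArr (bar_coord C V M n (ks1 @ k # ks2) ?n (l, k, \<phi>)) (map h (indices (ks1 @ k # ks2)))
      = map (coord_bar (tensA T) (Idt C (unt T)) ?n (extend (l, k, \<phi>)) h) (indices (ks1 @ l # ks2))"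
    if h: "\<And>e. h e \<in> Arr C" for h
  proof -
    have "onArr ?W (map (\<lambda>a. map (\<lambda>e'. h (glue ?n e a e')) (indices ks2)) [0..<k])
        = map (\<lambda>b. map (\<lambda>e'. foldr (tensA T) (map (\<lambda>a. h (glue ?n e a e')) (slice (extend (l, k, \<phi>))
            b)) (Idt C (unt T))) (indices ks2)) [0..<l]" for e
    proof -
      have "map (\<lambda>a. map (\<lambda>e'. h (glue ?n e a e')) (indices ks2)) [0..<k] \<in> Arr (pow_cat (pow_cat C ?q) k)"
        using h by auto
      then have "onArr ?W (map (\<lambda>a. map (\<lambda>e'. h (glue ?n e a e')) (indices ks2)) [0..<k])
         = bar_list (map2 (tensA T)) (replicate ?q (Idt C (unt T))) (l, k, \<phi>) (map (\<lambda>a. map (\<lambda>e'. h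
             (glue ?n e a e')) (indices ks2)) [0..<k])"
        using W by (simp add: fnctr_eq_def bar_fnctr_def pow_tensor_def idt del: pow_cat_simps)
      then show ?thesis using bar_list_pow[OF f, of "indices ks2" ?q k l "tensA T" "Idt C (unt T)"
          "\<lambda>a e'. h (glue ?n e a e')"] by simp
    qed
    moreover have "onArr (bar_coord C V M n (ks1 @ k # ks2) ?n (l, k, \<phi>)) (map h (indices (ks1 @ k # ks2)))
        = concat (concat (map (onArr ?W) (map (\<lambda>e. map (\<lambda>a. map (\<lambda>e'. h (glue ?n e a e')) (indices
            ks2)) [0..<k]) (indices ks1))))"
      unfolding bc nest[symmetric] by (simp add: comp_fnctr_def flatten_fnctr_def pow_fnctr_def
          nest_fnctr_def)
    ultimately show ?thesis by (simp add: o_def flat)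
  qed
qed

definition extends :: "simp_arr list \<Rightarrow> nat \<Rightarrow> nat \<Rightarrow> nat" where
  "extends fs = (\<lambda>i. if i < length fs then extend (fs ! i) else (\<lambda>b. b))"

lemma mono_extends: "set fs \<subseteq> Arr Delta_op \<Longrightarrow> mono (extends fs i)"
  using mono_extend[of "fs ! i"] nth_mem[of i fs] subsetD[of "set fs" "Arr Delta_op" "fs ! i"]
  by (simp add: extends_def monoI del: Delta_op_simps)

lemma extends_idt: "extends (map (Idt Delta_op) ks) = (\<lambda>i b. b)"
  by (auto simp: extends_def extend_idt simp del: Delta_op_simps intro!: ext)

lemma extends_cmp:
  assumes "set fs \<subseteq> Arr Delta_op" "set gs \<subseteq> Arr Delta_op" "map (Cod Delta_op) fs = map (Dom Delta_op) gs"
  shows "extends (map2 (Cmp Delta_op) gs fs) = (\<lambda>i b. extends fs i (extends gs i b))"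
proof (rule ext)
  fix i
  have len: "length fs = length gs" using assms(3) map_eq_imp_length_eq by blast
  show "extends (map2 (Cmp Delta_op) gs fs) i = (\<lambda>b. extends fs i (extends gs i b))"
  proof (cases "i < length gs")
    case True
    then have "Cod Delta_op (fs ! i) = Dom Delta_op (gs ! i)"
      using assms(3) len by (metis nth_map)
    moreover have "fs ! i \<in> Arr Delta_op" "gs ! i \<in> Arr Delta_op"
      using True len assms(1,2) nth_mem by (metis subsetD)+
    ultimately show ?thesis using True len extend_cmp[of "fs ! i" "gs ! i"]
      by (simp add: extends_def del: Delta_op_simps)
  qed (simp add: extends_def len)
qed

context interchange_family
begin

text \<open>The bar construction along the later coordinates does not see the first one.  This reconciles the
  recursion of \<open>barO\<close> with the coordinatewise iteration that defines \<open>multi_bar_arr\<close>.\<close>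
lemma coord_bar_Suc:
  "fold (\<lambda>i. coord_bar (t i) (u i) (Suc i) (g i)) is Y (a ## e)
    = fold (\<lambda>i. coord_bar (t i) (u i) i (g i)) is (\<lambda>e'. Y (a ## e')) e"
proof -
  have upd: "(a ## e)(Suc n := b) = a ## e(n := b)" for a b n and e :: "nat \<Rightarrow> nat"
    by (rule ext) (auto simp: scons_def split: nat.split)
  have "(\<lambda>e. fold (\<lambda>i. coord_bar (t i) (u i) (Suc i) (g i)) is Y (a ## e))
    = fold (\<lambda>i. coord_bar (t i) (u i) i (g i)) is (\<lambda>e'. Y (a ## e'))"
    by (induction "is" arbitrary: Y) (simp_all add: coord_bar_def[abs_def] upd)
  then show ?thesis by (rule fun_cong)
qed

lemma scons_upd0: "(b ## e)(0 := a) = a ## e"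
  by (rule ext) (simp add: scons_def split: nat.split)

lemma barO_fold:
  "barO ts \<phi> X = fold (\<lambda>i. coord_bar (tens (tn (ts ! i))) (unt (tn (ts ! i))) i (\<phi> i)) [0..<length ts] X"
proof (induction ts arbitrary: \<phi> X)
  case (Cons t ts)
  show ?case
  proof
    fix e
    have "fold (\<lambda>i. coord_bar (tens (tn ((t # ts) ! i))) (unt (tn ((t # ts) ! i))) i (\<phi> i))
        [0..<length (t # ts)] X (e 0 ## (\<lambda>i. e (Suc i)))
      = fold (\<lambda>i. coord_bar (tens (tn (ts ! i))) (unt (tn (ts ! i))) (Suc i) (\<phi> (Suc i))) [0..<length ts]
         (coord_bar (tens (tn t)) (unt (tn t)) 0 (\<phi> 0) X) (e 0 ## (\<lambda>i. e (Suc i)))"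
      by (simp add: upt_conv_Cons map_Suc_upt[symmetric] fold_map o_def del: upt_Suc scons_eta)
    also have "\<dots> = barO (t # ts) \<phi> X e"
      by (simp add: coord_bar_Suc Cons coord_bar_def[of _ _ 0] scons_upd0 tsum_def del: scons_eta)
    finally show "barO (t # ts) \<phi> X e = fold (\<lambda>i. coord_bar (tens (tn ((t # ts) ! i))) (unt (tn ((t #
        ts) ! i))) i (\<phi> i)) [0..<length (t # ts)] X e"
      by simp
  qed
qed (simp add: fun_eq_iff)

lemma barA_fold:
  "barA ts \<phi> h = fold (\<lambda>i. coord_bar (tensA (tn (ts ! i))) (Idt C (unt (tn (ts ! i)))) i (\<phi> i))
      [0..<length ts] h"
proof (induction ts arbitrary: \<phi> h)
  case (Cons t ts)
  show ?case
  proof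
    fix e
    have "fold (\<lambda>i. coord_bar (tensA (tn ((t # ts) ! i))) (Idt C (unt (tn ((t # ts) ! i)))) i (\<phi> i))
        [0..<length (t # ts)] h (e 0 ## (\<lambda>i. e (Suc i)))
      = fold (\<lambda>i. coord_bar (tensA (tn (ts ! i))) (Idt C (unt (tn (ts ! i)))) (Suc i) (\<phi> (Suc i)))
          [0..<length ts]
         (coord_bar (tensA (tn t)) (Idt C (unt (tn t))) 0 (\<phi> 0) h) (e 0 ## (\<lambda>i. e (Suc i)))"
      by (simp add: upt_conv_Cons map_Suc_upt[symmetric] fold_map o_def del: upt_Suc scons_eta)
    also have "\<dots> = barA (t # ts) \<phi> h e"
      by (simp add: coord_bar_Suc Cons coord_bar_def[of _ _ 0] scons_upd0 tsumA_def del: scons_eta)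
    finally show "barA (t # ts) \<phi> h e = fold (\<lambda>i. coord_bar (tensA (tn ((t # ts) ! i))) (Idt C (unt
        (tn ((t # ts) ! i)))) i (\<phi> i)) [0..<length (t # ts)] h e"
      by simp
  qed
qed (simp add: fun_eq_iff)

end

text \<open>Under this condition entries in the box \<open>ls\<close> depend only on entries in the box \<open>ks\<close>.  The
  congruence rules that follow from it permit replacing a family by another one with the same list of
  entries.\<close>
definition maps_box :: "nat list \<Rightarrow> nat list \<Rightarrow> (nat \<Rightarrow> nat \<Rightarrow> nat) \<Rightarrow> bool" where
  "maps_box ls ks \<phi> \<longleftrightarrow> length ls = length ks \<and> (\<forall>i < length ks. \<forall>b \<le> ls ! i. \<phi> i b \<le> ks ! i)"

lemma maps_box_Cons:
  "maps_box (l # ls) (k # ks) \<phi> \<longleftrightarrow> (\<forall>b\<le>l. \<phi> 0 b \<le> k) \<and> maps_box ls ks (\<lambda>i. \<phi> (Suc i))"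
  by (auto simp: maps_box_def less_Suc_eq_0_disj)

lemma maps_box_extends:
  "set fs \<subseteq> Arr Delta_op \<Longrightarrow> maps_box (map (Cod Delta_op) fs) (map (Dom Delta_op) fs) (extends fs)"
  by (auto simp: maps_box_def extends_def intro!: extend_le dest: nth_mem simp del: Delta_op_simps)

lemma slice_bound:
  assumes "\<forall>b\<le>l. f b \<le> k" "b < l" "a \<in> set (slice f b)"
  shows "a < k"
  using assms by (auto simp: slice_def Suc_le_eq dest: spec[of _ "Suc b"])

context interchange_family
begin

lemma barA_cong:
  assumes "maps_box ls ks \<phi>" "length ts = length ks" "\<And>e. e \<in> set (indices ks) \<Longrightarrow> X e = Y e" "e
      \<in> set (indices ls)"
  shows "barA ts \<phi> X e = barA ts \<phi> Y e"
  using assms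
proof (induction ts arbitrary: ls ks \<phi> X Y e)
  case Nil then show ?case by (simp add: maps_box_def)
next
  case (Cons t ts)
  from Cons.prems(1,2) obtain k ks' l ls' where ks: "ks = k # ks'" "ls = l # ls'"
    by (cases ks; cases ls) (auto simp: maps_box_def)
  have e: "e 0 < l" "(\<lambda>i. e (Suc i)) \<in> set (indices ls')" and \<phi>: "\<forall>b\<le>l. \<phi> 0 b \<le> k"
      "maps_box ls' ks' (\<lambda>i. \<phi> (Suc i))"
    using Cons.prems(1,4) by (auto simp: ks maps_box_Cons)
  have "barA ts (\<lambda>i. \<phi> (Suc i)) (slabA t (slice (\<phi> 0) (e 0)) X) (\<lambda>i. e (Suc i))
      = barA ts (\<lambda>i. \<phi> (Suc i)) (slabA t (slice (\<phi> 0) (e 0)) Y) (\<lambda>i. e (Suc i))"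
    using Cons.prems(2,3) slice_bound[OF \<phi>(1) e(1)]
    by (intro Cons.IH[OF \<phi>(2) _ _ e(2)] tsumA_cong) (auto simp: ks)
  then show ?case by simp
qed

lemma lax_mult_cong:
  assumes "maps_box ls ks \<phi>" "length ts = length ks"
    "\<And>i e. i \<in> set is \<Longrightarrow> e \<in> set (indices ks) \<Longrightarrow> X i e = Y i e" "e \<in> set (indices ls)"
  shows "lax_mult s ts \<phi> is X e = lax_mult s ts \<phi> is Y e"
  using assms
proof (induction ts arbitrary: ls ks \<phi> X Y e)
  case Nil then show ?case by (auto simp: maps_box_def intro!: arg_cong[of _ _ "Idt C"] tsum_cong)
next
  case (Cons t ts)
  from Cons.prems(1,2) obtain k ks' l ls' where ks: "ks = k # ks'" "ls = l # ls'"
    by (cases ks; cases ls) (auto simp: maps_box_def)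
  have e: "e 0 < l" "(\<lambda>i. e (Suc i)) \<in> set (indices ls')" and \<phi>: "\<forall>b\<le>l. \<phi> 0 b \<le> k"
      "maps_box ls' ks' (\<lambda>i. \<phi> (Suc i))"
    using Cons.prems(1,4) by (auto simp: ks maps_box_Cons)
  have "barA ts (\<lambda>i. \<phi> (Suc i)) (\<lambda>e'. swap s t is (slice (\<phi> 0) (e 0)) (\<lambda>i a. X i (a ## e'))) (\<lambda>i. e (Suc i))
      = barA ts (\<lambda>i. \<phi> (Suc i)) (\<lambda>e'. swap s t is (slice (\<phi> 0) (e 0)) (\<lambda>i a. Y i (a ## e'))) (\<lambda>i. e
          (Suc i))"
    using Cons.prems(2,3) slice_bound[OF \<phi>(1) e(1)]
    by (intro barA_cong[OF \<phi>(2) _ _ e(2)] swap_cong) (auto simp: ks)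
  moreover have "lax_mult s ts (\<lambda>i. \<phi> (Suc i)) is (\<lambda>i. slab t (slice (\<phi> 0) (e 0)) (X i)) (\<lambda>i. e (Suc i))
      = lax_mult s ts (\<lambda>i. \<phi> (Suc i)) is (\<lambda>i. slab t (slice (\<phi> 0) (e 0)) (Y i)) (\<lambda>i. e (Suc i))"
    using Cons.prems(2,3) slice_bound[OF \<phi>(1) e(1)]
    by (intro Cons.IH[OF \<phi>(2) _ _ e(2)] tsum_cong) (auto simp: ks)
  ultimately show ?case by simp
qed

lemma laxator_cong:
  assumes "maps_box ms ls \<psi>" "maps_box ls ks \<phi>" "length ts = length ks"
    "\<And>e. e \<in> set (indices ks) \<Longrightarrow> X e = Y e" "e \<in> set (indices ms)"
  shows "laxator ts \<psi> \<phi> X e = laxator ts \<psi> \<phi> Y e"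
  using assms
proof (induction ts arbitrary: ms ls ks \<psi> \<phi> X Y e)
  case Nil then show ?case by (simp add: maps_box_def)
next
  case (Cons t ts)
  from Cons.prems(1,2,3) obtain k ks' l ls' m ms' where ks: "ks = k # ks'" "ls = l # ls'" "ms = m # ms'"
    by (cases ks; cases ls; cases ms) (auto simp: maps_box_def)
  have e: "e 0 < m" "(\<lambda>i. e (Suc i)) \<in> set (indices ms')" and \<phi>: "\<forall>b\<le>l. \<phi> 0 b \<le> k"
      "maps_box ls' ks' (\<lambda>i. \<phi> (Suc i))"
    and \<psi>: "\<forall>b\<le>m. \<psi> 0 b \<le> l" "maps_box ms' ls' (\<lambda>i. \<psi> (Suc i))"
    using Cons.prems(1,2,5) by (auto simp: ks maps_box_Cons)
  have \<phi>\<psi>: "\<forall>b\<le>m. \<phi> 0 (\<psi> 0 b) \<le> k" using \<phi>(1) \<psi>(1) by auto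
  have len: "length ts = length ls'" using Cons.prems(2,3) by (simp add: ks maps_box_def)
  have "laxator ts (\<lambda>i. \<psi> (Suc i)) (\<lambda>i. \<phi> (Suc i)) (slab t (slice (\<lambda>b. \<phi> 0 (\<psi> 0 b)) (e 0)) X) (\<lambda>i. e
      (Suc i))
     = laxator ts (\<lambda>i. \<psi> (Suc i)) (\<lambda>i. \<phi> (Suc i)) (slab t (slice (\<lambda>b. \<phi> 0 (\<psi> 0 b)) (e 0)) Y) (\<lambda>i. e
         (Suc i))"
    using Cons.prems(3,4) slice_bound[OF \<phi>\<psi> e(1)]
    by (intro Cons.IH[OF \<psi>(2) \<phi>(2) _ _ e(2)] tsum_cong) (auto simp: ks)
  moreover have "barA ts (\<lambda>i. \<psi> (Suc i))
         (lax_mult t ts (\<lambda>i. \<phi> (Suc i)) (slice (\<psi> 0) (e 0)) (\<lambda>b. slab t (slice (\<phi> 0) b) X)) (\<lambda>i. e (Suc i))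
     = barA ts (\<lambda>i. \<psi> (Suc i))
         (lax_mult t ts (\<lambda>i. \<phi> (Suc i)) (slice (\<psi> 0) (e 0)) (\<lambda>b. slab t (slice (\<phi> 0) b) Y)) (\<lambda>i. e (Suc i))"
    using Cons.prems(3,4) slice_bound[OF \<phi>(1) slice_bound[OF \<psi>(1) e(1)]]
    by (intro barA_cong[OF \<psi>(2) len _ e(2)] lax_mult_cong[OF \<phi>(2)] tsum_cong) (auto simp: ks)
  ultimately show ?case by simp
qed

end
text \<open>After the first \<open>i\<close> coordinates have been treated, the entries are indexed by the box with
  sides \<open>take i ls @ drop i ks\<close>; the induction on \<open>i\<close> follows the fold in \<open>multi_bar_arr\<close>.\<close>
lemma multi_bar_arr_map:
  fixes V M :: "('o, 'a) sym_mon" and tn :: "'t::order \<Rightarrow> ('o, 'a) sym_mon"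
  assumes fam: "interchange_family C tn swap"
    and ts: "\<And>i. i < length ts \<Longrightarrow> tn (ts ! i) = (if i < n then V else M)"
    and fs: "length fs = length ts" "set fs \<subseteq> Arr Delta_op"
  shows "(\<And>e. X e \<in> Obj C) \<Longrightarrow>
      onObj (multi_bar_arr C V M n fs) (map X (indices (map (Dom Delta_op) fs)))
      = map (interchange_family.barO tn ts (extends fs) X) (indices (map (Cod Delta_op) fs))"
    and "(\<And>e. h e \<in> Arr C) \<Longrightarrow>
      onArr (multi_bar_arr C V M n fs) (map h (indices (map (Dom Delta_op) fs)))
      = map (interchange_family.barA C tn ts (extends fs) h) (indices (map (Cod Delta_op) fs))"
proof -
  interpret interchange_family C tn swap by fact
  let ?ks = "map (Dom Delta_op) fs" and ?ls = "map (Cod Delta_op) fs"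
  let ?mid = "\<lambda>i. take i ?ls @ drop i ?ks"
  let ?F = "\<lambda>i. fold (\<lambda>i F. bar_coord C V M n (?mid i) i (fs ! i) \<circ>\<^sub>F F) [0..<i] id_fnctr"
  let ?O = "\<lambda>i. fold (\<lambda>i. coord_bar (tens (tn (ts ! i))) (unt (tn (ts ! i))) i (extends fs i)) [0..<i]"
  let ?A = "\<lambda>i. fold (\<lambda>i. coord_bar (tensA (tn (ts ! i))) (Idt C (unt (tn (ts ! i)))) i (extends fs
      i)) [0..<i]"
  have step: "(\<And>e. X e \<in> Obj C) \<Longrightarrow> onObj (bar_coord C V M n (?mid i) i (fs ! i)) (map X (indices (?mid i)))
      = map (coord_bar (tens (tn (ts ! i))) (unt (tn (ts ! i))) i (extends fs i) X) (indices (?mid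
          (Suc i)))"
    and stepA: "(\<And>e. h e \<in> Arr C) \<Longrightarrow> onArr (bar_coord C V M n (?mid i) i (fs ! i)) (map h (indices (?mid i)))
      = map (coord_bar (tensA (tn (ts ! i))) (Idt C (unt (tn (ts ! i)))) i (extends fs i) h) (indices
          (?mid (Suc i)))"
    if i: "i < length ts" for i X h
  proof -
    obtain l k \<phi> where f: "fs ! i = (l, k, \<phi>)" by (cases "fs ! i")
    have arr: "(l, k, \<phi>) \<in> Arr Delta_op" using subsetD[OF fs(2) nth_mem, of i] fs(1) i f
      by (simp del: Delta_op_simps)
    define ks1 ks2 where "ks1 = take i ?ls" and "ks2 = drop (Suc i) ?ks"
    have mid: "?mid i = ks1 @ k # ks2" "?mid (Suc i) = ks1 @ l # ks2" and len: "i = length ks1"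
      using i fs(1) f by (simp_all add: ks1_def ks2_def Cons_nth_drop_Suc[symmetric] take_Suc_conv_app_nth)
    have tn: "tn (ts ! i) = (if length ks1 < n then V else M)" using ts[OF i] len by simp
    have st: "strict_tensor C (if length ks1 < n then V else M)" using strict[of "ts ! i"] unfolding tn .
    have ext: "extends fs i = extend (l, k, \<phi>)" using i fs(1) f by (simp add: extends_def)
    show "onObj (bar_coord C V M n (?mid i) i (fs ! i)) (map X (indices (?mid i)))
      = map (coord_bar (tens (tn (ts ! i))) (unt (tn (ts ! i))) i (extends fs i) X) (indices (?mid
          (Suc i)))"
      if "\<And>e. X e \<in> Obj C"
      unfolding mid f tn ext using bar_coord_map(1)[OF st arr that] len by simp
    show "onArr (bar_coord C V M n (?mid i) i (fs ! i)) (map h (indices (?mid i)))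
      = map (coord_bar (tensA (tn (ts ! i))) (Idt C (unt (tn (ts ! i)))) i (extends fs i) h) (indices
          (?mid (Suc i)))"
      if "\<And>e. h e \<in> Arr C"
      unfolding mid f tn ext using bar_coord_map(2)[OF st arr that] len by simp
  qed
  have cl: "coord_bar (tens (tn t)) (unt (tn t)) i g X e \<in> Obj C" if "\<And>e. X e \<in> Obj C" for t i g X e
    using that T.tsum_obj[of "\<lambda>a. X (e(i := a))"] by (simp add: coord_bar_def tsum_def)
  have clA: "coord_bar (tensA (tn t)) (Idt C (unt (tn t))) i g h e \<in> Arr C" if "\<And>e. h e
      \<in> Arr C" for t i g h e
    using that T.tsumA_simps(1)[of "\<lambda>a. h (e(i := a))"] by (simp add: coord_bar_def tsumA_def)
  have "onObj (?F i) (map X (indices ?ks)) = map (?O i X) (indices (?mid i)) \<and> (\<forall>e. ?O i X e \<in> Obj C)"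
    if X: "\<And>e. X e \<in> Obj C" and "i \<le> length ts" for X i
    using that(2)
  proof (induction i)
    case 0 then show ?case by (simp add: id_fnctr_def X)
  next
    case (Suc i)
    then have IH: "onObj (?F i) (map X (indices ?ks)) = map (?O i X) (indices (?mid i))" "\<And>e. ?O i X e
        \<in> Obj C" by auto
    have "onObj (?F (Suc i)) (map X (indices ?ks))
        = onObj (bar_coord C V M n (?mid i) i (fs ! i)) (map (?O i X) (indices (?mid i)))"
      using IH(1) by (simp add: comp_fnctr_def)
    also have "\<dots> = map (?O (Suc i) X) (indices (?mid (Suc i)))"
      using step[of i "?O i X"] IH(2) Suc.prems by simp
    finally show ?case using cl IH(2) by simp
  qed
  from this[of _ "length ts"] show "onObj (multi_bar_arr C V M n fs) (map X (indices ?ks))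
      = map (barO ts (extends fs) X) (indices ?ls)"
    if "\<And>e. X e \<in> Obj C" for X using that by (simp add: multi_bar_arr_def barO_fold fs(1) Let_def)
  have "onArr (?F i) (map h (indices ?ks)) = map (?A i h) (indices (?mid i)) \<and> (\<forall>e. ?A i h e \<in> Arr C)"
    if h: "\<And>e. h e \<in> Arr C" and "i \<le> length ts" for h i
    using that(2)
  proof (induction i)
    case 0 then show ?case by (simp add: id_fnctr_def h)
  next
    case (Suc i)
    then have IH: "onArr (?F i) (map h (indices ?ks)) = map (?A i h) (indices (?mid i))" "\<And>e. ?A i h e
        \<in> Arr C" by auto
    have "onArr (?F (Suc i)) (map h (indices ?ks))
        = onArr (bar_coord C V M n (?mid i) i (fs ! i)) (map (?A i h) (indices (?mid i)))"
      using IH(1) by (simp add: comp_fnctr_def)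
    also have "\<dots> = map (?A (Suc i) h) (indices (?mid (Suc i)))"
      using stepA[of i "?A i h"] IH(2) Suc.prems by simp
    finally show ?case using clA IH(2) by simp
  qed
  from this[of _ "length ts"] show "onArr (multi_bar_arr C V M n fs) (map h (indices ?ks))
      = map (barA ts (extends fs) h) (indices ?ls)"
    if "\<And>e. h e \<in> Arr C" for h using that by (simp add: multi_bar_arr_def barA_fold fs(1) Let_def)
qed

text \<open>With \<open>False\<close> for \<open>\<or>\<close> and \<open>True\<close> for \<open>\<and>\<close>, the triples \<open>r \<le> s \<le> t\<close> are those in which the
  \<open>\<or>\<close> come first, so two neighbours are equal and one of the four hexagons applies.\<close>
lemma SMI_interchange_family:
  fixes C :: "('o, 'a) cat"
  assumes "SMI_category C V M iota beta tau kappa" "strict_structure C V" "strict_structure C M"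
  shows "\<exists>swap. interchange_family C (\<lambda>s. if s then M else V) swap"
proof -
  interpret VM: symmetric_duoidal C V M iota beta tau kappa "symm V"
    by (rule SMI_duoidal(1)[OF assms])
  interpret MV: cosymmetric_duoidal C V M iota beta tau kappa "symm M"
    by (rule SMI_duoidal(2)[OF assms])
  interpret VV: symmetric_duoidal C V V VM.Sy.exchange "Idt C (unt V)" "Idt C (unt V)" "Idt C (unt V)"
      "symm V"
    by (rule VM.Sy.symmetric_duoidal_self)
  interpret MM: symmetric_duoidal C M M MV.Sy.exchange "Idt C (unt M)" "Idt C (unt M)" "Idt C (unt M)"
      "symm M"
    by (rule MV.Sy.symmetric_duoidal_self)
  define swap :: "bool \<Rightarrow> bool \<Rightarrow> nat list \<Rightarrow> nat list \<Rightarrow> (nat \<Rightarrow> nat \<Rightarrow> 'o) \<Rightarrow> 'a"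
    where "swap = (\<lambda>s t. if s then MV.Sy.self.interchange else if t then VM.interchange else
        VM.Sy.self.interchange)"
  have "interchange_family C (\<lambda>s. if s then M else V) swap"
  proof (intro interchange_family.intro interchange_family_axioms.intro)
    show "category C" by unfold_locales
  next
    show "strict_tensor C (if s then M else V)" for s
      using VM.S.strict_tensor_axioms VM.T.strict_tensor_axioms by simp
  next
    fix r s t :: bool and "is" js ks :: "nat list" and Z :: "nat \<Rightarrow> nat \<Rightarrow> nat \<Rightarrow> 'o"
    assume "r \<le> s" "s \<le> t" "\<And>i j k. Z i j k \<in> Obj C"
    then show "Cmp C (swap s t js ks (\<lambda>j k. tsum (if r then M else V) is (\<lambda>i. Z i j k)))
        (Cmp C (tsumA C (if s then M else V) js (\<lambda>j. swap r t is ks (\<lambda>i. Z i j)))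
        (swap r s is js (\<lambda>i j. tsum (if t then M else V) ks (Z i j))))
      = Cmp C (tsumA C (if t then M else V) ks (\<lambda>k. swap r s is js (\<lambda>i j. Z i j k)))
        (Cmp C (swap r t is ks (\<lambda>i k. tsum (if s then M else V) js (\<lambda>j. Z i j k)))
        (tsumA C (if r then M else V) is (\<lambda>i. swap s t js ks (Z i))))"
      using VM.interchange_hexagon[of Z js ks "is"] MV.interchange_hexagon[of Z js ks "is"]
        VV.interchange_hexagon[of Z js ks "is"] MM.interchange_hexagon[of Z js ks "is"]
      by (cases r; cases s; cases t) (simp_all add: swap_def)
  next
    fix s t :: bool and "is" js ks :: "nat list" and X :: "nat \<Rightarrow> nat \<Rightarrow> 'o" and f
    assume st: "s \<le> t" and X: "\<And>i j. X i j \<in> Obj C"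
    show "swap s t (concat (map f ks)) js X
      = Cmp C (swap s t ks js (\<lambda>k j. tsum (if s then M else V) (f k) (\<lambda>i. X i j)))
         (tsumA C (if s then M else V) ks (\<lambda>k. swap s t (f k) js X))"
      using st X VM.interchange_row_concat[of X f ks js] VM.Sy.self.interchange_row_concat[of X f ks
          js] MV.Sy.self.interchange_row_concat[of X f ks js]
      by (cases s; cases t) (simp_all add: swap_def)
    show "swap s t is (concat (map f ks)) X
      = Cmp C (tsumA C (if t then M else V) ks (\<lambda>k. swap s t is (f k) X))
          (swap s t is ks (\<lambda>i k. tsum (if t then M else V) (f k) (X i)))"
      using st X VM.interchange_col_concat[of X "is" f ks] VM.Sy.self.interchange_col_concat[of X
          "is" f ks] MV.Sy.self.interchange_col_concat[of X "is" f ks]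
      by (cases s; cases t) (simp_all add: swap_def)
  next
    fix s t :: bool and "is" js :: "nat list" and X :: "nat \<Rightarrow> nat \<Rightarrow> 'o" and i j
    assume st: "s \<le> t" and X: "\<And>i j. X i j \<in> Obj C"
    show "swap s t [i] js X = Idt C (tsum (if t then M else V) js (X i))"
      using st X VM.interchange_row_single[of X i js] VM.Sy.self.interchange_row_single[of X i js]
          MV.Sy.self.interchange_row_single[of X i js]
      by (cases s; cases t) (simp_all add: swap_def)
    show "swap s t is [j] X = Idt C (tsum (if s then M else V) is (\<lambda>i. X i j))"
      using st X VM.interchange_col_single[of X "is" j] VM.Sy.self.interchange_col_single[of X
          "is" j] MV.Sy.self.interchange_col_single[of X "is" j]
      by (cases s; cases t) (simp_all add: swap_def)
    show "swap s t is js X \<in> hom C (tsum (if s then M else V) is (\<lambda>i. tsum (if t then M else V) js (X i)))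
      (tsum (if t then M else V) js (\<lambda>j. tsum (if s then M else V) is (\<lambda>i. X i j)))"
      using st X by (cases s; cases t) (simp_all add: swap_def hom_iff)
  next
    fix s t :: bool and "is" js :: "nat list" and h :: "nat \<Rightarrow> nat \<Rightarrow> 'a"
    assume st: "s \<le> t" and h: "\<And>i j. h i j \<in> Arr C"
    show "Cmp C (swap s t is js (\<lambda>i j. Cod C (h i j))) (tsumA C (if s then M else V) is (\<lambda>i. tsumA C
        (if t then M else V) js (h i)))
      = Cmp C (tsumA C (if t then M else V) js (\<lambda>j. tsumA C (if s then M else V) is (\<lambda>i. h i j)))
          (swap s t is js (\<lambda>i j. Dom C (h i j)))"
      using st h VM.interchange_natural[of h "is" js] VM.Sy.self.interchange_natural[of h
          "is" js] MV.Sy.self.interchange_natural[of h "is" js]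
      by (cases s; cases t) (simp_all add: swap_def)
  next
    fix s t :: bool and "is" js :: "nat list" and X Y :: "nat \<Rightarrow> nat \<Rightarrow> 'o"
    assume eq: "\<And>i j. i \<in> set is \<Longrightarrow> j \<in> set js \<Longrightarrow> X i j = Y i j"
    show "swap s t is js X = swap s t is js Y"
      using VM.interchange_cong[of "is" js X Y] VM.Sy.self.interchange_cong[of "is" js X Y]
        MV.Sy.self.interchange_cong[of "is" js X Y] eq
      by (simp add: swap_def)
  qed
  then show ?thesis by blast
qed

lemma Delta_op_cmp:
  assumes "f \<in> Arr Delta_op" "g \<in> Arr Delta_op" "Cod Delta_op f = Dom Delta_op g"
  shows "Cmp Delta_op g f \<in> Arr Delta_op" "Dom Delta_op (Cmp Delta_op g f) = Dom Delta_op f"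
    "Cod Delta_op (Cmp Delta_op g f) = Cod Delta_op g"
  using assms by (cases f; cases g; auto simp: compose_def mono_on_def PiE_def Pi_def)+

lemma Delta_op_idt: "Idt Delta_op k \<in> Arr Delta_op"
    "Dom Delta_op (Idt Delta_op k) = k" "Cod Delta_op (Idt Delta_op k) = k"
  by (auto simp: mono_on_def)

lemma Delta_op_map2_cmp:
  assumes "length fs = length gs" "set fs \<subseteq> Arr Delta_op" "set gs \<subseteq> Arr Delta_op"
    "map (Cod Delta_op) fs = map (Dom Delta_op) gs"
  shows "set (map2 (Cmp Delta_op) gs fs) \<subseteq> Arr Delta_op \<and>
    map (Dom Delta_op) (map2 (Cmp Delta_op) gs fs) = map (Dom Delta_op) fs \<and>
    map (Cod Delta_op) (map2 (Cmp Delta_op) gs fs) = map (Cod Delta_op) gs"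
  using assms
  by (induction fs gs rule: list_induct2) (simp_all add: Delta_op_cmp del: Delta_op_simps)

lemma map2_map: "map2 f (map g xs) (map h xs) = map (\<lambda>x. f (g x) (h x)) xs"
  by (induction xs) auto

theorem mainTheorem2:
  fixes C :: "('o, 'a) cat"
    and V M :: "('o, 'a) sym_mon"
    and iota :: "'o \<Rightarrow> 'o \<Rightarrow> 'o \<Rightarrow> 'o \<Rightarrow> 'a"
    and beta tau kappa :: 'a
    and n m :: nat
  assumes "SMI_category C V M iota beta tau kappa"
    and "strict_structure C V"
    and "strict_structure C M"
    and "n + m \<ge> 1"
  shows "is_lax_functor_to_Cat (pow_cat Delta_op (n + m)) (multi_bar_obj C) (multi_bar_arr C V M n)"
proof -
  define tn where "tn = (\<lambda>s. if s then M else V)"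
  obtain swap where fam: "interchange_family C tn swap"
    unfolding tn_def using SMI_interchange_family[OF assms(1-3)] by blast
  interpret interchange_family C tn swap by (rule fam)
  let ?J = "pow_cat Delta_op (n + m)"
  let ?W = "multi_bar_arr C V M n"
  define ts where "ts = replicate n False @ replicate m True"
  have len: "length ts = n + m" by (simp add: ts_def)
  have sorted [simp]: "sorted_wrt (\<le>) ts"
  proof -
    have "sorted_wrt (\<le>) (replicate k x)" for k and x :: bool by (induction k) auto
    then show ?thesis by (simp add: ts_def sorted_wrt_append)
  qed
  have ts: "tn (ts ! i) = (if i < n then V else M)" if "i < length ts" for i
    using that by (simp add: ts_def tn_def nth_append)
  define dom cod where "dom = map (Dom Delta_op)" and "cod = map (Cod Delta_op)"
  have J: "Arr ?J = {fs. length fs = n + m \<and> set fs \<subseteq> Arr Delta_op}" "Dom ?J = dom" "Cod ?J = cod"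
    "Obj ?J = {ks. length ks = n + m}" "Idt ?J = map (Idt Delta_op)" "Cmp ?J = map2 (Cmp Delta_op)"
    by (simp_all add: dom_def cod_def)
  have P: "multi_bar_obj C ks = pow_cat C (prod_list ks)" for ks by (simp add: multi_bar_obj_def)
  have uV: "unt V \<in> Obj C" using T.unt_obj[of False] by (simp add: tn_def)
  have objE: "\<exists>X. xs = map X (indices ks) \<and> (\<forall>e. X e \<in> Obj C)" if "xs
      \<in> Obj (pow_cat C (prod_list ks))" for xs ks
    using that unflat(1)[of xs ks "unt V"] unflat_mem[of xs ks "Obj C" "unt V"] uV
    by (intro exI[of _ "unflat (unt V) ks xs"]) auto
  have arrE: "\<exists>h. hs = map h (indices ks) \<and> (\<forall>e. h e \<in> Arr C) \<and> (\<forall>e. e \<notin> set (indices ks) \<longrightarrow> h e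
      = Idt C (unt V))"
    if "hs \<in> Arr (pow_cat C (prod_list ks))" for hs ks
    using that unflat(1)[of hs ks "Idt C (unt V)"] unflat(2)[of hs ks _ "Idt C (unt V)"]
      unflat_mem[of hs ks "Arr C" "Idt C (unt V)"] uV
    by (intro exI[of _ "unflat (Idt C (unt V)) ks hs"]) auto
  \<comment> \<open>The constraint is computed on an extension of the list to a total family; by \<open>laxator_cong\<close>
    the choice of the extension is immaterial.\<close>
  define \<omega> where "\<omega> = (\<lambda>gs fs xs. map (laxator ts (extends gs) (extends fs) (unflat (unt V) (dom fs)
      xs)) (indices (cod gs)))"
  have WO: "onObj (?W fs) (map X (indices (dom fs))) = map (barO ts (extends fs) X) (indices (cod fs))"
    if "fs \<in> Arr ?J" "\<And>e. X e \<in> Obj C" for fs X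
    using multi_bar_arr_map(1)[OF fam ts, of fs X] that unfolding J dom_def cod_def by (simp add: len)
  have WA: "onArr (?W fs) (map h (indices (dom fs))) = map (barA ts (extends fs) h) (indices (cod fs))"
    if "fs \<in> Arr ?J" "\<And>e. h e \<in> Arr C" for fs h
    using multi_bar_arr_map(2)[OF fam ts, of fs h] that unfolding J dom_def cod_def by (simp add: len)
  have mono: "mono (extends fs i)" if "fs \<in> Arr ?J" for fs i
    using that mono_extends unfolding J by blast
  have box: "maps_box (cod fs) (dom fs) (extends fs)" if "fs \<in> Arr ?J" for fs
    using that maps_box_extends unfolding J dom_def cod_def by blast
  have W\<omega>: "\<omega> gs fs (map X (indices (dom fs)))
      = map (laxator ts (extends gs) (extends fs) X) (indices (cod gs))"
    if "fs \<in> Arr ?J" "gs \<in> Arr ?J" "cod fs = dom gs" for fs gs X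
  proof -
    have "unflat (unt V) (dom fs) (map X (indices (dom fs))) e = X e" if "e \<in> set (indices (dom fs))" for e
      using unflat(1)[of "map X (indices (dom fs))" "dom fs" "unt V"] that by simp
    moreover have "length ts = length (dom fs)" using that(1) unfolding J by (simp add: len dom_def)
    moreover have "maps_box (cod gs) (cod fs) (extends gs)" using box[OF that(2)] by (simp only: that(3))
    ultimately show ?thesis
      unfolding \<omega>_def by (intro map_cong[OF refl] laxator_cong[OF _ box[OF that(1)]])
  qed
  have cmp: "Cmp ?J gs fs \<in> Arr ?J" "dom (Cmp ?J gs fs) = dom fs" "cod (Cmp ?J gs fs) = cod gs"
    "extends (Cmp ?J gs fs) = (\<lambda>i b. extends fs i (extends gs i b))"
    if "fs \<in> Arr ?J" "gs \<in> Arr ?J" "cod fs = dom gs" for fs gs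
  proof -
    have fg: "length fs = n + m" "length gs = n + m" "set fs \<subseteq> Arr Delta_op" "set gs \<subseteq> Arr Delta_op"
      "map (Cod Delta_op) fs = map (Dom Delta_op) gs"
      using that unfolding J dom_def cod_def by blast+
    show "Cmp ?J gs fs \<in> Arr ?J" "dom (Cmp ?J gs fs) = dom fs" "cod (Cmp ?J gs fs) = cod gs"
      using Delta_op_map2_cmp[OF _ fg(3-5)] fg(1,2) unfolding J dom_def cod_def by auto
    show "extends (Cmp ?J gs fs) = (\<lambda>i b. extends fs i (extends gs i b))"
      unfolding J by (rule extends_cmp[OF fg(3-5)])
  qed
  have idt: "Idt ?J ks \<in> Arr ?J" "dom (Idt ?J ks) = ks" "cod (Idt ?J ks) = ks" "extends (Idt ?J ks)
      = (\<lambda>i b. b)"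
    if "ks \<in> Obj ?J" for ks
    using that extends_idt[of ks] unfolding J dom_def cod_def
    by (auto simp: Delta_op_idt o_def image_subset_iff simp del: Delta_op_simps)
  show ?thesis
    unfolding is_lax_functor_to_Cat_def
  proof (rule exI[of _ \<omega>], unfold lax_functor_to_Cat_with_def P J(2,3), intro conjI ballI impI)
    show "category (pow_cat C (prod_list ks))" for ks
      by (rule category_pow_cat) unfold_locales
  next
    fix fs assume fs: "fs \<in> Arr ?J"
    show "is_functor (pow_cat C (prod_list (dom fs))) (pow_cat C (prod_list (cod fs))) (?W fs)"
      unfolding is_functor_def
    proof (intro conjI ballI impI)
      fix xs assume "xs \<in> Obj (pow_cat C (prod_list (dom fs)))"
      then obtain X where X: "xs = map X (indices (dom fs))" "\<And>e. X e \<in> Obj C" using objE by blast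
      show "onObj (?W fs) xs \<in> Obj (pow_cat C (prod_list (cod fs)))"
        unfolding X(1) WO[OF fs X(2)] using X(2) by auto
      have "onArr (?W fs) (map (\<lambda>e. Idt C (X e)) (indices (dom fs)))
          = map (\<lambda>e. Idt C (barO ts (extends fs) X e)) (indices (cod fs))"
        using WA[OF fs, of "\<lambda>e. Idt C (X e)"] X(2) by simp
      then show "onArr (?W fs) (Idt (pow_cat C (prod_list (dom fs))) xs)
          = Idt (pow_cat C (prod_list (cod fs))) (onObj (?W fs) xs)"
        unfolding X(1) WO[OF fs X(2)] by (simp add: o_def)
    next
      fix xs assume "xs \<in> Arr (pow_cat C (prod_list (dom fs)))"
      then obtain h where h: "xs = map h (indices (dom fs))" "\<And>e. h e \<in> Arr C" using arrE by blast
      show "onArr (?W fs) xs \<in> hom (pow_cat C (prod_list (cod fs)))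
          (onObj (?W fs) (Dom (pow_cat C (prod_list (dom fs))) xs)) (onObj (?W fs) (Cod (pow_cat C
              (prod_list (dom fs))) xs))"
        unfolding h(1) WA[OF fs h(2)]
        using WO[OF fs, of "\<lambda>e. Dom C (h e)"] WO[OF fs, of "\<lambda>e. Cod C (h e)"] h(2)
            by (auto simp: hom_iff o_def)
    next
      fix xs ys assume a: "xs \<in> Arr (pow_cat C (prod_list (dom fs)))" "ys
          \<in> Arr (pow_cat C (prod_list (dom fs)))"
        "Cod (pow_cat C (prod_list (dom fs))) xs = Dom (pow_cat C (prod_list (dom fs))) ys"
      obtain f where f: "xs = map f (indices (dom fs))" "\<And>e. f e \<in> Arr C"
        "\<And>e. e \<notin> set (indices (dom fs)) \<Longrightarrow> f e = Idt C (unt V)" using arrE[OF a(1)] by blast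
      obtain g where g: "ys = map g (indices (dom fs))" "\<And>e. g e \<in> Arr C"
        "\<And>e. e \<notin> set (indices (dom fs)) \<Longrightarrow> g e = Idt C (unt V)" using arrE[OF a(2)] by blast
      have fg: "Cod C (f e) = Dom C (g e)" for e
        using a(3) f(3)[of e] g(3)[of e] uV unfolding f(1) g(1) by (cases "e \<in> set (indices (dom fs))") auto
      have "onArr (?W fs) (map (\<lambda>e. Cmp C (g e) (f e)) (indices (dom fs)))
         = map (\<lambda>e. Cmp C (barA ts (extends fs) g e) (barA ts (extends fs) f e)) (indices (cod fs))"
        using WA[OF fs, of "\<lambda>e. Cmp C (g e) (f e)"] f(2) g(2) fg by (simp add: barA_cmp)
      then show "onArr (?W fs) (Cmp (pow_cat C (prod_list (dom fs))) ys xs)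
         = Cmp (pow_cat C (prod_list (cod fs))) (onArr (?W fs) ys) (onArr (?W fs) xs)"
        unfolding f(1) g(1) WA[OF fs f(2)] WA[OF fs g(2)] by (simp add: map2_map)
    qed
  next
    fix ks assume ks: "ks \<in> Obj ?J"
    note i = idt[OF ks]
    show "fnctr_eq (pow_cat C (prod_list ks)) (?W (Idt ?J ks)) id_fnctr"
      unfolding fnctr_eq_def
    proof (intro conjI ballI)
      fix xs assume "xs \<in> Obj (pow_cat C (prod_list ks))"
      then obtain X where X: "xs = map X (indices ks)" "\<And>e. X e \<in> Obj C" using objE by blast
      show "onObj (?W (Idt ?J ks)) xs = onObj id_fnctr xs"
        using WO[OF i(1) X(2)] X(2) unfolding i(2-4) X(1) by (simp add: id_fnctr_def)
    next
      fix xs assume "xs \<in> Arr (pow_cat C (prod_list ks))"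
      then obtain h where h: "xs = map h (indices ks)" "\<And>e. h e \<in> Arr C" using arrE by blast
      show "onArr (?W (Idt ?J ks)) xs = onArr id_fnctr xs"
        using WA[OF i(1) h(2)] h(2) unfolding i(2-4) h(1) by (simp add: id_fnctr_def)
    qed
  next
    fix fs gs assume a: "fs \<in> Arr ?J" "gs \<in> Arr ?J" "cod fs = dom gs"
    note c = cmp[OF a]
    note m = mono[OF a(1)] mono[OF a(2)]
    have WOg: "onObj (?W gs) (map X (indices (cod fs))) = map (barO ts (extends gs) X) (indices (cod gs))"
      if "\<And>e. X e \<in> Obj C" for X
      using WO[OF a(2) that] by (simp add: a(3))
    have WAg: "onArr (?W gs) (map h (indices (cod fs))) = map (barA ts (extends gs) h) (indices (cod gs))"
      if "\<And>e. h e \<in> Arr C" for h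
      using WA[OF a(2) that] by (simp add: a(3))
    have WOc: "onObj (?W (Cmp ?J gs fs)) (map X (indices (dom fs)))
        = map (barO ts (\<lambda>i b. extends fs i (extends gs i b)) X) (indices (cod gs))"
      if "\<And>e. X e \<in> Obj C" for X
      using WO[OF c(1) that] by (simp only: c(2-4))
    have WAc: "onArr (?W (Cmp ?J gs fs)) (map h (indices (dom fs)))
        = map (barA ts (\<lambda>i b. extends fs i (extends gs i b)) h) (indices (cod gs))"
      if "\<And>e. h e \<in> Arr C" for h
      using WA[OF c(1) that] by (simp only: c(2-4))
    show "is_nat_trans (pow_cat C (prod_list (dom fs))) (pow_cat C (prod_list (cod gs)))
       (?W gs \<circ>\<^sub>F ?W fs) (?W (Cmp ?J gs fs)) (\<omega> gs fs)"
      unfolding is_nat_trans_def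
    proof (intro conjI ballI)
      fix xs assume "xs \<in> Obj (pow_cat C (prod_list (dom fs)))"
      then obtain X where X: "xs = map X (indices (dom fs))" "\<And>e. X e \<in> Obj C" using objE by blast
      have "onObj (?W gs \<circ>\<^sub>F ?W fs) xs = map (barO ts (extends gs) (barO ts (extends fs) X)) (indices
          (cod gs))"
        using WO[OF a(1) X(2)] X(2) by (simp add: comp_fnctr_def X(1) WOg)
      then show "\<omega> gs fs xs \<in> hom (pow_cat C (prod_list (cod gs))) (onObj (?W gs \<circ>\<^sub>F ?W fs) xs) (onObj
          (?W (Cmp ?J gs fs)) xs)"
        using X(2) m unfolding X(1) WOc[OF X(2)] W\<omega>[OF a] by (auto simp: hom_iff)
    next
      fix xs assume "xs \<in> Arr (pow_cat C (prod_list (dom fs)))"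
      then obtain h where h: "xs = map h (indices (dom fs))" "\<And>e. h e \<in> Arr C" using arrE by blast
      have FF: "onArr (?W gs \<circ>\<^sub>F ?W fs) xs = map (barA ts (extends gs) (barA ts (extends fs) h))
          (indices (cod gs))"
        using WA[OF a(1) h(2)] h(2) by (simp add: comp_fnctr_def h(1) WAg)
      have D: "Cod (pow_cat C (prod_list (dom fs))) xs = map (\<lambda>e. Cod C (h e)) (indices (dom fs))"
        "Dom (pow_cat C (prod_list (dom fs))) xs = map (\<lambda>e. Dom C (h e)) (indices (dom fs))"
        by (simp_all add: h(1))
      show "Cmp (pow_cat C (prod_list (cod gs))) (\<omega> gs fs (Cod (pow_cat C (prod_list (dom fs))) xs))
          (onArr (?W gs \<circ>\<^sub>F ?W fs) xs)
        = Cmp (pow_cat C (prod_list (cod gs))) (onArr (?W (Cmp ?J gs fs)) xs) (\<omega> gs fs (Dom (pow_cat C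
            (prod_list (dom fs))) xs))"
        unfolding FF D W\<omega>[OF a] unfolding h(1) WAc[OF h(2)]
        using laxator_natural[OF sorted m(2) m(1) h(2)] by (simp add: map2_map)
    qed
  next
    fix fs gs hs xs assume a: "fs \<in> Arr ?J" "gs \<in> Arr ?J" "hs \<in> Arr ?J" "cod fs = dom gs" "cod gs = dom hs"
      "xs \<in> Obj (pow_cat C (prod_list (dom fs)))"
    note c1 = cmp[OF a(1,2,4)] and c2 = cmp[OF a(2,3,5)]
    note m = mono[OF a(1)] mono[OF a(2)] mono[OF a(3)]
    obtain X where X: "xs = map X (indices (dom fs))" "\<And>e. X e \<in> Obj C" using objE[OF a(6)] by blast
    have 1: "\<omega> (Cmp ?J hs gs) fs xs = map (laxator ts (\<lambda>i b. extends gs i (extends hs i b)) (extends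
        fs) X) (indices (cod hs))"
      using W\<omega>[OF a(1) c2(1), of X] a(4) unfolding X(1) c2(2-4) by simp
    have "onObj (?W fs) xs = map (barO ts (extends fs) X) (indices (dom gs))"
      using WO[OF a(1) X(2)] unfolding X(1) a(4) .
    then have 2: "\<omega> hs gs (onObj (?W fs) xs) = map (laxator ts (extends hs) (extends gs) (barO ts
        (extends fs) X)) (indices (cod hs))"
      using W\<omega>[OF a(2,3,5), of "barO ts (extends fs) X"] by simp
    have 3: "\<omega> hs (Cmp ?J gs fs) xs = map (laxator ts (extends hs) (\<lambda>i b. extends fs i (extends gs i
        b)) X) (indices (cod hs))"
      using W\<omega>[OF c1(1) a(3), of X] a(5) unfolding X(1) c1(2-4) by simp
    have "\<omega> gs fs xs = map (laxator ts (extends gs) (extends fs) X) (indices (dom hs))"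
      using W\<omega>[OF a(1,2,4), of X] unfolding X(1) a(5) .
    then have 4: "onArr (?W hs) (\<omega> gs fs xs) = map (barA ts (extends hs) (laxator ts (extends gs)
        (extends fs) X)) (indices (cod hs))"
      using WA[OF a(3), of "laxator ts (extends gs) (extends fs) X"] X(2) m by simp
    show "Cmp (pow_cat C (prod_list (cod hs))) (\<omega> (Cmp ?J hs gs) fs xs) (\<omega> hs gs (onObj (?W fs) xs)) =
       Cmp (pow_cat C (prod_list (cod hs))) (\<omega> hs (Cmp ?J gs fs) xs) (onArr (?W hs) (\<omega> gs fs xs))"
      unfolding 1 2 3 4 using laxator_assoc[OF sorted m(3) m(2) m(1) X(2)] by (simp add: map2_map)
  next
    fix fs xs assume a: "fs \<in> Arr ?J" "xs \<in> Obj (pow_cat C (prod_list (dom fs)))"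
    obtain X where X: "xs = map X (indices (dom fs))" "\<And>e. X e \<in> Obj C" using objE[OF a(2)] by blast
    note m = mono[OF a(1)]
    have ob: "dom fs \<in> Obj ?J" "cod fs \<in> Obj ?J" using a(1) unfolding J dom_def cod_def by auto
    note i = idt[OF ob(1)] and j = idt[OF ob(2)]
    have "\<omega> (Idt ?J (cod fs)) fs xs = map (laxator ts (\<lambda>i b. b) (extends fs) X) (indices (cod fs))"
      using W\<omega>[OF a(1) j(1), of X] unfolding X(1) j(2-4) by simp
    then show "\<omega> (Idt ?J (cod fs)) fs xs = Idt (pow_cat C (prod_list (cod fs))) (onObj (?W fs) xs)"
      using WO[OF a(1) X(2)] laxator_ident_left[OF sorted m X(2)] by (simp add: X(1))
    have "\<omega> fs (Idt ?J (dom fs)) xs = map (laxator ts (extends fs) (\<lambda>i b. b) X) (indices (cod fs))"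
      using W\<omega>[OF i(1) a(1), of X] unfolding X(1) i(2-4) by simp
    then show "\<omega> fs (Idt ?J (dom fs)) xs = Idt (pow_cat C (prod_list (cod fs))) (onObj (?W fs) xs)"
      using WO[OF a(1) X(2)] laxator_ident_right[OF sorted m X(2)] by (simp add: X(1))
  qed
qed

end
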